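(* Let $D$ be a division ring with center $F$ and let $d$ be a positive integer. Assume that $N$ is a noncentral subnormal subgroup of $D^*$ (that is, $N\not\subseteq F$). If all additive commutators of the form $ac-ca$, where $a\in N$ and $c\in D$, are algebraic over $F$ of bounded degree $d$, then $[D:F]\le d^2$.
   Context: $D^*$ denotes the multiplicative group of $D$, and $[D:F]$ the dimension of $D$ as a vector space over $F$. A subgroup $N$ of a group $G$ is subnormal if there is a finite chain $N=N_r\trianglelefteq N_{r-1}\trianglelefteq\dots\trianglelefteq N_0=G$ with each term normal in the next larger one. Elements of a set are algebraic over $F$ of bounded degree $d$ if each such element $x$ is algebraic over $F$ with $[F(x):F]\le d$. *)

theory Defs
  imports "HOL-Algebra.Algebra"
begin

locale skew_field = ring R for R (structure) +
  assumes one_not_zero [simp]: "\<one> \<noteq> \<zero>"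
    and skew_field_Units: "Units R = carrier R - {\<zero>}"

definition ring_center :: "('a, 'b) ring_scheme \<Rightarrow> 'a set"
  where "ring_center R =
    {z \<in> carrier R. \<forall>x \<in> carrier R. z \<otimes>\<^bsub>R\<^esub> x = x \<otimes>\<^bsub>R\<^esub> z}"

definition subnormal :: "'a set \<Rightarrow> ('a, 'b) monoid_scheme \<Rightarrow> bool"
  where "subnormal N G \<longleftrightarrow>
    (\<exists>r (H :: nat \<Rightarrow> 'a set). H 0 = carrier G \<and> H r = N \<and>
       (\<forall>i<r. H (Suc i) \<lhd> G\<lparr>carrier := H i\<rparr>))"

text \<open>
  Here \<open>generate_field R (insert x K)\<close> is \<open>K(x)\<close>. Its defining closure conditions make sense in
  every ring, although the library only develops its theory over fields. The bound is an upper
  bound on a finite dimension: \<open>dimension n K E\<close> forces \<open>E\<close> to have a \<open>K\<close>-basis of length \<open>n\<close>.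
\<close>
definition (in ring) algebraic_deg_le :: "'a set \<Rightarrow> nat \<Rightarrow> 'a \<Rightarrow> bool"
  where "algebraic_deg_le K d x \<longleftrightarrow>
    (algebraic over K) x \<and> (\<exists>n\<le>d. dimension n K (generate_field R (insert x K)))"

lemma (in skew_field) ring_center_subfield: "subfield (ring_center R) R"
proof -
  have closed: "z \<in> carrier R" if "z \<in> ring_center R" for z
    using that unfolding ring_center_def by blast
  have comm: "z \<otimes> x = x \<otimes> z" if "z \<in> ring_center R" "x \<in> carrier R" for z x
    using that unfolding ring_center_def by blast
  have centralI: "z \<in> ring_center R"
    if "z \<in> carrier R" "\<And>x. x \<in> carrier R \<Longrightarrow> z \<otimes> x = x \<otimes> z" for z
    using that unfolding ring_center_def by blast
  have inv_central: "inv z \<in> ring_center R" if z: "z \<in> ring_center R" "z \<noteq> \<zero>" for z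
  proof (rule centralI)
    have zU: "z \<in> Units R" and zc: "z \<in> carrier R"
      using z closed skew_field_Units by auto
    show "inv z \<in> carrier R" using zU by simp
    fix x assume x: "x \<in> carrier R"
    have "inv z \<otimes> x = inv z \<otimes> (x \<otimes> z) \<otimes> inv z"
      using zU zc x by (simp add: m_assoc)
    also have "\<dots> = inv z \<otimes> (z \<otimes> x) \<otimes> inv z"
      by (simp only: comm[OF z(1) x])
    also have "\<dots> = x \<otimes> inv z"
      using zU zc x by (simp add: m_assoc[symmetric])
    finally show "inv z \<otimes> x = x \<otimes> inv z" .
  qed
  have sub: "subring (ring_center R) R"
  proof (rule subringI)
    show "ring_center R \<subseteq> carrier R" using closed by blast
    show "\<one> \<in> ring_center R" by (rule centralI) simp_all
  next
    fix h assume h: "h \<in> ring_center R"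
    show "\<ominus> h \<in> ring_center R"
      by (rule centralI) (simp_all add: closed[OF h] l_minus r_minus comm[OF h])
  next
    fix h1 h2 assume h: "h1 \<in> ring_center R" "h2 \<in> ring_center R"
    show "h1 \<oplus> h2 \<in> ring_center R"
      by (rule centralI) (simp_all add: h closed l_distr r_distr comm)
    show "h1 \<otimes> h2 \<in> ring_center R"
    proof (rule centralI)
      fix x assume x: "x \<in> carrier R"
      have "h1 \<otimes> h2 \<otimes> x = h1 \<otimes> (x \<otimes> h2)"
        using h x by (simp add: closed m_assoc comm[OF h(2) x])
      also have "\<dots> = h1 \<otimes> x \<otimes> h2"
        using h x by (simp add: closed m_assoc)
      also have "\<dots> = x \<otimes> (h1 \<otimes> h2)"
        using h x by (simp only: closed m_assoc comm[OF h(1) x])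
      finally show "h1 \<otimes> h2 \<otimes> x = x \<otimes> (h1 \<otimes> h2)" .
    qed (use h closed in simp)
  qed
  have subc: "subcring (ring_center R) R"
    by (rule subcringI[OF sub]) (rule comm, assumption, rule closed)
  show ?thesis
  proof (rule subfieldI[OF subc], intro equalityI subsetI)
    fix z assume "z \<in> Units (R\<lparr>carrier := ring_center R\<rparr>)"
    then obtain y where z: "z \<in> ring_center R" and "y \<in> ring_center R" "y \<otimes> z = \<one>"
      unfolding Units_def by auto
    then show "z \<in> ring_center R - {\<zero>}"
      using closed one_not_zero by (metis DiffI r_null singletonD)
  next
    fix z assume z: "z \<in> ring_center R - {\<zero>}"
    then have "z \<in> Units R" using skew_field_Units closed by blast
    then have "inv z \<otimes> z = \<one>" "z \<otimes> inv z = \<one>" by simp_all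
    then show "z \<in> Units (R\<lparr>carrier := ring_center R\<rparr>)"
      unfolding Units_def using z inv_central[of z] by auto
  qed
qed

lemma (in group) subnormal_imp_subgroup:
  assumes "subnormal N G"
  shows "subgroup N G"
proof -
  obtain r H where H: "H 0 = carrier G" "H r = N"
    "\<And>i. i < r \<Longrightarrow> H (Suc i) \<lhd> G\<lparr>carrier := H i\<rparr>"
    using assms unfolding subnormal_def by blast
  have "i \<le> r \<Longrightarrow> subgroup (H i) G" for i
  proof (induction i)
    case 0
    then show ?case using H(1) subgroup_self by simp
  next
    case (Suc i)
    then show ?case
      using incl_subgroup[of "H i" "H (Suc i)"] H(3)[of i] by (simp add: normal_imp_subgroup)
  qed
  then show ?thesis using H(2) by blast
qed

end

theory Submission
  imports Defs
begin

text \<open>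
  Fix a noncentral \<open>a \<in> N\<close> and a maximal commutative subset \<open>K\<close> of \<open>D\<close> containing \<open>a\<close>; it is a
  subfield equal to its own centralizer. View \<open>D\<close> as a left \<open>K\<close>-space on which \<open>D\<close> acts from the
  right. By Jacobson density the operators \<open>T v = \<Sum> k\<^sub>l v c\<^sub>l\<close> with \<open>k\<^sub>l \<in> K\<close> prescribe arbitrary
  values on finitely many independent vectors, and the commutator of \<open>T\<close> with right multiplication
  by \<open>a\<close> has the form \<open>v \<mapsto> \<Sum> k\<^sub>l v x\<^sub>l\<close>, where the \<open>x\<^sub>l\<close> are additive commutators of \<open>a\<close>.

  If \<open>D\<close> is not spanned by \<open>d\<close> vectors over \<open>K\<close>, some such commutator \<open>X\<close> has independent vectors
  \<open>v, X v, \<dots>, X^d v\<close>. For this one finds vectors \<open>u\<^sub>1, \<dots>, u\<^sub>k\<close> such that all the \<open>u\<^sub>i\<close> and \<open>u\<^sub>i a\<close>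
  are jointly independent, with \<open>k\<close> as large as the dimension permits, and chooses \<open>T\<close> so that \<open>X\<close>
  becomes an upper Hessenberg matrix. When the center \<open>F\<close> is infinite, the coefficients \<open>k\<^sub>l\<close> can be
  replaced one at a time by elements of \<open>F\<close> while keeping independence, because dependence is a
  polynomial condition; the result is an additive commutator of \<open>a\<close> of degree greater than \<open>d\<close>.
  Hence \<open>[D:K] \<le> d\<close>, which gives \<open>[K:F] \<le> d\<close> and \<open>[D:F] \<le> d\<^sup>2\<close>.

  When \<open>F\<close> is finite, the commutators satisfy \<open>x^M = x\<close> for a fixed \<open>M\<close>. The multilinear form of
  this identity passes to the operators and again bounds \<open>[D:K]\<close>, so \<open>D\<close> would be finite, contrary
  to Wedderburn's theorem.
\<close>

text \<open>For the commutator \<open>X\<close> of \<open>T\<close> with right multiplication by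
  \<open>a\<close>, the vector \<open>X u\<close> involves both \<open>T u\<close> and
  \<open>T (u a)\<close>. Its values can thus be prescribed freely where the \<open>u\<close> and
  the \<open>u a\<close> are independent together, and this is why pairs are sought. A system of
  pairs that cannot be extended forces \<open>a\<close> to act as a scalar modulo its span, and an
  element not commuting with \<open>a\<close> excludes this as long as the dimension leaves room.

  To reach exactly \<open>d\<^sup>2\<close>, a chain of length \<open>d + 1\<close> must be
  available in dimension \<open>d + 1\<close>. If this number is odd, the pairs leave one vector
  over, and the matrix has to be built around it.

  With central coefficients, \<open>X\<close> is right multiplication by a single commutator
  \<open>y\<close>. Then \<open>v, v y, ..., v y^d\<close> are independent over \<open>K\<close>,
  although \<open>1, y, ..., y^d\<close> satisfy a relation over \<open>F\<close>.

  For finite \<open>F\<close> no sharp bound is sought: any finite dimension makes \<open>D\<close>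
  finite. The exponent \<open>M\<close> can therefore be crude, one more than the factorial of a
  bound for the size of \<open>F(x)\<close>.\<close>

context ring
begin

text \<open>These library rules have a premise \<open>subfield K R\<close> with \<open>K\<close> free, which the simplifier would try to solve on
  every membership goal.\<close>

declare Span.simps [simp del] subring_props [simp del] Span_subgroup_props [simp del]
  Span_smult_closed [simp del] Span_m_inv_simprule [simp del]

section \<open>Indexed linear combinations, spans and independence\<close>

lemma Span_Nil [simp]: "Span K [] = {\<zero>}"
  and Span_Cons: "Span K (u # Us) = line_extension K u (Span K Us)"
  by (simp_all add: Span.simps)

text \<open>Scalars stand on the left throughout, since \<open>D\<close> is a left vector space over
  \<open>K\<close>. An index function takes the place of the coefficient lists of
  \<open>combine\<close>, so that single entries can be altered.\<close>

primrec lincomb :: "(nat \<Rightarrow> 'a) \<Rightarrow> (nat \<Rightarrow> 'a) \<Rightarrow> nat \<Rightarrow> 'a" where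
  "lincomb \<alpha> f 0 = \<zero>"
| "lincomb \<alpha> f (Suc n) = lincomb \<alpha> f n \<oplus> \<alpha> n \<otimes> f n"

lemma lincomb_closed [simp, intro]:
  "(\<And>i. i < n \<Longrightarrow> \<alpha> i \<in> carrier R) \<Longrightarrow> (\<And>i. i < n \<Longrightarrow> f i \<in> carrier R) \<Longrightarrow> lincomb \<alpha> f n \<in> carrier R"
  by (induction n) auto

lemma lincomb_cong:
  "(\<And>i. i < n \<Longrightarrow> \<alpha> i = \<beta> i) \<Longrightarrow> (\<And>i. i < n \<Longrightarrow> f i = g i) \<Longrightarrow> lincomb \<alpha> f n = lincomb \<beta> g n"
  by (induction n) auto

lemma lincomb_zero_left:
  "(\<And>i. i < n \<Longrightarrow> \<alpha> i = \<zero>) \<Longrightarrow> (\<And>i. i < n \<Longrightarrow> f i \<in> carrier R) \<Longrightarrow> lincomb \<alpha> f n = \<zero>"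
  by (induction n) auto

lemma lincomb_add_left:
  "(\<And>i. i < n \<Longrightarrow> \<alpha> i \<in> carrier R) \<Longrightarrow> (\<And>i. i < n \<Longrightarrow> \<beta> i \<in> carrier R) \<Longrightarrow>
   (\<And>i. i < n \<Longrightarrow> f i \<in> carrier R) \<Longrightarrow>
   lincomb (\<lambda>i. \<alpha> i \<oplus> \<beta> i) f n = lincomb \<alpha> f n \<oplus> lincomb \<beta> f n"
  by (induction n) (auto simp: l_distr a_ac)

lemma lincomb_add_right:
  "(\<And>i. i < n \<Longrightarrow> \<alpha> i \<in> carrier R) \<Longrightarrow> (\<And>i. i < n \<Longrightarrow> f i \<in> carrier R) \<Longrightarrow>
   (\<And>i. i < n \<Longrightarrow> g i \<in> carrier R) \<Longrightarrow>
   lincomb \<alpha> (\<lambda>i. f i \<oplus> g i) n = lincomb \<alpha> f n \<oplus> lincomb \<alpha> g n"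
  by (induction n) (auto simp: r_distr a_ac)

lemma lincomb_smult:
  "k \<in> carrier R \<Longrightarrow> (\<And>i. i < n \<Longrightarrow> \<alpha> i \<in> carrier R) \<Longrightarrow> (\<And>i. i < n \<Longrightarrow> f i \<in> carrier R) \<Longrightarrow>
   lincomb (\<lambda>i. k \<otimes> \<alpha> i) f n = k \<otimes> lincomb \<alpha> f n"
  by (induction n) (auto simp: r_distr m_assoc)

lemma lincomb_rmult:
  "c \<in> carrier R \<Longrightarrow> (\<And>i. i < n \<Longrightarrow> \<alpha> i \<in> carrier R) \<Longrightarrow> (\<And>i. i < n \<Longrightarrow> f i \<in> carrier R) \<Longrightarrow>
   lincomb \<alpha> (\<lambda>i. f i \<otimes> c) n = lincomb \<alpha> f n \<otimes> c"
  by (induction n) (auto simp: l_distr m_assoc)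

lemma lincomb_delta:
  "i < n \<Longrightarrow> (\<And>i. i < n \<Longrightarrow> f i \<in> carrier R) \<Longrightarrow> lincomb (\<lambda>j. if j = i then \<one> else \<zero>) f n = f i"
proof (induction n)
  case (Suc n)
  show ?case
  proof (cases "i = n")
    case True
    have "lincomb (\<lambda>j. if j = i then \<one> else \<zero>) f n = \<zero>"
      using True Suc.prems by (intro lincomb_zero_left) auto
    then show ?thesis using True Suc.prems by simp
  next
    case False
    then show ?thesis using Suc by simp
  qed
qed simp

text \<open>Serves the perturbation of a single \<open>u i\<close> in
  \<open>pair_comb_update\<close>.\<close>

lemma lincomb_update:
  "i < n \<Longrightarrow> (\<And>i. i < n \<Longrightarrow> \<alpha> i \<in> carrier R) \<Longrightarrow> (\<And>i. i < n \<Longrightarrow> f i \<in> carrier R) \<Longrightarrow> z \<in> carrier R \<Longrightarrow>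
   lincomb \<alpha> (f(i := f i \<oplus> z)) n = lincomb \<alpha> f n \<oplus> \<alpha> i \<otimes> z"
proof (induction n)
  case (Suc n)
  show ?case
  proof (cases "i = n")
    case True
    have "lincomb \<alpha> (f(i := f i \<oplus> z)) n = lincomb \<alpha> f n"
      using True by (intro lincomb_cong) auto
    then show ?thesis using True Suc.prems by (simp add: r_distr a_assoc del: fun_upd_apply) (simp add: r_distr a_assoc)
  next
    case False
    then show ?thesis using Suc by (simp add: a_ac)
  qed
qed simp

lemma lincomb_append:
  "(\<And>i. i < n + m \<Longrightarrow> \<alpha> i \<in> carrier R) \<Longrightarrow> (\<And>i. i < n + m \<Longrightarrow> f i \<in> carrier R) \<Longrightarrow>
   lincomb \<alpha> f (n + m) = lincomb \<alpha> f n \<oplus> lincomb (\<lambda>i. \<alpha> (n + i)) (\<lambda>i. f (n + i)) m"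
  by (induction m) (auto simp: a_assoc)

text \<open>The order is reversed so that passing from \<open>n\<close> to \<open>Suc n\<close> puts
  \<open>f n\<close> at the head, where the recursions for \<open>Span\<close> and
  \<open>independent\<close> act.\<close>

definition family :: "(nat \<Rightarrow> 'a) \<Rightarrow> nat \<Rightarrow> 'a list"
  where "family f n = map f (rev [0..<n])"

lemma family_simps [simp]: "family f 0 = []" "family f (Suc n) = f n # family f n"
  "length (family f n) = n" "set (family f n) = f ` {..<n}"
  by (auto simp: family_def)

lemma family_carrier: "(\<And>i. i < n \<Longrightarrow> f i \<in> carrier R) \<Longrightarrow> set (family f n) \<subseteq> carrier R"
  by auto

lemma family_cong: "(\<And>i. i < n \<Longrightarrow> f i = g i) \<Longrightarrow> family f n = family g n"
  by (induction n) auto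

lemma list_eq_family: "xs = family (\<lambda>i. rev xs ! i) (length xs)"
proof (induction xs)
  case (Cons a xs)
  have "family (\<lambda>i. rev (a # xs) ! i) (length xs) = family (\<lambda>i. rev xs ! i) (length xs)"
    by (rule family_cong) (simp add: nth_append)
  then show ?case using Cons by (simp add: nth_append)
qed simp

lemma family_append: "family (\<lambda>i. if i < n then f i else g (i - n)) (n + m) = family g m @ family f n"
proof (induction m)
  case 0
  show ?case by (simp, rule family_cong) simp
qed simp

lemma mem_Span_family:
  assumes "K \<subseteq> carrier R" "\<And>i. i < n \<Longrightarrow> f i \<in> carrier R"
  shows "x \<in> Span K (family f n) \<longleftrightarrow> (\<exists>\<alpha>. (\<forall>i<n. \<alpha> i \<in> K) \<and> x = lincomb \<alpha> f n)"
  using assms(2)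
proof (induction n arbitrary: x)
  case (Suc n)
  show ?case
  proof
    assume "x \<in> Span K (family f (Suc n))"
    then obtain k v where k: "k \<in> K" "v \<in> Span K (family f n)" "x = k \<otimes> f n \<oplus> v"
      by (auto simp: Span_Cons line_extension_mem_iff)
    obtain \<alpha> where a: "\<forall>i<n. \<alpha> i \<in> K" "v = lincomb \<alpha> f n" using k Suc by auto
    have e: "lincomb (\<alpha>(n := k)) f n = lincomb \<alpha> f n" by (rule lincomb_cong) auto
    have v: "v \<in> carrier R" unfolding a(2)
      by (rule lincomb_closed) (use a(1) assms(1) Suc.prems in auto)
    have kf: "k \<otimes> f n \<in> carrier R" using k(1) assms(1) Suc.prems by auto
    have "x = lincomb (\<alpha>(n := k)) f (Suc n)"
      using e a(2) k(3) a_comm[OF kf v] by simp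
    then show "\<exists>\<alpha>. (\<forall>i<Suc n. \<alpha> i \<in> K) \<and> x = lincomb \<alpha> f (Suc n)"
      using a k by (intro exI[of _ "\<alpha>(n := k)"]) (auto simp: less_Suc_eq)
  next
    assume "\<exists>\<alpha>. (\<forall>i<Suc n. \<alpha> i \<in> K) \<and> x = lincomb \<alpha> f (Suc n)"
    then obtain \<alpha> where a: "\<forall>i<Suc n. \<alpha> i \<in> K" "x = lincomb \<alpha> f (Suc n)" by auto
    have "lincomb \<alpha> f n \<in> Span K (family f n)" using Suc.IH[of "lincomb \<alpha> f n"] Suc.prems a(1) less_SucI by blast
    moreover have "x = \<alpha> n \<otimes> f n \<oplus> lincomb \<alpha> f n"
    proof -
      have "lincomb \<alpha> f n \<in> carrier R"
        by (rule lincomb_closed) (use a(1) assms(1) Suc.prems in auto)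
      moreover have "\<alpha> n \<otimes> f n \<in> carrier R"
        using a(1) assms(1) Suc.prems by auto
      ultimately show ?thesis using a(2) by (simp add: a_comm)
    qed
    ultimately show "x \<in> Span K (family f (Suc n))"
      using a by (auto simp: Span_Cons line_extension_mem_iff)
  qed
qed auto

lemma Span_familyI:
  assumes "K \<subseteq> carrier R" "\<And>i. i < n \<Longrightarrow> f i \<in> carrier R" "\<And>i. i < n \<Longrightarrow> \<alpha> i \<in> K"
  shows "lincomb \<alpha> f n \<in> Span K (family f n)"
proof -
  have "\<exists>\<beta>. (\<forall>i<n. \<beta> i \<in> K) \<and> lincomb \<alpha> f n = lincomb \<beta> f n"
    by (rule exI[of _ \<alpha>]) (simp add: assms(3))
  then show ?thesis by (subst mem_Span_family[OF assms(1,2)])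
qed

lemma Span_familyE:
  assumes "x \<in> Span K (family f n)" "K \<subseteq> carrier R" "\<And>i. i < n \<Longrightarrow> f i \<in> carrier R"
  obtains \<alpha> where "\<forall>i<n. \<alpha> i \<in> K" "x = lincomb \<alpha> f n"
proof -
  have "\<exists>\<alpha>. (\<forall>i<n. \<alpha> i \<in> K) \<and> x = lincomb \<alpha> f n"
    using assms(1) by (rule iffD1[OF mem_Span_family[OF assms(2,3)], rotated])
  then show thesis using that by auto
qed

lemma independent_Cons_iff:
  "independent K (u # Us) \<longleftrightarrow> u \<in> carrier R \<and> u \<notin> Span K Us \<and> independent K Us"
  using independent_backwards li_Cons by blast

lemma independent_family_iff:
  assumes "subfield K R" "\<And>i. i < n \<Longrightarrow> f i \<in> carrier R"
  shows "independent K (family f n) \<longleftrightarrow>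
    (\<forall>\<alpha>. (\<forall>i<n. \<alpha> i \<in> K) \<longrightarrow> lincomb \<alpha> f n = \<zero> \<longrightarrow> (\<forall>i<n. \<alpha> i = \<zero>))"
proof -
  have K: "K \<subseteq> carrier R" using subring_props(1)[OF assms(1)] .
  have pair_comb: "combine (family \<alpha> n) (family f n) = lincomb \<alpha> f n" if "\<forall>i<n. \<alpha> i \<in> K" for \<alpha>
    using that assms(2)
  proof (induction n)
    case (Suc n)
    have "lincomb \<alpha> f n \<in> carrier R" "\<alpha> n \<otimes> f n \<in> carrier R"
      using Suc.prems K by (auto simp: subset_iff)
    then show ?case using Suc by (simp add: a_comm)
  qed simp
  show ?thesis
  proof (intro iffI allI impI)
    fix \<alpha> i assume i: "independent K (family f n)" "\<forall>i<n. \<alpha> i \<in> K" "lincomb \<alpha> f n = \<zero>" "i < n"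
    have "set (family \<alpha> n) \<subseteq> K" using i by auto
    moreover have "combine (family \<alpha> n) (family f n) = \<zero>" using pair_comb i by simp
    ultimately have "set (take (length (family f n)) (family \<alpha> n)) \<subseteq> {\<zero>}"
      using independent_imp_trivial_combine[OF assms(1) i(1)] by blast
    then have "set (family \<alpha> n) \<subseteq> {\<zero>}" by (simp del: family_simps(4))
    then show "\<alpha> i = \<zero>" using i by auto
  next
    assume a: "\<forall>\<alpha>. (\<forall>i<n. \<alpha> i \<in> K) \<longrightarrow> lincomb \<alpha> f n = \<zero> \<longrightarrow> (\<forall>i<n. \<alpha> i = \<zero>)"
    show "independent K (family f n)"
    proof (rule trivial_combine_imp_independent[OF assms(1)])
      show "set (family f n) \<subseteq> carrier R" using assms(2) by auto
      fix Ks assume Ks: "set Ks \<subseteq> K" "combine Ks (family f n) = \<zero>"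
      show "set (take (length (family f n)) Ks) \<subseteq> {\<zero>}"
      proof -
        \<comment> \<open>\<open>combine\<close> ignores surplus entries of either list, so
          \<open>Ks\<close> is first cut or padded with zeros to length \<open>n\<close>.\<close>
        obtain Ks' where Ks': "set (take (length (family f n)) Ks) \<subseteq> set Ks'"
            "set Ks' \<subseteq> set (take (length (family f n)) Ks) \<union> { \<zero> }"
            "length Ks' = length (family f n)" "\<zero> = combine Ks' (family f n)"
          using combine_normalize[OF subset_trans[OF Ks(1) K] family_carrier[of n f, OF assms(2)] Ks(2)]
          by metis
        define \<alpha> where "\<alpha> = (\<lambda>i. rev Ks' ! i)"
        have e: "Ks' = family \<alpha> n" using list_eq_family[of Ks'] Ks'(3) unfolding \<alpha>_def by simp
        have K': "set Ks' \<subseteq> K"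
          using Ks'(2) Ks(1) subring_props(2)[OF assms(1)] by (auto dest: in_set_takeD)
        then have "\<forall>i<n. \<alpha> i \<in> K" using e by auto
        moreover from this have "lincomb \<alpha> f n = \<zero>" using pair_comb e Ks'(4) by simp
        ultimately have "\<forall>i<n. \<alpha> i = \<zero>" using a by blast
        then show ?thesis using Ks'(1) e by auto
      qed
    qed
  qed
qed

end

section \<open>Cancellation in a division ring\<close>

context skew_field
begin

lemma zero_not_one [simp]: "\<zero> \<noteq> \<one>"
  using one_not_zero by metis

lemma nonzero_Unit: "x \<in> carrier R \<Longrightarrow> x \<noteq> \<zero> \<Longrightarrow> x \<in> Units R"
  using skew_field_Units by auto

lemma inv_closed' [simp]: "x \<in> carrier R \<Longrightarrow> x \<noteq> \<zero> \<Longrightarrow> inv x \<in> carrier R"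
  using nonzero_Unit by auto

lemma inv_left [simp]: "x \<in> carrier R \<Longrightarrow> x \<noteq> \<zero> \<Longrightarrow> inv x \<otimes> x = \<one>"
  using nonzero_Unit by auto

lemma inv_right [simp]: "x \<in> carrier R \<Longrightarrow> x \<noteq> \<zero> \<Longrightarrow> x \<otimes> inv x = \<one>"
  using nonzero_Unit by auto

lemma inv_cancel1 [simp]:
  "x \<in> carrier R \<Longrightarrow> x \<noteq> \<zero> \<Longrightarrow> y \<in> carrier R \<Longrightarrow> inv x \<otimes> (x \<otimes> y) = y"
  by (simp add: m_assoc[symmetric])

lemma inv_cancel2 [simp]:
  "x \<in> carrier R \<Longrightarrow> x \<noteq> \<zero> \<Longrightarrow> y \<in> carrier R \<Longrightarrow> x \<otimes> (inv x \<otimes> y) = y"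
  by (simp add: m_assoc[symmetric])

lemma no_zero_divisors:
  assumes "x \<in> carrier R" "y \<in> carrier R" "x \<otimes> y = \<zero>"
  shows "x = \<zero> \<or> y = \<zero>"
proof (rule disjCI)
  assume "y \<noteq> \<zero>"
  then have "x = (x \<otimes> y) \<otimes> inv y" using assms(1,2) by (simp add: m_assoc)
  then show "x = \<zero>" using assms \<open>y \<noteq> \<zero>\<close> by simp
qed

lemma mult_eq_zero_iff [simp]:
  "x \<in> carrier R \<Longrightarrow> y \<in> carrier R \<Longrightarrow> x \<otimes> y = \<zero> \<longleftrightarrow> x = \<zero> \<or> y = \<zero>"
  using no_zero_divisors by auto

lemma inv_nonzero [simp]: "x \<in> carrier R \<Longrightarrow> x \<noteq> \<zero> \<Longrightarrow> inv x \<noteq> \<zero>"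
  using inv_right[of x] by fastforce

lemma minus_eq_zero_iff:
  "x \<in> carrier R \<Longrightarrow> y \<in> carrier R \<Longrightarrow> x \<ominus> y = \<zero> \<longleftrightarrow> x = y"
  using r_right_minus_eq by simp

subsection \<open>Centralizers\<close>

definition centralizer :: "'a set \<Rightarrow> 'a set"
  where "centralizer P = {z \<in> carrier R. \<forall>x\<in>P. z \<otimes> x = x \<otimes> z}"

lemma centralizerD: "z \<in> centralizer P \<Longrightarrow> z \<in> carrier R" "z \<in> centralizer P \<Longrightarrow> x \<in> P \<Longrightarrow> z \<otimes> x = x \<otimes> z"
  unfolding centralizer_def by auto

lemma centralizer_inv:
  assumes "z \<in> centralizer P" "z \<noteq> \<zero>" "P \<subseteq> carrier R"
  shows "inv z \<in> centralizer P"
proof -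
  have z: "z \<in> carrier R" using assms centralizerD by blast
  have "inv z \<otimes> x = x \<otimes> inv z" if "x \<in> P" for x
  proof -
    have x: "x \<in> carrier R" using that assms by blast
    have "inv z \<otimes> x = inv z \<otimes> (x \<otimes> z) \<otimes> inv z"
      using z x assms(2) by (simp add: m_assoc)
    also have "\<dots> = inv z \<otimes> (z \<otimes> x) \<otimes> inv z"
      using centralizerD(2)[OF assms(1) that] by simp
    also have "\<dots> = x \<otimes> inv z"
      using z x assms(2) by (simp add: m_assoc[symmetric])
    finally show ?thesis .
  qed
  then show ?thesis unfolding centralizer_def using z assms(2) by auto
qed

lemma centralizer_subring:
  assumes "P \<subseteq> carrier R"
  shows "subring (centralizer P) R"
proof (rule subringI)
  show "centralizer P \<subseteq> carrier R" unfolding centralizer_def by auto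
  show "\<one> \<in> centralizer P" using assms unfolding centralizer_def by auto
next
  fix h assume "h \<in> centralizer P"
  then show "\<ominus> h \<in> centralizer P"
    using assms unfolding centralizer_def by (auto simp: l_minus r_minus subset_iff)
next
  fix h1 h2 assume h: "h1 \<in> centralizer P" "h2 \<in> centralizer P"
  show "h1 \<oplus> h2 \<in> centralizer P"
    using h assms unfolding centralizer_def by (auto simp: l_distr r_distr subset_iff)
  show "h1 \<otimes> h2 \<in> centralizer P"
  proof -
    have "h1 \<otimes> h2 \<otimes> x = x \<otimes> (h1 \<otimes> h2)" if "x \<in> P" for x
    proof -
      have c: "x \<in> carrier R" "h1 \<in> carrier R" "h2 \<in> carrier R" using that assms h centralizerD by auto
      have "h1 \<otimes> h2 \<otimes> x = h1 \<otimes> (x \<otimes> h2)"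
        using c centralizerD(2)[OF h(2) that] by (simp add: m_assoc)
      also have "\<dots> = x \<otimes> h1 \<otimes> h2"
        using c centralizerD(2)[OF h(1) that] by (simp add: m_assoc[symmetric])
      finally show ?thesis using c by (simp add: m_assoc)
    qed
    then show ?thesis using h unfolding centralizer_def by auto
  qed
qed

text \<open>Inverses of centralizing elements centralize, so commutativity is all that a centralizer
  may lack to be a field.\<close>

lemma centralizer_subfield:
  assumes "P \<subseteq> carrier R" "\<And>x y. x \<in> centralizer P \<Longrightarrow> y \<in> centralizer P \<Longrightarrow> x \<otimes> y = y \<otimes> x"
  shows "subfield (centralizer P) R"
proof (rule subfieldI[OF subcringI[OF centralizer_subring]], goal_cases)
  case 1 then show ?case using assms by simp
next
  case (2 h1 h2) then show ?case using assms(2) by blast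
next
  case 3
  have c: "centralizer P \<subseteq> carrier R" by (auto simp: centralizer_def)
  show ?case
  proof (intro equalityI subsetI)
    fix z assume "z \<in> Units (R\<lparr>carrier := centralizer P\<rparr>)"
    then obtain y where "z \<in> centralizer P" "y \<in> centralizer P" "y \<otimes> z = \<one>"
      unfolding Units_def by auto
    then show "z \<in> centralizer P - {\<zero>}"
      using c one_not_zero by (metis DiffI r_null singletonD subsetD)
  next
    fix z assume z: "z \<in> centralizer P - {\<zero>}"
    then have "inv z \<in> centralizer P" "inv z \<otimes> z = \<one>" "z \<otimes> inv z = \<one>"
      using centralizer_inv[of z P] assms(1) c by auto
    then show "z \<in> Units (R\<lparr>carrier := centralizer P\<rparr>)"
      unfolding Units_def using z by auto
  qed
qed

lemma centralizer_carrier: "centralizer (carrier R) = ring_center R"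
  unfolding centralizer_def ring_center_def by auto

end

subsection \<open>Jacobson density\<close>

context ring
begin

text \<open>The list stands for a tensor, a sum of terms \<open>p \<otimes> c\<close>, acting on
  \<open>v\<close> from both sides. Different lists may act alike; the list is kept because its
  coefficients are altered one at a time in \<open>transfer\<close>.\<close>

primrec sandwich :: "('a \<times> 'a) list \<Rightarrow> 'a \<Rightarrow> 'a" where
  "sandwich [] v = \<zero>"
| "sandwich (pc # ps) v = fst pc \<otimes> v \<otimes> snd pc \<oplus> sandwich ps v"

lemma sandwich_closed [simp, intro]:
  "set ps \<subseteq> carrier R \<times> carrier R \<Longrightarrow> v \<in> carrier R \<Longrightarrow> sandwich ps v \<in> carrier R"
  by (induction ps) auto

lemma sandwich_append:
  "set ps \<subseteq> carrier R \<times> carrier R \<Longrightarrow> set qs \<subseteq> carrier R \<times> carrier R \<Longrightarrow> v \<in> carrier R \<Longrightarrow>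
   sandwich (ps @ qs) v = sandwich ps v \<oplus> sandwich qs v"
  by (induction ps) (auto simp: a_assoc)

lemma sandwich_add:
  "set ps \<subseteq> carrier R \<times> carrier R \<Longrightarrow> u \<in> carrier R \<Longrightarrow> v \<in> carrier R \<Longrightarrow>
   sandwich ps (u \<oplus> v) = sandwich ps u \<oplus> sandwich ps v"
  by (induction ps) (auto simp: l_distr r_distr a_ac)

lemma sandwich_zero: "set ps \<subseteq> carrier R \<times> carrier R \<Longrightarrow> sandwich ps \<zero> = \<zero>"
  by (induction ps) auto

text \<open>The factor \<open>k\<close> only has to pass the left coefficients, so these operators
  are linear over the centralizer of \<open>P\<close>.\<close>

lemma sandwich_lmult:
  assumes "set ps \<subseteq> P \<times> carrier R" "P \<subseteq> carrier R" "k \<in> carrier R"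
    "\<And>p. p \<in> P \<Longrightarrow> k \<otimes> p = p \<otimes> k" "v \<in> carrier R"
  shows "sandwich ps (k \<otimes> v) = k \<otimes> sandwich ps v"
  using assms(1)
proof (induction ps)
  case (Cons pc ps)
  have c: "fst pc \<in> carrier R" "snd pc \<in> carrier R" "k \<otimes> fst pc = fst pc \<otimes> k"
    using Cons.prems assms(2,4) by auto
  have "set ps \<subseteq> carrier R \<times> carrier R" using Cons.prems assms(2) by auto
  then have o: "sandwich ps v \<in> carrier R" using assms(5) by simp
  have "fst pc \<otimes> (k \<otimes> v) \<otimes> snd pc = fst pc \<otimes> k \<otimes> v \<otimes> snd pc"
    using c assms by (simp add: m_assoc)
  also have "\<dots> = k \<otimes> (fst pc \<otimes> v \<otimes> snd pc)"
    using c assms by (simp add: m_assoc flip: c(3))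
  finally show ?case using Cons c o assms(3,5) by (simp add: r_distr)
qed (use assms in auto)

definition sandwich_right :: "'a \<Rightarrow> ('a \<times> 'a) list \<Rightarrow> ('a \<times> 'a) list"
  where "sandwich_right w ps = map (\<lambda>(p, c). (p, c \<otimes> w)) ps"

lemma sandwich_right_set: "set ps \<subseteq> P \<times> carrier R \<Longrightarrow> w \<in> carrier R \<Longrightarrow> set (sandwich_right w ps) \<subseteq> P \<times> carrier R"
  unfolding sandwich_right_def by auto

lemma sandwich_right:
  "set ps \<subseteq> carrier R \<times> carrier R \<Longrightarrow> w \<in> carrier R \<Longrightarrow> v \<in> carrier R \<Longrightarrow>
   sandwich (sandwich_right w ps) v = sandwich ps v \<otimes> w"
  unfolding sandwich_right_def by (induction ps) (auto simp: l_distr m_assoc)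

definition sandwich_left :: "'a \<Rightarrow> ('a \<times> 'a) list \<Rightarrow> ('a \<times> 'a) list"
  where "sandwich_left k ps = map (\<lambda>(p, c). (k \<otimes> p, c)) ps"

lemma sandwich_left:
  "set ps \<subseteq> carrier R \<times> carrier R \<Longrightarrow> k \<in> carrier R \<Longrightarrow> v \<in> carrier R \<Longrightarrow>
   sandwich (sandwich_left k ps) v = k \<otimes> sandwich ps v"
  unfolding sandwich_left_def by (induction ps) (auto simp: r_distr m_assoc)

text \<open>If the operators \<open>T i\<close> are dual to vectors \<open>f j\<close>, with values
  \<open>\<one>\<close> for \<open>i = j\<close> and \<open>\<zero>\<close> otherwise, this operator
  sends each \<open>f j\<close> to \<open>w j\<close>.\<close>

definition sandwich_sum :: "(nat \<Rightarrow> ('a \<times> 'a) list) \<Rightarrow> (nat \<Rightarrow> 'a) \<Rightarrow> nat \<Rightarrow> ('a \<times> 'a) list"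
  where "sandwich_sum T w n = concat (map (\<lambda>i. sandwich_right (w i) (T i)) [0..<n])"

lemma sandwich_sum_set:
  "(\<And>i. i < n \<Longrightarrow> set (T i) \<subseteq> P \<times> carrier R) \<Longrightarrow> (\<And>i. i < n \<Longrightarrow> w i \<in> carrier R) \<Longrightarrow>
   set (sandwich_sum T w n) \<subseteq> P \<times> carrier R"
proof (induction n)
  case 0
  show ?case by (simp add: sandwich_sum_def)
next
  case (Suc n)
  have "sandwich_sum T w (Suc n) = sandwich_sum T w n @ sandwich_right (w n) (T n)" by (simp add: sandwich_sum_def)
  moreover have "set (sandwich_sum T w n) \<subseteq> P \<times> carrier R" using Suc less_SucI by blast
  moreover have "set (sandwich_right (w n) (T n)) \<subseteq> P \<times> carrier R"
    by (rule sandwich_right_set) (use Suc.prems in blast)+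
  ultimately show ?case by (simp only: set_append Un_subset_iff)
qed

lemma sandwich_sum:
  assumes "\<And>i. i < n \<Longrightarrow> set (T i) \<subseteq> carrier R \<times> carrier R" "\<And>i. i < n \<Longrightarrow> w i \<in> carrier R"
    "v \<in> carrier R"
  shows "sandwich (sandwich_sum T w n) v = lincomb (\<lambda>i. sandwich (T i) v) w n"
  using assms(1,2)
proof (induction n)
  case 0
  then show ?case by (simp add: sandwich_sum_def)
next
  case (Suc n)
  have e: "sandwich_sum T w (Suc n) = sandwich_sum T w n @ sandwich_right (w n) (T n)"
    by (simp add: sandwich_sum_def)
  have "set (sandwich_sum T w n) \<subseteq> carrier R \<times> carrier R"
    using Suc.prems by (intro sandwich_sum_set) auto
  moreover have "set (sandwich_right (w n) (T n)) \<subseteq> carrier R \<times> carrier R"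
    using Suc.prems by (intro sandwich_right_set) auto
  ultimately show ?case
    unfolding e using Suc assms(3) by (simp add: sandwich_append sandwich_right)
qed

lemma sandwich_lincomb:
  assumes "set ps \<subseteq> P \<times> carrier R" "P \<subseteq> carrier R"
    "\<And>i. i < n \<Longrightarrow> \<alpha> i \<in> carrier R" "\<And>i p. i < n \<Longrightarrow> p \<in> P \<Longrightarrow> \<alpha> i \<otimes> p = p \<otimes> \<alpha> i"
    "\<And>i. i < n \<Longrightarrow> f i \<in> carrier R"
  shows "sandwich ps (lincomb \<alpha> f n) = lincomb \<alpha> (\<lambda>i. sandwich ps (f i)) n"
  using assms(3-5)
proof (induction n)
  case 0
  have "set ps \<subseteq> carrier R \<times> carrier R" using assms(1,2) by auto
  then show ?case by (simp add: sandwich_zero)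
next
  case (Suc n)
  have ps: "set ps \<subseteq> carrier R \<times> carrier R" using assms(1,2) by auto
  have "lincomb \<alpha> f n \<in> carrier R" using Suc.prems by (intro lincomb_closed) auto
  moreover have "sandwich ps (\<alpha> n \<otimes> f n) = \<alpha> n \<otimes> sandwich ps (f n)"
    using Suc.prems by (intro sandwich_lmult[OF assms(1,2)]) auto
  ultimately show ?case using Suc by (simp add: sandwich_add[OF ps])
qed

end

context skew_field
begin

text \<open>Independence is insensitive to order, so a transposition moves any index to the last
  place, the one that \<open>density_aux\<close> serves.\<close>

lemma dual_aux:
  assumes Z: "subfield (centralizer P) R"
    and H: "\<And>g. independent (centralizer P) (family g (Suc n)) \<Longrightarrow>
      \<exists>ps. set ps \<subseteq> P \<times> carrier R \<and> sandwich ps (g n) = \<one> \<and> (\<forall>j<n. sandwich ps (g j) = \<zero>)"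
    and ind: "independent (centralizer P) (family f (Suc n))"
    and i: "i < Suc n"
  shows "\<exists>ps. set ps \<subseteq> P \<times> carrier R \<and> (\<forall>j<Suc n. sandwich ps (f j) = (if j = i then \<one> else \<zero>))"
proof -
  define g where "g = f \<circ> Transposition.transpose i n"
  have "Transposition.transpose i n ` {..<Suc n} = {..<Suc n}"
    using i by (intro bij_betw_imp_surj_on[of _ "{..<Suc n}" "{..<Suc n}"])
      (auto simp: bij_betw_transpose_iff)
  then have s: "set (family g (Suc n)) = set (family f (Suc n))"
    unfolding g_def by (simp only: family_simps(4) image_comp[symmetric])
  have "independent (centralizer P) (family g (Suc n))"
    using independent_same_set[OF Z s[symmetric] _ ind] by (simp del: family_simps(2))
  then obtain ps where ps: "set ps \<subseteq> P \<times> carrier R" "sandwich ps (g n) = \<one>" "\<forall>j<n. sandwich ps (g j) = \<zero>"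
    using H by blast
  have "sandwich ps (f j) = (if j = i then \<one> else \<zero>)" if "j < Suc n" for j
  proof (cases "j = i")
    case True
    then show ?thesis using ps(2) by (simp add: g_def)
  next
    case False
    then have "Transposition.transpose i n j < n" using that i
      by (auto simp: transpose_def less_Suc_eq)
    then show ?thesis using ps(3) False by (auto simp: g_def dest!: spec[of _ "Transposition.transpose i n j"])
  qed
  then show ?thesis using ps by blast
qed

text \<open>Induction on the number of vectors. Suppose every operator that kills the first
  \<open>m\<close> vectors also kills \<open>f m\<close>. Then \<open>ps (f m)\<close> is a fixed
  combination of the \<open>ps (f i)\<close>, its coefficients \<open>t i\<close> turn out to
  centralize \<open>P\<close>, and the identity operator makes \<open>f m\<close> dependent on the
  others.\<close>

lemma density_aux:
  assumes P: "P \<subseteq> carrier R" "\<one> \<in> P" "\<And>x y. x \<in> P \<Longrightarrow> y \<in> P \<Longrightarrow> x \<otimes> y \<in> P"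
    and Z: "subfield (centralizer P) R"
    and ind: "independent (centralizer P) (family f (Suc n))"
  shows "\<exists>ps. set ps \<subseteq> P \<times> carrier R \<and> sandwich ps (f n) = \<one> \<and> (\<forall>j<n. sandwich ps (f j) = \<zero>)"
  using ind
proof (induction n arbitrary: f)
  case 0
  then have f: "f 0 \<in> carrier R" "f 0 \<noteq> \<zero>" by (auto simp: independent_Cons_iff)
  then have "sandwich [(\<one>, inv (f 0))] (f 0) = \<one>" by simp
  then show ?case using f P by (intro exI[of _ "[(\<one>, inv (f 0))]"]) auto
next
  case (Suc n)
  define m where "m = Suc n"
  have ZR: "centralizer P \<subseteq> carrier R" using Z subring_props(1) by blast
  have indm: "independent (centralizer P) (family f m)" and fm: "f m \<in> carrier R"
      "f m \<notin> Span (centralizer P) (family f m)"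
    using Suc.prems unfolding m_def family_simps(2)[of f "Suc n"] independent_Cons_iff by auto
  have fc: "f i \<in> carrier R" if "i < m" for i
    using independent_in_carrier[OF indm] that by auto
  have "\<exists>ps. set ps \<subseteq> P \<times> carrier R \<and> (\<forall>j<m. sandwich ps (f j) = (if j = i then \<one> else \<zero>))"
    if i: "i < m" for i
    using dual_aux[OF Z _ _ i[unfolded m_def]] Suc.IH indm unfolding m_def by blast
  then obtain T where T: "\<And>i. i < m \<Longrightarrow> set (T i) \<subseteq> P \<times> carrier R"
      "\<And>i j. i < m \<Longrightarrow> j < m \<Longrightarrow> sandwich (T i) (f j) = (if j = i then \<one> else \<zero>)"
    by metis
  have TR: "set (T i) \<subseteq> carrier R \<times> carrier R" if "i < m" for i using T(1)[OF that] P(1) by auto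
  define t where "t i = sandwich (T i) (f m)" for i
  have tc: "t i \<in> carrier R" if "i < m" for i unfolding t_def using TR[OF that] fm by auto
  show ?case
  proof (cases "\<exists>ps. set ps \<subseteq> P \<times> carrier R \<and> (\<forall>j<m. sandwich ps (f j) = \<zero>) \<and> sandwich ps (f m) \<noteq> \<zero>")
    case True
    then obtain ps where ps: "set ps \<subseteq> P \<times> carrier R" "\<forall>j<m. sandwich ps (f j) = \<zero>" "sandwich ps (f m) \<noteq> \<zero>"
      by blast
    have psR: "set ps \<subseteq> carrier R \<times> carrier R" using ps(1) P(1) by auto
    have w: "sandwich ps (f m) \<in> carrier R" using psR fm by auto
    have iw: "inv (sandwich ps (f m)) \<in> carrier R" using w ps(3) by simp
    let ?qs = "sandwich_right (inv (sandwich ps (f m))) ps"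
    have "sandwich ?qs (f m) = \<one>" using sandwich_right[OF psR iw fm(1)] w ps(3) by simp
    moreover have "sandwich ?qs (f j) = \<zero>" if "j < m" for j
      using sandwich_right[OF psR iw fc[OF that]] ps(2) that iw by simp
    ultimately show ?thesis using sandwich_right_set[OF ps(1) iw] m_def by blast
  next
    case False
    \<comment> \<open>Correcting \<open>ps\<close> by the operators \<open>T i\<close> followed by
      right multiplication with \<open>- ps (f i)\<close> gives an operator that kills the first
      \<open>m\<close> vectors, hence also \<open>f m\<close>.\<close>
    have key: "sandwich ps (f m) \<oplus> lincomb t (\<lambda>i. \<ominus> sandwich ps (f i)) m = \<zero>" if ps: "set ps \<subseteq> P \<times> carrier R" for ps
    proof -
      have psR: "set ps \<subseteq> carrier R \<times> carrier R" using ps P(1) by auto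
      let ?w = "\<lambda>i. \<ominus> sandwich ps (f i)"
      have wc: "?w i \<in> carrier R" if "i < m" for i using psR fc that by auto
      let ?S = "sandwich_sum T ?w m"
      have S: "set ?S \<subseteq> P \<times> carrier R" using T(1) wc by (intro sandwich_sum_set) auto
      have SR: "set ?S \<subseteq> carrier R \<times> carrier R" using S P(1) by auto
      have e: "sandwich ?S v = lincomb (\<lambda>i. sandwich (T i) v) ?w m" if "v \<in> carrier R" for v
        using TR wc that by (intro sandwich_sum) auto
      have "sandwich (ps @ ?S) (f j) = \<zero>" if j: "j < m" for j
      proof -
        have "lincomb (\<lambda>i. sandwich (T i) (f j)) ?w m = lincomb (\<lambda>i. if i = j then \<one> else \<zero>) ?w m"
          using T(2) j by (intro lincomb_cong) auto
        also have "\<dots> = ?w j" using wc j by (intro lincomb_delta) auto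
        finally show ?thesis
          using e[OF fc[OF j]] sandwich_append[OF psR SR fc[OF j]] psR fc[OF j] by (simp add: r_neg)
      qed
      moreover have "set (ps @ ?S) \<subseteq> P \<times> carrier R" using ps S by auto
      ultimately have "sandwich (ps @ ?S) (f m) = \<zero>" using False by blast
      then show ?thesis using sandwich_append[OF psR SR fm(1)] e[OF fm(1)] unfolding t_def by simp
    qed
    \<comment> \<open>For the operator \<open>k T j\<close>, \<open>key\<close> reads
      \<open>k t j = t j k\<close>.\<close>
    have tZ: "t j \<in> centralizer P" if j: "j < m" for j
    proof -
      have "t j \<otimes> k = k \<otimes> t j" if k: "k \<in> P" for k
      proof -
        have kR: "k \<in> carrier R" using k P(1) by auto
        let ?ps = "sandwich_left k (T j)"
        have "set ?ps \<subseteq> P \<times> carrier R"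
          using T(1)[OF j] P(3) k unfolding sandwich_left_def by auto
        then have "sandwich ?ps (f m) \<oplus> lincomb t (\<lambda>i. \<ominus> sandwich ?ps (f i)) m = \<zero>" by (rule key)
        moreover have "sandwich ?ps (f m) = k \<otimes> t j" using sandwich_left[OF TR[OF j] kR fm(1)] t_def by simp
        moreover have "lincomb t (\<lambda>i. \<ominus> sandwich ?ps (f i)) m = lincomb (\<lambda>i. if i = j then \<one> else \<zero>) (\<lambda>i. t i \<otimes> \<ominus> k) m"
        proof -
          have "sandwich ?ps (f i) = (if i = j then k else \<zero>)" if "i < m" for i
            using sandwich_left[OF TR[OF j] kR fc[OF that]] T(2)[OF j that] kR by simp
          then have "lincomb t (\<lambda>i. \<ominus> sandwich ?ps (f i)) m = lincomb t (\<lambda>i. if i = j then \<ominus> k else \<zero>) m"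
            by (intro lincomb_cong) auto
          also have "\<dots> = lincomb (\<lambda>i. if i = j then \<one> else \<zero>) (\<lambda>i. t i \<otimes> \<ominus> k) m"
            using tc kR
          proof (induction m)
            case (Suc m)
            then show ?case using kR by auto
          qed simp
          finally show ?thesis .
        qed
        moreover have "lincomb (\<lambda>i. if i = j then \<one> else \<zero>) (\<lambda>i. t i \<otimes> \<ominus> k) m = t j \<otimes> \<ominus> k"
          using tc kR j by (intro lincomb_delta) auto
        ultimately have "k \<otimes> t j \<ominus> t j \<otimes> k = \<zero>" using tc[OF j] kR by (simp add: r_minus a_minus_def)
        then show ?thesis using tc[OF j] kR by (simp add: minus_eq_zero_iff)
      qed
      then show ?thesis using tc[OF j] unfolding centralizer_def by auto
    qed
    \<comment> \<open>For the identity operator, \<open>key\<close> expresses \<open>f m\<close> by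
      the other \<open>f i\<close> with the coefficients \<open>t i\<close>.\<close>
    have "set [(\<one>, \<one>)] \<subseteq> P \<times> carrier R" using P by auto
    then have "sandwich [(\<one>, \<one>)] (f m) \<oplus> lincomb t (\<lambda>i. \<ominus> sandwich [(\<one>, \<one>)] (f i)) m = \<zero>" by (rule key)
    then have "f m \<oplus> lincomb t (\<lambda>i. \<ominus> \<one> \<otimes> f i) m = \<zero>"
    proof -
      have "sandwich [(\<one>, \<one>)] v = v" if "v \<in> carrier R" for v using that by simp
      then have "lincomb t (\<lambda>i. \<ominus> sandwich [(\<one>, \<one>)] (f i)) m = lincomb t (\<lambda>i. \<ominus> \<one> \<otimes> f i) m"
        using fc by (intro lincomb_cong) (simp_all add: l_minus del: sandwich.simps)
      then show ?thesis using \<open>sandwich [(\<one>, \<one>)] (f m) \<oplus> _ = \<zero>\<close> fm by simp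
    qed
    moreover have "lincomb t (\<lambda>i. \<ominus> \<one> \<otimes> f i) m = lincomb (\<lambda>i. \<ominus> t i) f m"
      using tc fc by (induction m) (auto simp: l_minus r_minus)
    moreover have c: "lincomb (\<lambda>i. \<ominus> t i) f m \<in> carrier R" using tc fc by auto
    ultimately have "f m \<oplus> lincomb (\<lambda>i. \<ominus> t i) f m = \<zero>" by simp
    then have e: "f m = \<ominus> lincomb (\<lambda>i. \<ominus> t i) f m"
      using fm(1) c by (metis minus_equality)
    have "\<ominus> t i \<in> centralizer P" if "i < m" for i
      by (rule subring_props(5)[OF Z tZ[OF that]])
    then have "lincomb (\<lambda>i. \<ominus> t i) f m \<in> Span (centralizer P) (family f m)"
      using fc by (intro Span_familyI[OF ZR])
    then have "f m \<in> Span (centralizer P) (family f m)"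
      using Span_subgroup_props(4)[OF Z independent_in_carrier[OF indm]] e by metis
    then show ?thesis using fm by simp
  qed
qed

lemma density:
  assumes P: "P \<subseteq> carrier R" "\<one> \<in> P" "\<And>x y. x \<in> P \<Longrightarrow> y \<in> P \<Longrightarrow> x \<otimes> y \<in> P"
    and Z: "subfield (centralizer P) R"
    and ind: "independent (centralizer P) (family f n)"
    and c: "\<And>i. i < n \<Longrightarrow> c i \<in> carrier R"
  shows "\<exists>ps. set ps \<subseteq> P \<times> carrier R \<and> (\<forall>j<n. sandwich ps (f j) = c j)"
proof -
  have fc: "f i \<in> carrier R" if "i < n" for i
    using independent_in_carrier[OF ind] that by auto
  have "\<exists>ps. set ps \<subseteq> P \<times> carrier R \<and> (\<forall>j<n. sandwich ps (f j) = (if j = i then \<one> else \<zero>))"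
    if i: "i < n" for i
  proof -
    obtain m where n: "n = Suc m" using i by (cases n) auto
    show ?thesis
      using dual_aux[OF Z _ _ i[unfolded n]] density_aux[OF P Z] ind unfolding n by blast
  qed
  then obtain T where T: "\<And>i. i < n \<Longrightarrow> set (T i) \<subseteq> P \<times> carrier R"
      "\<And>i j. i < n \<Longrightarrow> j < n \<Longrightarrow> sandwich (T i) (f j) = (if j = i then \<one> else \<zero>)"
    by metis
  have TR: "set (T i) \<subseteq> carrier R \<times> carrier R" if "i < n" for i using T(1)[OF that] P(1) by auto
  have "sandwich (sandwich_sum T c n) (f j) = c j" if j: "j < n" for j
  proof -
    have "sandwich (sandwich_sum T c n) (f j) = lincomb (\<lambda>i. sandwich (T i) (f j)) c n"
      using TR c fc[OF j] by (intro sandwich_sum) auto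
    also have "\<dots> = lincomb (\<lambda>i. if i = j then \<one> else \<zero>) c n"
      using T(2) j by (intro lincomb_cong) auto
    also have "\<dots> = c j" using c j by (intro lincomb_delta) auto
    finally show ?thesis .
  qed
  moreover have "set (sandwich_sum T c n) \<subseteq> P \<times> carrier R" using T(1) c by (intro sandwich_sum_set) auto
  ultimately show ?thesis by blast
qed

text \<open>The vectors \<open>zs\<close>, whose values are not prescribed, must not be sent outside
  the span of the prescribed values. So \<open>f\<close> is completed to a basis of a space
  containing \<open>zs\<close>, and the operator is made to vanish on the added vectors.\<close>

lemma density_extend:
  assumes P: "P \<subseteq> carrier R" "\<one> \<in> P" "\<And>x y. x \<in> P \<Longrightarrow> y \<in> P \<Longrightarrow> x \<otimes> y \<in> P"
    and Z: "subfield (centralizer P) R"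
    and ind: "independent (centralizer P) (family f n)"
    and c: "\<And>i. i < n \<Longrightarrow> c i \<in> carrier R"
    and zs: "set zs \<subseteq> carrier R"
  shows "\<exists>ps. set ps \<subseteq> P \<times> carrier R \<and> (\<forall>j<n. sandwich ps (f j) = c j) \<and>
    (\<forall>z\<in>set zs. sandwich ps z \<in> Span (centralizer P) (family c n))"
proof -
  let ?Z = "centralizer P"
  have ZR: "?Z \<subseteq> carrier R" using Z subring_props(1) by blast
  have fs: "set (family f n) \<subseteq> carrier R" using independent_in_carrier[OF ind] .
  have fc: "f i \<in> carrier R" if "i < n" for i using fs that by auto
  let ?E = "Span ?Z (zs @ family f n)"
  have zf: "set (zs @ family f n) \<subseteq> carrier R" using zs fs by auto
  obtain m where m: "dimension m ?Z ?E"
    using Span_finite_dimension[OF Z zf] by blast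
  have base: "set (zs @ family f n) \<subseteq> ?E" using Span_base_incl[OF Z zf] .
  obtain Vs where V: "length (Vs @ family f n) = m" "independent ?Z (Vs @ family f n)" "Span ?Z (Vs @ family f n) = ?E"
    using complete_base[OF Z m ind] base by auto
  define N where "N = n + length Vs"
  define g where "g i = (if i < n then f i else rev Vs ! (i - n))" for i
  have g: "family g N = Vs @ family f n"
    unfolding N_def g_def family_append by (simp flip: list_eq_family)
  define c' where "c' i = (if i < n then c i else \<zero>)" for i
  have "\<exists>ps. set ps \<subseteq> P \<times> carrier R \<and> (\<forall>j<N. sandwich ps (g j) = c' j)"
    using V(2) g c by (intro density[OF P Z]) (auto simp: c'_def)
  then obtain ps where ps: "set ps \<subseteq> P \<times> carrier R" "\<forall>j<N. sandwich ps (g j) = c' j" by blast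
  have "sandwich ps (f j) = c j" if "j < n" for j
    using ps(2) that by (auto simp: N_def g_def c'_def dest: spec[of _ j])
  moreover have "sandwich ps z \<in> Span ?Z (family c n)" if "z \<in> set zs" for z
  proof -
    have gc: "g i \<in> carrier R" if "i < N" for i
      using independent_in_carrier[OF V(2)] that unfolding g[symmetric] by auto
    have "z \<in> Span ?Z (family g N)" using that base V(3) g by auto
    then obtain \<alpha> where a: "\<forall>i<N. \<alpha> i \<in> ?Z" "z = lincomb \<alpha> g N"
      by (rule Span_familyE[OF _ ZR gc])
    have aR: "\<alpha> i \<in> carrier R" if "i < N" for i using a(1) ZR that by auto
    have "sandwich ps z = lincomb \<alpha> (\<lambda>i. sandwich ps (g i)) N"
      unfolding a(2)
    proof (rule sandwich_lincomb[OF ps(1) P(1)])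
      show "\<alpha> i \<otimes> p = p \<otimes> \<alpha> i" if "i < N" "p \<in> P" for i p
        using a(1) that centralizerD(2) by blast
    qed (use aR gc in auto)
    also have "\<dots> = lincomb \<alpha> c' N" using ps(2) by (intro lincomb_cong) auto
    also have "\<dots> = lincomb \<alpha> c' n \<oplus> lincomb (\<lambda>i. \<alpha> (n + i)) (\<lambda>i. c' (n + i)) (length Vs)"
      unfolding N_def
      by (rule lincomb_append) (use aR c in \<open>auto simp: c'_def N_def\<close>)
    also have "lincomb (\<lambda>i. \<alpha> (n + i)) (\<lambda>i. c' (n + i)) (length Vs) = \<zero>"
    proof -
      have "lincomb (\<lambda>i. \<alpha> (n + i)) (\<lambda>i. c' (n + i)) l = \<zero>" if "l \<le> length Vs" for l
        using that aR by (induction l) (auto simp: c'_def N_def)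
      then show ?thesis by simp
    qed
    also have "lincomb \<alpha> c' n = lincomb \<alpha> c n" by (rule lincomb_cong) (auto simp: c'_def)
    finally have "sandwich ps z = lincomb \<alpha> c n"
      using lincomb_closed[of n \<alpha> c] aR c by (simp add: N_def)
    moreover have "lincomb \<alpha> c n \<in> Span ?Z (family c n)"
      by (rule Span_familyI[OF ZR]) (use a(1) N_def c in auto)
    ultimately show ?thesis by simp
  qed
  ultimately show ?thesis using ps(1) by blast
qed

end

section \<open>Linear maps and dimension over the subfield \<open>K\<close>\<close>

context ring
begin

lemma Span_Cons_iff: "v \<in> Span K (u # Us) \<longleftrightarrow> (\<exists>k\<in>K. \<exists>w\<in>Span K Us. v = k \<otimes> u \<oplus> w)"
  by (simp add: Span_Cons line_extension_mem_iff)

definition K_linear :: "'a set \<Rightarrow> ('a \<Rightarrow> 'a) \<Rightarrow> bool" where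
  "K_linear K T \<longleftrightarrow> (\<forall>x\<in>carrier R. T x \<in> carrier R) \<and>
     (\<forall>x\<in>carrier R. \<forall>y\<in>carrier R. T (x \<oplus> y) = T x \<oplus> T y) \<and>
     (\<forall>k\<in>K. \<forall>x\<in>carrier R. T (k \<otimes> x) = k \<otimes> T x)"

lemma K_linearI:
  assumes "\<And>x. x \<in> carrier R \<Longrightarrow> T x \<in> carrier R"
    "\<And>x y. x \<in> carrier R \<Longrightarrow> y \<in> carrier R \<Longrightarrow> T (x \<oplus> y) = T x \<oplus> T y"
    "\<And>k x. k \<in> K \<Longrightarrow> x \<in> carrier R \<Longrightarrow> T (k \<otimes> x) = k \<otimes> T x"
  shows "K_linear K T"
  using assms unfolding K_linear_def by blast

lemma K_linear_closed: "K_linear K T \<Longrightarrow> x \<in> carrier R \<Longrightarrow> T x \<in> carrier R"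
  and K_linear_add: "K_linear K T \<Longrightarrow> x \<in> carrier R \<Longrightarrow> y \<in> carrier R \<Longrightarrow> T (x \<oplus> y) = T x \<oplus> T y"
  and K_linear_smult: "K_linear K T \<Longrightarrow> k \<in> K \<Longrightarrow> x \<in> carrier R \<Longrightarrow> T (k \<otimes> x) = k \<otimes> T x"
  unfolding K_linear_def by blast+

lemma K_linear_zero: "K_linear K T \<Longrightarrow> T \<zero> = \<zero>"
  using K_linear_add[of K T \<zero> \<zero>] K_linear_closed[of K T \<zero>]
  by (metis add.l_cancel_one r_zero zero_closed)

lemma K_linear_uminus: "K_linear K T \<Longrightarrow> x \<in> carrier R \<Longrightarrow> T (\<ominus> x) = \<ominus> T x"
  using K_linear_add[of K T "\<ominus> x" x] K_linear_closed[of K T x] K_linear_closed[of K T "\<ominus> x"] K_linear_zero[of K T]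
  by (metis a_inv_closed l_neg minus_equality)

lemma K_linear_minus: "K_linear K T \<Longrightarrow> x \<in> carrier R \<Longrightarrow> y \<in> carrier R \<Longrightarrow> T (x \<ominus> y) = T x \<ominus> T y"
  unfolding a_minus_def by (simp add: K_linear_add K_linear_uminus)

lemma K_linear_lincomb:
  assumes "K_linear K T" "K \<subseteq> carrier R"
    "\<And>i. i < n \<Longrightarrow> \<alpha> i \<in> K" "\<And>i. i < n \<Longrightarrow> f i \<in> carrier R"
  shows "T (lincomb \<alpha> f n) = lincomb \<alpha> (\<lambda>i. T (f i)) n"
  using assms(3,4)
proof (induction n)
  case 0
  show ?case using K_linear_zero[OF assms(1)] by simp
next
  case (Suc n)
  have "lincomb \<alpha> f n \<in> carrier R" using Suc.prems assms(2) by (intro lincomb_closed) auto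
  moreover have "\<alpha> n \<otimes> f n \<in> carrier R" using Suc.prems assms(2) by auto
  ultimately show ?case using Suc by (simp add: K_linear_add[OF assms(1)] K_linear_smult[OF assms(1)])
qed

end

text \<open>The equation \<open>centralizer K = K\<close> is maximality among commutative subsets,
  and it is also what makes \<open>K\<close> the field of scalars in the density theorem for
  \<open>P = K\<close>.\<close>

locale max_subfield = skew_field R for R (structure) +
  fixes K :: "'a set" and a :: 'a
  assumes centralizer_K: "centralizer K = K" and a_in_K: "a \<in> K" and a_noncentral: "a \<notin> ring_center R"
begin

lemma K_sub: "K \<subseteq> carrier R"
  using centralizer_K centralizerD(1) by blast

lemma K_carrier [simp]: "k \<in> K \<Longrightarrow> k \<in> carrier R"
  using K_sub by blast

lemma K_comm: "k \<in> K \<Longrightarrow> l \<in> K \<Longrightarrow> k \<otimes> l = l \<otimes> k"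
  using centralizer_K centralizerD(2) by blast

lemma subfield_K: "subfield K R"
  by (rule centralizer_subfield[OF K_sub, unfolded centralizer_K]) (rule K_comm)

lemma a_carrier [simp]: "a \<in> carrier R"
  using a_in_K by simp

lemma center_K: "ring_center R \<subseteq> K"
proof -
  have "centralizer (carrier R) \<subseteq> centralizer K" using K_sub unfolding centralizer_def by auto
  then show ?thesis by (simp add: centralizer_K centralizer_carrier)
qed

lemma K_closed [simp, intro]:
  "\<zero> \<in> K" "\<one> \<in> K" "k \<in> K \<Longrightarrow> \<ominus> k \<in> K" "k \<in> K \<Longrightarrow> l \<in> K \<Longrightarrow> k \<oplus> l \<in> K"
  "k \<in> K \<Longrightarrow> l \<in> K \<Longrightarrow> k \<otimes> l \<in> K" "k \<in> K \<Longrightarrow> l \<in> K \<Longrightarrow> k \<ominus> l \<in> K"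
proof -
  show "\<zero> \<in> K" "\<one> \<in> K" by (fact subring_props(2,3)[OF subfield_K])+
  show m: "\<ominus> k \<in> K" if "k \<in> K" for k by (rule subring_props(5)[OF subfield_K that])
  show p: "k \<oplus> l \<in> K" if "k \<in> K" "l \<in> K" for k l by (rule subring_props(7)[OF subfield_K that])
  show "k \<otimes> l \<in> K" if "k \<in> K" "l \<in> K" for k l by (rule subring_props(6)[OF subfield_K that])
  show "k \<ominus> l \<in> K" if "k \<in> K" "l \<in> K" for k l unfolding a_minus_def by (intro m p that)
qed

lemma K_inv [simp, intro]: "k \<in> K \<Longrightarrow> k \<noteq> \<zero> \<Longrightarrow> inv k \<in> K"
  using centralizer_inv[of k K] centralizer_K K_sub by simp

lemma noncommuting: obtains g where "g \<in> carrier R" "g \<otimes> a \<noteq> a \<otimes> g"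
proof -
  have "\<exists>g\<in>carrier R. g \<otimes> a \<noteq> a \<otimes> g"
  proof (rule ccontr)
    assume "\<not> ?thesis"
    then have "a \<in> ring_center R" unfolding ring_center_def by simp
    then show False using a_noncentral by simp
  qed
  then show thesis using that by auto
qed

lemma a_neq: "a \<noteq> \<zero>" "a \<noteq> \<one>"
  using noncommuting by fastforce+

lemmas Span_K = Span_subgroup_props[OF subfield_K] Span_smult_closed[OF subfield_K]

lemma Span_K_minus:
  "set Us \<subseteq> carrier R \<Longrightarrow> x \<in> Span K Us \<Longrightarrow> y \<in> Span K Us \<Longrightarrow> x \<ominus> y \<in> Span K Us"
  unfolding a_minus_def by (simp add: Span_K)

lemma Span_K_divide:
  "set Us \<subseteq> carrier R \<Longrightarrow> k \<in> K \<Longrightarrow> k \<noteq> \<zero> \<Longrightarrow> x \<in> carrier R \<Longrightarrow> k \<otimes> x \<in> Span K Us \<Longrightarrow> x \<in> Span K Us"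
  using Span_m_inv_simprule[OF subfield_K] by blast

text \<open>A lower bound for the dimension over \<open>K\<close> that makes sense also when this
  dimension is infinite.\<close>

definition dim_ge :: "nat \<Rightarrow> bool" where
  "dim_ge n \<longleftrightarrow> (\<forall>xs. set xs \<subseteq> carrier R \<longrightarrow> length xs < n \<longrightarrow> Span K xs \<noteq> carrier R)"

lemma dim_ge_mono: "dim_ge n \<Longrightarrow> m \<le> n \<Longrightarrow> dim_ge m"
  unfolding dim_ge_def by auto

lemma dim_geD: "dim_ge n \<Longrightarrow> set xs \<subseteq> carrier R \<Longrightarrow> length xs < n \<Longrightarrow> \<exists>v\<in>carrier R. v \<notin> Span K xs"
  unfolding dim_ge_def using Span_K(1)[of xs] by blast

text \<open>An operator for which all vectors are eigenvectors is scalar; here this is done modulo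
  \<open>Span K L\<close>. Two vectors independent modulo \<open>L\<close> share their eigenvalue
  because their sum is an eigenvector too, and codimension at least two lets every vector be
  compared with \<open>v0\<close> or \<open>v1\<close>.\<close>

lemma K_linear_scalar:
  assumes L: "set L \<subseteq> carrier R" and T: "K_linear K T"
    and loc: "\<And>v. v \<in> carrier R \<Longrightarrow> v \<notin> Span K L \<Longrightarrow> \<exists>l\<in>K. T v \<ominus> l \<otimes> v \<in> Span K L"
    and codim: "dim_ge (length L + 2)"
  shows "\<exists>l\<in>K. \<forall>v\<in>carrier R. T v \<ominus> l \<otimes> v \<in> Span K L"
proof -
  obtain v0 where v0: "v0 \<in> carrier R" "v0 \<notin> Span K L" using dim_geD[OF codim L] by auto
  obtain v1 where v1: "v1 \<in> carrier R" "v1 \<notin> Span K (v0 # L)"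
    using dim_geD[OF codim, of "v0 # L"] L v0 by auto
  have v1L: "v1 \<notin> Span K L" using mono_Span[OF subfield_K L v0(1)] v1(2) by blast
  have eq: "l = l'" if v: "v \<in> carrier R" "v \<notin> Span K L" and v': "v' \<in> carrier R" "v' \<notin> Span K (v # L)"
    and l: "l \<in> K" "T v \<ominus> l \<otimes> v \<in> Span K L" and l': "l' \<in> K" "T v' \<ominus> l' \<otimes> v' \<in> Span K L" for v v' l l'
  proof -
    have "v \<oplus> v' \<notin> Span K L"
    proof
      assume "v \<oplus> v' \<in> Span K L"
      then have "\<ominus> \<one> \<otimes> v \<oplus> (v \<oplus> v') \<in> Span K (v # L)" unfolding Span_Cons_iff by auto
      moreover have "\<ominus> \<one> \<otimes> v \<oplus> (v \<oplus> v') = v'"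
        using v v' by (simp add: l_minus a_assoc[symmetric] l_neg)
      ultimately show False using v' by simp
    qed
    then obtain m where m: "m \<in> K" "T (v \<oplus> v') \<ominus> m \<otimes> (v \<oplus> v') \<in> Span K L"
      using loc[of "v \<oplus> v'"] v v' by auto
    have c: "T v \<in> carrier R" "T v' \<in> carrier R" using K_linear_closed[OF T] v v' by auto
    have "T (v \<oplus> v') \<ominus> m \<otimes> (v \<oplus> v') \<ominus> (T v \<ominus> l \<otimes> v) \<ominus> (T v' \<ominus> l' \<otimes> v') =
        (l \<ominus> m) \<otimes> v \<oplus> (l' \<ominus> m) \<otimes> v'"
      unfolding K_linear_add[OF T v(1) v'(1)]
      using v(1) v'(1) K_carrier[OF l(1)] K_carrier[OF l'(1)] K_carrier[OF m(1)] c by algebra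
    moreover have "T (v \<oplus> v') \<ominus> m \<otimes> (v \<oplus> v') \<ominus> (T v \<ominus> l \<otimes> v) \<ominus> (T v' \<ominus> l' \<otimes> v') \<in> Span K L"
      by (rule Span_K_minus[OF L Span_K_minus[OF L m(2) l(2)] l'(2)])
    ultimately have s: "(l \<ominus> m) \<otimes> v \<oplus> (l' \<ominus> m) \<otimes> v' \<in> Span K L" by simp
    have "l' \<ominus> m = \<zero>"
    proof (rule ccontr)
      assume n: "l' \<ominus> m \<noteq> \<zero>"
      have "\<ominus> (l \<ominus> m) \<otimes> v \<oplus> ((l \<ominus> m) \<otimes> v \<oplus> (l' \<ominus> m) \<otimes> v') \<in> Span K (v # L)"
        unfolding Span_Cons_iff using s l m by blast
      moreover have "\<ominus> (l \<ominus> m) \<otimes> v \<oplus> ((l \<ominus> m) \<otimes> v \<oplus> (l' \<ominus> m) \<otimes> v') = (l' \<ominus> m) \<otimes> v'"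
        using v v' l l' m by (simp add: l_minus a_assoc[symmetric] l_neg)
      ultimately have "v' \<in> Span K (v # L)"
        using Span_K_divide[of "v # L" "l' \<ominus> m" v'] n l' m v v' L by auto
      then show False using v' by simp
    qed
    then have "(l \<ominus> m) \<otimes> v \<in> Span K L" using s v v' l m by simp
    then have "l \<ominus> m = \<zero>"
      using Span_K_divide[OF L, of "l \<ominus> m" v] v l m by auto
    then show ?thesis using \<open>l' \<ominus> m = \<zero>\<close> l l' m by (simp add: minus_eq_zero_iff)
  qed
  obtain l0 where l0: "l0 \<in> K" "T v0 \<ominus> l0 \<otimes> v0 \<in> Span K L" using loc v0 by blast
  obtain l1 where l1: "l1 \<in> K" "T v1 \<ominus> l1 \<otimes> v1 \<in> Span K L" using loc v1 v1L by blast
  have l01: "l0 = l1" using eq[OF v0 v1 l0 l1] .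
  have out: "T v \<ominus> l0 \<otimes> v \<in> Span K L" if v: "v \<in> carrier R" "v \<notin> Span K L" for v
  proof -
    obtain l where l: "l \<in> K" "T v \<ominus> l \<otimes> v \<in> Span K L" using loc v by blast
    have "l = l0"
    proof (cases "v1 \<in> Span K (v # L)")
      case False
      then show ?thesis using eq[OF v v1(1) False l l1] l01 by simp
    next
      case True
      \<comment> \<open>If \<open>v\<close> lay in this span, so would \<open>v1\<close>. Hence
        \<open>v\<close> can be compared with \<open>v0\<close> instead of
        \<open>v1\<close>.\<close>
      have "v \<notin> Span K (v0 # L)"
      proof
        assume h: "v \<in> Span K (v0 # L)"
        have "set (v # L) \<subseteq> Span K (v0 # L)"
          using h Span_base_incl[OF subfield_K, of "v0 # L"] L v0 by auto
        then have "Span K (v # L) \<subseteq> Span K (v0 # L)"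
          using mono_Span_subset[OF subfield_K] L v0 by auto
        then show False using True v1 by blast
      qed
      then show ?thesis using eq[OF v0 v(1) _ l0 l] by simp
    qed
    then show ?thesis using l by simp
  qed
  \<comment> \<open>Inside the span \<open>loc\<close> says nothing. There the claim is the
    difference of the claims for \<open>v0 \<oplus> v\<close> and \<open>v0\<close>, both
    outside.\<close>
  have "T v \<ominus> l0 \<otimes> v \<in> Span K L" if v: "v \<in> Span K L" for v
  proof -
    have vc: "v \<in> carrier R" using v Span_K(1)[OF L] by blast
    have "v0 \<oplus> v \<notin> Span K L"
    proof
      assume "v0 \<oplus> v \<in> Span K L"
      then have "v0 \<oplus> v \<ominus> v \<in> Span K L" using v Span_K_minus[OF L] by blast
      then show False using v0 vc by (simp add: a_minus_def a_assoc r_neg)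
    qed
    then have "T (v0 \<oplus> v) \<ominus> l0 \<otimes> (v0 \<oplus> v) \<in> Span K L" using out v0 vc by simp
    then have "T (v0 \<oplus> v) \<ominus> l0 \<otimes> (v0 \<oplus> v) \<ominus> (T v0 \<ominus> l0 \<otimes> v0) \<in> Span K L"
      using l0 Span_K_minus[OF L] by blast
    moreover have "T (v0 \<oplus> v) \<ominus> l0 \<otimes> (v0 \<oplus> v) \<ominus> (T v0 \<ominus> l0 \<otimes> v0) = T v \<ominus> l0 \<otimes> v"
      unfolding K_linear_add[OF T v0(1) vc]
      using v0(1) vc K_carrier[OF l0(1)] K_linear_closed[OF T v0(1)] K_linear_closed[OF T vc] by algebra
    ultimately show ?thesis by simp
  qed
  then show ?thesis using out l0(1) by blast
qed

text \<open>Right multiplication by \<open>a\<close> minus a scalar. It can replace right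
  multiplication by \<open>a\<close> in the pairs without changing their span, and a suitable
  \<open>l\<close> makes its image small.\<close>

definition eigen_shift :: "'a \<Rightarrow> 'a \<Rightarrow> 'a" where "eigen_shift l v = v \<otimes> a \<ominus> l \<otimes> v"

lemma eigen_shift_closed [simp]: "l \<in> K \<Longrightarrow> v \<in> carrier R \<Longrightarrow> eigen_shift l v \<in> carrier R"
  unfolding eigen_shift_def by simp

lemma K_linear_eigen_shift: "l \<in> K \<Longrightarrow> K_linear K (eigen_shift l)"
proof (rule K_linearI)
  fix k x assume "l \<in> K" "k \<in> K" "x \<in> carrier R"
  then have "l \<otimes> (k \<otimes> x) = k \<otimes> (l \<otimes> x)"
    using K_comm[of k l] by (simp add: m_assoc[symmetric])
  then show "eigen_shift l (k \<otimes> x) = k \<otimes> eigen_shift l x"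
    using \<open>l \<in> K\<close> \<open>k \<in> K\<close> \<open>x \<in> carrier R\<close> unfolding eigen_shift_def a_minus_def by (simp add: r_distr r_minus m_assoc)
qed (auto simp: eigen_shift_def a_minus_def l_distr r_distr minus_add a_ac)

lemma K_linear_sandwich: "set ps \<subseteq> K \<times> carrier R \<Longrightarrow> K_linear K (sandwich ps)"
proof (rule K_linearI)
  assume ps: "set ps \<subseteq> K \<times> carrier R"
  then have psR: "set ps \<subseteq> carrier R \<times> carrier R" using K_sub by auto
  fix k x y assume "x \<in> carrier R"
  then show "sandwich ps x \<in> carrier R" using psR by simp
  show "y \<in> carrier R \<Longrightarrow> sandwich ps (x \<oplus> y) = sandwich ps x \<oplus> sandwich ps y"
    using sandwich_add[OF psR] \<open>x \<in> carrier R\<close> by simp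
  show "k \<in> K \<Longrightarrow> sandwich ps (k \<otimes> x) = k \<otimes> sandwich ps x"
    using K_comm \<open>x \<in> carrier R\<close> by (intro sandwich_lmult[OF ps K_sub]) auto
qed

end

context ring
begin

lemma add_smult_swap:
  "x \<in> carrier R \<Longrightarrow> x' \<in> carrier R \<Longrightarrow> y \<in> carrier R \<Longrightarrow> y' \<in> carrier R \<Longrightarrow> t \<in> carrier R \<Longrightarrow>
   (x \<oplus> t \<otimes> x') \<oplus> (y \<oplus> t \<otimes> y') = (x \<oplus> y) \<oplus> t \<otimes> (x' \<oplus> y')"
  by algebra

lemma add_mult_swap:
  "x \<in> carrier R \<Longrightarrow> y \<in> carrier R \<Longrightarrow> p \<in> carrier R \<Longrightarrow> q \<in> carrier R \<Longrightarrow> s \<in> carrier R \<Longrightarrow>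
   w \<in> carrier R \<Longrightarrow> z \<in> carrier R \<Longrightarrow>
   (x \<oplus> p \<otimes> (s \<otimes> w)) \<oplus> (y \<oplus> q \<otimes> (s \<otimes> z)) = x \<oplus> y \<oplus> (p \<otimes> s) \<otimes> w \<oplus> (q \<otimes> s) \<otimes> z"
  by algebra

lemma add_swap4:
  "x \<in> carrier R \<Longrightarrow> x' \<in> carrier R \<Longrightarrow> y \<in> carrier R \<Longrightarrow> y' \<in> carrier R \<Longrightarrow>
   (x \<oplus> x') \<oplus> (y \<oplus> y') = (x \<oplus> y) \<oplus> (x' \<oplus> y')"
  by algebra

end

subsection \<open>Pairs of vectors \<open>u\<close>, \<open>u a\<close>\<close>

context max_subfield
begin

definition pair_comb :: "'a \<Rightarrow> (nat \<Rightarrow> 'a) \<Rightarrow> (nat \<Rightarrow> 'a) \<Rightarrow> (nat \<Rightarrow> 'a) \<Rightarrow> nat \<Rightarrow> 'a" where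
  "pair_comb l \<alpha> \<beta> u k = lincomb \<alpha> u k \<oplus> lincomb \<beta> (\<lambda>i. eigen_shift l (u i)) k"

definition pairs :: "'a \<Rightarrow> (nat \<Rightarrow> 'a) \<Rightarrow> nat \<Rightarrow> 'a list" where
  "pairs l u k = family (\<lambda>i. eigen_shift l (u i)) k @ family u k"

lemma pairs_carrier:
  assumes "l \<in> K" "\<And>i. i < k \<Longrightarrow> u i \<in> carrier R"
  shows "set (pairs l u k) \<subseteq> carrier R"
  using assms unfolding pairs_def by auto

lemma length_pairs [simp]: "length (pairs l u k) = 2 * k"
  unfolding pairs_def by simp

lemma lincomb_K_closed [simp]:
  "\<forall>i<n. \<alpha> i \<in> K \<Longrightarrow> \<forall>i<n. f i \<in> carrier R \<Longrightarrow> lincomb \<alpha> f n \<in> carrier R"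
  by (rule lincomb_closed) auto

lemma lincomb_eigen_shift_closed [simp]:
  "l \<in> K \<Longrightarrow> \<forall>i<n. \<alpha> i \<in> K \<Longrightarrow> \<forall>i<n. f i \<in> carrier R \<Longrightarrow> lincomb \<alpha> (\<lambda>i. eigen_shift l (f i)) n \<in> carrier R"
  by (rule lincomb_closed) auto

lemma pair_comb_closed [simp]:
  "l \<in> K \<Longrightarrow> \<forall>i<k. \<alpha> i \<in> K \<Longrightarrow> \<forall>i<k. \<beta> i \<in> K \<Longrightarrow> \<forall>i<k. u i \<in> carrier R \<Longrightarrow> pair_comb l \<alpha> \<beta> u k \<in> carrier R"
  unfolding pair_comb_def by simp

text \<open>The \<open>u i\<close> come first and their shifts second; this is the order in which
  the Hessenberg matrices are written.\<close>

definition pairs_fun :: "'a \<Rightarrow> (nat \<Rightarrow> 'a) \<Rightarrow> nat \<Rightarrow> nat \<Rightarrow> 'a" where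
  "pairs_fun l u k i = (if i < k then u i else eigen_shift l (u (i - k)))"

lemma pairs_eq_family: "pairs l u k = family (pairs_fun l u k) (k + k)"
  unfolding pairs_def pairs_fun_def using family_append[of k u "\<lambda>i. eigen_shift l (u i)" k] by simp

lemma pairs_fun_carrier:
  "l \<in> K \<Longrightarrow> \<forall>i<k. u i \<in> carrier R \<Longrightarrow> i < k + k \<Longrightarrow> pairs_fun l u k i \<in> carrier R"
  unfolding pairs_fun_def by auto

lemma lincomb_pairs_fun:
  assumes "l \<in> K" "\<forall>i<k. u i \<in> carrier R" "\<forall>i<k+k. \<gamma> i \<in> K"
  shows "lincomb \<gamma> (pairs_fun l u k) (k + k) = pair_comb l \<gamma> (\<lambda>i. \<gamma> (k + i)) u k"
proof -
  have "lincomb \<gamma> (pairs_fun l u k) (k + k) =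
      lincomb \<gamma> (pairs_fun l u k) k \<oplus> lincomb (\<lambda>i. \<gamma> (k + i)) (\<lambda>i. pairs_fun l u k (k + i)) k"
    using assms by (intro lincomb_append) (auto intro: pairs_fun_carrier)
  moreover have "lincomb \<gamma> (pairs_fun l u k) k = lincomb \<gamma> u k"
    by (rule lincomb_cong) (auto simp: pairs_fun_def)
  ultimately show ?thesis unfolding pair_comb_def by (simp add: pairs_fun_def)
qed

lemma mem_Span_pairs:
  assumes l: "l \<in> K" and u: "\<forall>i<k. u i \<in> carrier R"
  shows "x \<in> Span K (pairs l u k) \<longleftrightarrow>
    (\<exists>\<alpha> \<beta>. (\<forall>i<k. \<alpha> i \<in> K) \<and> (\<forall>i<k. \<beta> i \<in> K) \<and> x = pair_comb l \<alpha> \<beta> u k)"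
proof -
  let ?f = "pairs_fun l u k"
  note e = pairs_eq_family[of l u k] and f = pairs_fun_carrier[OF l u] and lcf = lincomb_pairs_fun[OF l u]
  show ?thesis
  proof
    assume "x \<in> Span K (pairs l u k)"
    then have "x \<in> Span K (family ?f (k + k))" unfolding e .
    then obtain \<gamma> where g: "\<forall>i<k+k. \<gamma> i \<in> K" "x = lincomb \<gamma> ?f (k + k)"
      by (rule Span_familyE[OF _ K_sub f])
    then show "\<exists>\<alpha> \<beta>. (\<forall>i<k. \<alpha> i \<in> K) \<and> (\<forall>i<k. \<beta> i \<in> K) \<and> x = pair_comb l \<alpha> \<beta> u k"
      using lcf[OF g(1)] by (intro exI[of _ \<gamma>] exI[of _ "\<lambda>i. \<gamma> (k + i)"]) auto
  next
    assume "\<exists>\<alpha> \<beta>. (\<forall>i<k. \<alpha> i \<in> K) \<and> (\<forall>i<k. \<beta> i \<in> K) \<and> x = pair_comb l \<alpha> \<beta> u k"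
    then obtain \<alpha> \<beta> where ab: "\<forall>i<k. \<alpha> i \<in> K" "\<forall>i<k. \<beta> i \<in> K" "x = pair_comb l \<alpha> \<beta> u k" by blast
    let ?g = "\<lambda>i. if i < k then \<alpha> i else \<beta> (i - k)"
    have g: "\<forall>i<k+k. ?g i \<in> K" using ab by auto
    have "pair_comb l ?g (\<lambda>i. ?g (k + i)) u k = pair_comb l \<alpha> \<beta> u k"
      unfolding pair_comb_def by (intro arg_cong2[where f="(\<oplus>)"] lincomb_cong) auto
    then have "x = lincomb ?g ?f (k + k)" using lcf[OF g] ab(3) by simp
    moreover have "lincomb ?g ?f (k + k) \<in> Span K (family ?f (k + k))"
      by (rule Span_familyI[OF K_sub]) (use f g in auto)
    ultimately show "x \<in> Span K (pairs l u k)" unfolding e by simp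
  qed
qed

lemma pair_comb_in_Span:
  "l \<in> K \<Longrightarrow> \<forall>i<k. u i \<in> carrier R \<Longrightarrow> \<forall>i<k. \<alpha> i \<in> K \<Longrightarrow> \<forall>i<k. \<beta> i \<in> K \<Longrightarrow>
   pair_comb l \<alpha> \<beta> u k \<in> Span K (pairs l u k)"
  using mem_Span_pairs by blast

text \<open>Rests on \<open>u a - l' u = (l - l') u + (u a - l u)\<close>: changing the shift is a
  triangular change of basis.\<close>

lemma pair_comb_shift:
  assumes "l \<in> K" "l' \<in> K" "\<forall>i<k. \<alpha> i \<in> K" "\<forall>i<k. \<beta> i \<in> K" "\<forall>i<k. u i \<in> carrier R"
  shows "pair_comb l' \<alpha> \<beta> u k = pair_comb l (\<lambda>i. \<alpha> i \<oplus> \<beta> i \<otimes> (l \<ominus> l')) \<beta> u k"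
proof -
  have "lincomb \<beta> (\<lambda>i. eigen_shift l' (u i)) k = lincomb \<beta> (\<lambda>i. (l \<ominus> l') \<otimes> u i \<oplus> eigen_shift l (u i)) k"
  proof (rule lincomb_cong)
    fix i assume "i < k"
    then have c: "u i \<in> carrier R" using assms by simp
    have "a \<in> carrier R" "l \<in> carrier R" "l' \<in> carrier R" using assms by simp_all
    then show "eigen_shift l' (u i) = (l \<ominus> l') \<otimes> u i \<oplus> eigen_shift l (u i)"
      unfolding eigen_shift_def using c by algebra
  qed simp
  also have "\<dots> = lincomb \<beta> (\<lambda>i. (l \<ominus> l') \<otimes> u i) k \<oplus> lincomb \<beta> (\<lambda>i. eigen_shift l (u i)) k"
    by (rule lincomb_add_right) (use assms in auto)
  also have "lincomb \<beta> (\<lambda>i. (l \<ominus> l') \<otimes> u i) k = lincomb (\<lambda>i. \<beta> i \<otimes> (l \<ominus> l')) u k"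
    using assms(3-5)
  proof (induction k)
    case (Suc k)
    then show ?case using assms(1,2) by (simp add: m_assoc)
  qed simp
  finally have 1: "lincomb \<beta> (\<lambda>i. eigen_shift l' (u i)) k = lincomb (\<lambda>i. \<beta> i \<otimes> (l \<ominus> l')) u k \<oplus> lincomb \<beta> (\<lambda>i. eigen_shift l (u i)) k" .
  have "lincomb (\<lambda>i. \<alpha> i \<oplus> \<beta> i \<otimes> (l \<ominus> l')) u k = lincomb \<alpha> u k \<oplus> lincomb (\<lambda>i. \<beta> i \<otimes> (l \<ominus> l')) u k"
    by (rule lincomb_add_left) (use assms in auto)
  moreover have "lincomb \<alpha> u k \<in> carrier R" "lincomb (\<lambda>i. \<beta> i \<otimes> (l \<ominus> l')) u k \<in> carrier R"
      "lincomb \<beta> (\<lambda>i. eigen_shift l (u i)) k \<in> carrier R"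
    using assms by auto
  ultimately show ?thesis unfolding pair_comb_def 1 by (simp add: a_assoc)
qed

text \<open>Independence of the \<open>2 k\<close> vectors in \<open>pairs l u k\<close>. Two
  coefficient functions spare the index arithmetic of \<open>pairs_fun\<close>.\<close>

definition indep_pairs :: "'a \<Rightarrow> (nat \<Rightarrow> 'a) \<Rightarrow> nat \<Rightarrow> bool" where
  "indep_pairs l u k \<longleftrightarrow> (\<forall>i<k. u i \<in> carrier R) \<and>
    (\<forall>\<alpha> \<beta>. (\<forall>i<k. \<alpha> i \<in> K) \<longrightarrow> (\<forall>i<k. \<beta> i \<in> K) \<longrightarrow> pair_comb l \<alpha> \<beta> u k = \<zero> \<longrightarrow>
      (\<forall>i<k. \<alpha> i = \<zero> \<and> \<beta> i = \<zero>))"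

lemma indep_pairsD: "indep_pairs l u k \<Longrightarrow> \<forall>i<k. u i \<in> carrier R"
  "indep_pairs l u k \<Longrightarrow> \<forall>i<k. \<alpha> i \<in> K \<Longrightarrow> \<forall>i<k. \<beta> i \<in> K \<Longrightarrow> pair_comb l \<alpha> \<beta> u k = \<zero> \<Longrightarrow> i < k \<Longrightarrow> \<alpha> i = \<zero>"
  "indep_pairs l u k \<Longrightarrow> \<forall>i<k. \<alpha> i \<in> K \<Longrightarrow> \<forall>i<k. \<beta> i \<in> K \<Longrightarrow> pair_comb l \<alpha> \<beta> u k = \<zero> \<Longrightarrow> i < k \<Longrightarrow> \<beta> i = \<zero>"
  unfolding indep_pairs_def by blast+

lemma indep_pairsI:
  assumes "\<forall>i<k. u i \<in> carrier R"
    "\<And>\<alpha> \<beta> i. \<forall>i<k. \<alpha> i \<in> K \<Longrightarrow> \<forall>i<k. \<beta> i \<in> K \<Longrightarrow> pair_comb l \<alpha> \<beta> u k = \<zero> \<Longrightarrow> i < k \<Longrightarrow> \<alpha> i = \<zero> \<and> \<beta> i = \<zero>"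
  shows "indep_pairs l u k"
  using assms unfolding indep_pairs_def by blast

lemma indep_pairs_independent:
  assumes "l \<in> K" "indep_pairs l u k"
  shows "independent K (family (pairs_fun l u k) (k + k))"
proof (subst independent_family_iff[OF subfield_K])
  note u = indep_pairsD(1)[OF assms(2)]
  show "pairs_fun l u k i \<in> carrier R" if "i < k + k" for i by (rule pairs_fun_carrier[OF assms(1) u that])
  show "\<forall>\<gamma>. (\<forall>i<k+k. \<gamma> i \<in> K) \<longrightarrow> lincomb \<gamma> (pairs_fun l u k) (k + k) = \<zero> \<longrightarrow> (\<forall>i<k+k. \<gamma> i = \<zero>)"
  proof (intro allI impI)
    fix \<gamma> i assume g: "\<forall>i<k+k. \<gamma> i \<in> K" "lincomb \<gamma> (pairs_fun l u k) (k + k) = \<zero>" and i: "i < k + k"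
    have z: "pair_comb l \<gamma> (\<lambda>i. \<gamma> (k + i)) u k = \<zero>" using g lincomb_pairs_fun[OF assms(1) u g(1)] by simp
    have K: "\<forall>i<k. \<gamma> i \<in> K" "\<forall>i<k. \<gamma> (k + i) \<in> K" using g by auto
    show "\<gamma> i = \<zero>"
      using indep_pairsD(2)[OF assms(2) K z, of i] indep_pairsD(3)[OF assms(2) K z, of "i - k"] i by (cases "i < k") auto
  qed
qed

lemma indep_pairs_shift:
  assumes "l \<in> K" "l' \<in> K" "indep_pairs l u k"
  shows "indep_pairs l' u k"
proof (rule indep_pairsI)
  show u: "\<forall>i<k. u i \<in> carrier R" using indep_pairsD(1)[OF assms(3)] .
  fix \<alpha> \<beta> i
  assume ab: "\<forall>i<k. \<alpha> i \<in> K" "\<forall>i<k. \<beta> i \<in> K" and z: "pair_comb l' \<alpha> \<beta> u k = \<zero>" and i: "i < k"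
  let ?a = "\<lambda>i. \<alpha> i \<oplus> \<beta> i \<otimes> (l \<ominus> l')"
  have z': "pair_comb l ?a \<beta> u k = \<zero>" using pair_comb_shift[OF assms(1,2) ab u] z by simp
  have a': "\<forall>i<k. ?a i \<in> K" using ab assms by simp
  have "\<beta> i = \<zero>" using indep_pairsD(3)[OF assms(3) a' ab(2) z' i] .
  moreover have "?a i = \<zero>" using indep_pairsD(2)[OF assms(3) a' ab(2) z' i] .
  ultimately show "\<alpha> i = \<zero> \<and> \<beta> i = \<zero>" using ab assms i by simp
qed

lemma Span_pairs_shift:
  assumes "l \<in> K" "l' \<in> K" "\<forall>i<k. u i \<in> carrier R"
  shows "Span K (pairs l u k) = Span K (pairs l' u k)"
proof -
  have "Span K (pairs l' u k) \<subseteq> Span K (pairs l u k)" if l: "l \<in> K" "l' \<in> K" for l l'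
  proof
    fix x assume "x \<in> Span K (pairs l' u k)"
    then obtain \<alpha> \<beta> where ab: "\<forall>i<k. \<alpha> i \<in> K" "\<forall>i<k. \<beta> i \<in> K" "x = pair_comb l' \<alpha> \<beta> u k"
      using mem_Span_pairs[OF l(2) assms(3)] by blast
    have "x = pair_comb l (\<lambda>i. \<alpha> i \<oplus> \<beta> i \<otimes> (l \<ominus> l')) \<beta> u k"
      using pair_comb_shift[OF l ab(1,2) assms(3)] ab(3) by simp
    moreover have "\<forall>i<k. \<alpha> i \<oplus> \<beta> i \<otimes> (l \<ominus> l') \<in> K" using ab l by simp
    ultimately show "x \<in> Span K (pairs l u k)"
      using pair_comb_in_Span[OF l(1) assms(3) _ ab(2)] by simp
  qed
  then show ?thesis using assms(1,2) by blast
qed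

lemma pair_comb_linear:
  assumes "l \<in> K" "\<forall>i<k. \<alpha> i \<in> K" "\<forall>i<k. \<beta> i \<in> K" "\<forall>i<k. p i \<in> K" "\<forall>i<k. q i \<in> K"
    "\<forall>i<k. u i \<in> carrier R" "t \<in> K"
  shows "pair_comb l (\<lambda>i. \<alpha> i \<oplus> t \<otimes> p i) (\<lambda>i. \<beta> i \<oplus> t \<otimes> q i) u k = pair_comb l \<alpha> \<beta> u k \<oplus> t \<otimes> pair_comb l p q u k"
proof -
  have "lincomb (\<lambda>i. \<alpha> i \<oplus> t \<otimes> p i) u k = lincomb \<alpha> u k \<oplus> lincomb (\<lambda>i. t \<otimes> p i) u k"
    by (rule lincomb_add_left) (use assms in auto)
  moreover have "lincomb (\<lambda>i. t \<otimes> p i) u k = t \<otimes> lincomb p u k"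
    by (rule lincomb_smult) (use assms in auto)
  moreover have "lincomb (\<lambda>i. \<beta> i \<oplus> t \<otimes> q i) (\<lambda>i. eigen_shift l (u i)) k =
      lincomb \<beta> (\<lambda>i. eigen_shift l (u i)) k \<oplus> lincomb (\<lambda>i. t \<otimes> q i) (\<lambda>i. eigen_shift l (u i)) k"
    by (rule lincomb_add_left) (use assms in auto)
  moreover have "lincomb (\<lambda>i. t \<otimes> q i) (\<lambda>i. eigen_shift l (u i)) k = t \<otimes> lincomb q (\<lambda>i. eigen_shift l (u i)) k"
    by (rule lincomb_smult) (use assms in auto)
  ultimately have "pair_comb l (\<lambda>i. \<alpha> i \<oplus> t \<otimes> p i) (\<lambda>i. \<beta> i \<oplus> t \<otimes> q i) u k =
    (lincomb \<alpha> u k \<oplus> t \<otimes> lincomb p u k) \<oplus> (lincomb \<beta> (\<lambda>i. eigen_shift l (u i)) k \<oplus> t \<otimes> lincomb q (\<lambda>i. eigen_shift l (u i)) k)"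
    unfolding pair_comb_def by simp
  moreover have "lincomb \<alpha> u k \<in> carrier R" "lincomb p u k \<in> carrier R" "t \<in> carrier R"
    "lincomb \<beta> (\<lambda>i. eigen_shift l (u i)) k \<in> carrier R" "lincomb q (\<lambda>i. eigen_shift l (u i)) k \<in> carrier R"
    using assms by auto
  ultimately show ?thesis unfolding pair_comb_def by (simp add: add_smult_swap)
qed

lemma pair_comb_update:
  assumes "l \<in> K" "\<forall>i<k. \<alpha> i \<in> K" "\<forall>i<k. \<beta> i \<in> K" "\<forall>i<k. u i \<in> carrier R"
    "i < k" "w \<in> carrier R" "s \<in> K"
  shows "pair_comb l \<alpha> \<beta> (u(i := u i \<oplus> s \<otimes> w)) k =
    pair_comb l \<alpha> \<beta> u k \<oplus> (\<alpha> i \<otimes> s) \<otimes> w \<oplus> (\<beta> i \<otimes> s) \<otimes> eigen_shift l w"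
proof -
  have "lincomb \<alpha> (u(i := u i \<oplus> s \<otimes> w)) k = lincomb \<alpha> u k \<oplus> \<alpha> i \<otimes> (s \<otimes> w)"
    by (rule lincomb_update) (use assms in auto)
  moreover have "lincomb \<beta> (\<lambda>j. eigen_shift l ((u(i := u i \<oplus> s \<otimes> w)) j)) k =
      lincomb \<beta> ((\<lambda>j. eigen_shift l (u j))(i := eigen_shift l (u i) \<oplus> s \<otimes> eigen_shift l w)) k"
    using assms by (intro lincomb_cong) (auto simp: K_linear_add[OF K_linear_eigen_shift] K_linear_smult[OF K_linear_eigen_shift])
  moreover have "\<dots> = lincomb \<beta> (\<lambda>j. eigen_shift l (u j)) k \<oplus> \<beta> i \<otimes> (s \<otimes> eigen_shift l w)"
    using lincomb_update[of i k \<beta> "\<lambda>j. eigen_shift l (u j)" "s \<otimes> eigen_shift l w"] assms by auto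
  ultimately have "pair_comb l \<alpha> \<beta> (u(i := u i \<oplus> s \<otimes> w)) k =
     (lincomb \<alpha> u k \<oplus> \<alpha> i \<otimes> (s \<otimes> w)) \<oplus> (lincomb \<beta> (\<lambda>j. eigen_shift l (u j)) k \<oplus> \<beta> i \<otimes> (s \<otimes> eigen_shift l w))"
    unfolding pair_comb_def by simp
  moreover have "lincomb \<alpha> u k \<in> carrier R" "lincomb \<beta> (\<lambda>i. eigen_shift l (u i)) k \<in> carrier R" "s \<in> carrier R"
      "\<alpha> i \<in> carrier R" "\<beta> i \<in> carrier R" "w \<in> carrier R" "eigen_shift l w \<in> carrier R"
    using assms by auto
  ultimately show ?thesis unfolding pair_comb_def by (simp add: add_mult_swap)
qed

text \<open>A relation created by the new pair must involve \<open>v a\<close>, since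
  \<open>v\<close> is outside the span and the old pairs are independent. Dividing by the
  coefficient of \<open>v a\<close> makes \<open>v\<close> an eigenvector of right multiplication by
  \<open>a\<close> modulo the span.\<close>

lemma indep_pairs_extend:
  assumes g: "indep_pairs \<zero> u k" and v: "v \<in> carrier R"
    and n: "\<not> indep_pairs \<zero> (u(k := v)) (Suc k)" and vs: "v \<notin> Span K (pairs \<zero> u k)"
  shows "\<exists>l\<in>K. eigen_shift l v \<in> Span K (pairs \<zero> u k)"
proof -
  have u: "\<forall>i<k. u i \<in> carrier R" using indep_pairsD(1)[OF g] .
  have uv: "\<forall>i<Suc k. (u(k := v)) i \<in> carrier R" using u v by (auto simp: less_Suc_eq)
  obtain \<alpha> \<beta> i where ab: "\<forall>i<Suc k. \<alpha> i \<in> K" "\<forall>i<Suc k. \<beta> i \<in> K"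
      "pair_comb \<zero> \<alpha> \<beta> (u(k := v)) (Suc k) = \<zero>" "i < Suc k" "\<not> (\<alpha> i = \<zero> \<and> \<beta> i = \<zero>)"
    using n uv indep_pairsI[of "Suc k" "u(k := v)" \<zero>] by blast
  let ?c = "pair_comb \<zero> \<alpha> \<beta> u k"
  have "lincomb \<alpha> (u(k := v)) k = lincomb \<alpha> u k" "lincomb \<beta> (\<lambda>i. eigen_shift \<zero> ((u(k := v)) i)) k = lincomb \<beta> (\<lambda>i. eigen_shift \<zero> (u i)) k"
    by (rule lincomb_cong; simp)+
  then have "pair_comb \<zero> \<alpha> \<beta> (u(k := v)) (Suc k) =
      (lincomb \<alpha> u k \<oplus> \<alpha> k \<otimes> v) \<oplus> (lincomb \<beta> (\<lambda>i. eigen_shift \<zero> (u i)) k \<oplus> \<beta> k \<otimes> eigen_shift \<zero> v)"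
    unfolding pair_comb_def by simp
  moreover have c: "lincomb \<alpha> u k \<in> carrier R" "lincomb \<beta> (\<lambda>i. eigen_shift \<zero> (u i)) k \<in> carrier R"
      "\<alpha> k \<in> carrier R" "\<beta> k \<in> carrier R" "eigen_shift \<zero> v \<in> carrier R"
    using ab u v by auto
  ultimately have e: "?c \<oplus> (\<alpha> k \<otimes> v \<oplus> \<beta> k \<otimes> eigen_shift \<zero> v) = \<zero>"
    using ab(3) v unfolding pair_comb_def by (simp add: add_swap4)
  have cs: "?c \<in> Span K (pairs \<zero> u k)" using pair_comb_in_Span u ab by simp
  have pc: "set (pairs \<zero> u k) \<subseteq> carrier R" using pairs_carrier u by simp
  have cc: "?c \<in> carrier R" using ab u by simp
  have s: "\<alpha> k \<otimes> v \<oplus> \<beta> k \<otimes> eigen_shift \<zero> v \<in> Span K (pairs \<zero> u k)"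
  proof -
    have "\<alpha> k \<otimes> v \<oplus> \<beta> k \<otimes> eigen_shift \<zero> v = \<ominus> ?c" using e cc c v by (metis a_closed a_comm m_closed minus_equality)
    then show ?thesis using cs Span_K(4)[OF pc] by simp
  qed
  have b: "\<beta> k \<noteq> \<zero>"
  proof
    assume b0: "\<beta> k = \<zero>"
    then have "\<alpha> k \<otimes> v \<in> Span K (pairs \<zero> u k)" using s c v by simp
    then have a0: "\<alpha> k = \<zero>" using Span_K_divide[OF pc, of "\<alpha> k" v] vs v ab by auto
    then have "?c = \<zero>" using e b0 c v cc by simp
    then have "\<forall>i<k. \<alpha> i = \<zero> \<and> \<beta> i = \<zero>" using indep_pairsD(2,3)[OF g, of \<alpha> \<beta>] ab by auto
    then show False using ab(4,5) a0 b0 by (auto simp: less_Suc_eq)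
  qed
  have bK: "\<beta> k \<in> K" "\<alpha> k \<in> K" using ab by auto
  let ?l = "\<ominus> (inv (\<beta> k) \<otimes> \<alpha> k)"
  have ib: "inv (\<beta> k) \<in> K" "inv (\<beta> k) \<in> carrier R" using b bK by auto
  have "inv (\<beta> k) \<otimes> (\<alpha> k \<otimes> v \<oplus> \<beta> k \<otimes> eigen_shift \<zero> v) \<in> Span K (pairs \<zero> u k)"
    using Span_K(5)[OF pc ib(1) s] .
  moreover have "inv (\<beta> k) \<otimes> (\<alpha> k \<otimes> v \<oplus> \<beta> k \<otimes> eigen_shift \<zero> v) = inv (\<beta> k) \<otimes> \<alpha> k \<otimes> v \<oplus> eigen_shift \<zero> v"
    using ib c v b by (simp add: r_distr m_assoc)
  moreover have "\<dots> = eigen_shift ?l v"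
    using ib c(3) v a_carrier unfolding eigen_shift_def by algebra
  ultimately show ?thesis using ib bK by auto
qed

text \<open>When no system of \<open>k + 1\<close> pairs exists, \<open>indep_pairs_extend\<close>
  makes every vector outside the span an eigenvector modulo it, and the quotient has dimension at
  least two.\<close>

lemma scalar_modulo_pairs:
  assumes g: "indep_pairs \<zero> u k" and b: "dim_ge (2 * k + 2)" and n: "\<nexists>u. indep_pairs \<zero> u (Suc k)"
  shows "\<exists>l\<in>K. \<forall>v\<in>carrier R. eigen_shift l v \<in> Span K (pairs \<zero> u k)"
proof -
  have pc: "set (pairs \<zero> u k) \<subseteq> carrier R" using pairs_carrier indep_pairsD(1)[OF g] by simp
  have "\<exists>l\<in>K. \<forall>v\<in>carrier R. v \<otimes> a \<ominus> l \<otimes> v \<in> Span K (pairs \<zero> u k)"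
  proof (rule K_linear_scalar[OF pc])
    show "K_linear K (\<lambda>v. v \<otimes> a)" by (rule K_linearI) (auto simp: l_distr m_assoc)
    show "dim_ge (length (pairs \<zero> u k) + 2)" using b by simp
    fix v assume "v \<in> carrier R" "v \<notin> Span K (pairs \<zero> u k)"
    then have "\<exists>l\<in>K. eigen_shift l v \<in> Span K (pairs \<zero> u k)" using indep_pairs_extend[OF g] n by blast
    then show "\<exists>l\<in>K. v \<otimes> a \<ominus> l \<otimes> v \<in> Span K (pairs \<zero> u k)" unfolding eigen_shift_def .
  qed
  then show ?thesis unfolding eigen_shift_def .
qed

text \<open>As \<open>w\<close> is outside the span and \<open>w a - l w\<close> is inside it, a relation among the new pairs has no
  \<open>u i\<close> term, and the factor \<open>1 + s q\<^sub>i\<close> on the term of \<open>u i a - l u i\<close> forces that one to vanish too.\<close>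

lemma indep_pairs_perturb:
  assumes l: "l \<in> K" and g: "indep_pairs l u k" and i: "i < k"
    and w: "w \<in> carrier R" "w \<notin> Span K (pairs l u k)"
    and pq: "\<forall>i<k. p i \<in> K" "\<forall>i<k. q i \<in> K" "eigen_shift l w = pair_comb l p q u k"
    and s: "s \<in> K" "s \<noteq> \<zero>" "\<one> \<oplus> s \<otimes> q i \<noteq> \<zero>"
  shows "indep_pairs l (u(i := u i \<oplus> s \<otimes> w)) k"
proof (rule indep_pairsI)
  have u: "\<forall>i<k. u i \<in> carrier R" using indep_pairsD(1)[OF g] .
  have pc: "set (pairs l u k) \<subseteq> carrier R" using pairs_carrier u l by simp
  show "\<forall>j<k. (u(i := u i \<oplus> s \<otimes> w)) j \<in> carrier R" using u w s i by auto
  fix \<alpha> \<beta> j assume ab: "\<forall>i<k. \<alpha> i \<in> K" "\<forall>i<k. \<beta> i \<in> K"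
    and z: "pair_comb l \<alpha> \<beta> (u(i := u i \<oplus> s \<otimes> w)) k = \<zero>" and j: "j < k"
  have iK: "\<alpha> i \<in> K" "\<beta> i \<in> K" "q i \<in> K" "p i \<in> K" using ab pq i by auto
  let ?c = "pair_comb l \<alpha> \<beta> u k \<oplus> (\<beta> i \<otimes> s) \<otimes> pair_comb l p q u k"
  have c1: "pair_comb l \<alpha> \<beta> u k \<in> carrier R" "pair_comb l p q u k \<in> carrier R" using ab pq l u by auto
  have e: "pair_comb l \<alpha> \<beta> u k \<oplus> (\<alpha> i \<otimes> s) \<otimes> w \<oplus> (\<beta> i \<otimes> s) \<otimes> pair_comb l p q u k = \<zero>"
    using pair_comb_update[OF l ab u i w(1) s(1)] z pq(3) by simp
  have cc: "?c = pair_comb l (\<lambda>j. \<alpha> j \<oplus> (\<beta> i \<otimes> s) \<otimes> p j) (\<lambda>j. \<beta> j \<oplus> (\<beta> i \<otimes> s) \<otimes> q j) u k"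
    using pair_comb_linear[OF l ab pq(1,2) u, of "\<beta> i \<otimes> s"] iK s by simp
  have K1: "\<forall>j<k. \<alpha> j \<oplus> (\<beta> i \<otimes> s) \<otimes> p j \<in> K" "\<forall>j<k. \<beta> j \<oplus> (\<beta> i \<otimes> s) \<otimes> q j \<in> K"
    using ab pq iK s by auto
  have cS: "?c \<in> Span K (pairs l u k)" unfolding cc using pair_comb_in_Span[OF l u K1] .
  have e2: "?c \<oplus> (\<alpha> i \<otimes> s) \<otimes> w = \<zero>"
  proof -
    have "(\<alpha> i \<otimes> s) \<otimes> w \<in> carrier R" "(\<beta> i \<otimes> s) \<otimes> pair_comb l p q u k \<in> carrier R"
      using iK s w c1 by auto
    then show ?thesis using e c1 by (simp add: a_ac)
  qed
  have a0: "\<alpha> i = \<zero>"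
  proof (rule ccontr)
    assume a0: "\<alpha> i \<noteq> \<zero>"
    have "(\<alpha> i \<otimes> s) \<otimes> w = \<ominus> ?c"
    proof -
      have "(\<alpha> i \<otimes> s) \<otimes> w \<in> carrier R" "?c \<in> carrier R"
        using iK s w c1 by auto
      then show ?thesis using e2 by (metis a_comm minus_equality)
    qed
    then have "(\<alpha> i \<otimes> s) \<otimes> w \<in> Span K (pairs l u k)" using cS Span_K(4)[OF pc] by simp
    then show False using Span_K_divide[OF pc, of "\<alpha> i \<otimes> s" w] a0 iK s w by auto
  qed
  have c0: "pair_comb l (\<lambda>j. \<alpha> j \<oplus> (\<beta> i \<otimes> s) \<otimes> p j) (\<lambda>j. \<beta> j \<oplus> (\<beta> i \<otimes> s) \<otimes> q j) u k = \<zero>"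
  proof -
    have "?c \<oplus> \<zero> = \<zero>" using e2 a0 s w by simp
    then have "?c = \<zero>" using c1 iK s(1) by simp
    then show ?thesis unfolding cc .
  qed
  have "\<beta> i \<oplus> (\<beta> i \<otimes> s) \<otimes> q i = \<zero>" using indep_pairsD(3)[OF g K1 c0 i] .
  then have "\<beta> i \<otimes> (\<one> \<oplus> s \<otimes> q i) = \<zero>" using iK s by (simp add: r_distr m_assoc)
  then have b0: "\<beta> i = \<zero>" using s(3) iK s(1) by simp
  have "\<alpha> j \<oplus> (\<beta> i \<otimes> s) \<otimes> p j = \<zero>" "\<beta> j \<oplus> (\<beta> i \<otimes> s) \<otimes> q j = \<zero>"
    using indep_pairsD(2,3)[OF g K1 c0 j] by blast+
  then show "\<alpha> j = \<zero> \<and> \<beta> j = \<zero>" using b0 ab pq s j by simp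
qed

lemma indep_pairs_unique:
  assumes l: "l \<in> K" and g: "indep_pairs l u k" and K: "\<forall>i<k. \<alpha> i \<in> K" "\<forall>i<k. \<beta> i \<in> K" "\<forall>i<k. \<alpha>' i \<in> K" "\<forall>i<k. \<beta>' i \<in> K"
    and e: "pair_comb l \<alpha> \<beta> u k = pair_comb l \<alpha>' \<beta>' u k" and i: "i < k"
  shows "\<alpha> i = \<alpha>' i" "\<beta> i = \<beta>' i"
proof -
  have u: "\<forall>i<k. u i \<in> carrier R" using indep_pairsD(1)[OF g] .
  let ?m = "\<ominus> \<one>"
  have c: "pair_comb l \<alpha>' \<beta>' u k \<in> carrier R" using K l u by auto
  have m: "?m \<in> K" by simp
  have z: "pair_comb l (\<lambda>i. \<alpha> i \<oplus> ?m \<otimes> \<alpha>' i) (\<lambda>i. \<beta> i \<oplus> ?m \<otimes> \<beta>' i) u k = \<zero>"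
    unfolding pair_comb_linear[OF l K u m] e using c by (simp add: l_minus r_neg)
  have K': "\<forall>j<k. \<alpha> j \<oplus> ?m \<otimes> \<alpha>' j \<in> K" "\<forall>j<k. \<beta> j \<oplus> ?m \<otimes> \<beta>' j \<in> K" using K by auto
  have "\<alpha> i \<oplus> ?m \<otimes> \<alpha>' i = \<zero>" "\<beta> i \<oplus> ?m \<otimes> \<beta>' i = \<zero>"
    using indep_pairsD(2,3)[OF g K' z i] by blast+
  moreover have "\<alpha> i \<in> carrier R" "\<beta> i \<in> carrier R" "\<alpha>' i \<in> carrier R" "\<beta>' i \<in> carrier R" using K i by auto
  ultimately show "\<alpha> i = \<alpha>' i" "\<beta> i = \<beta>' i"
    by (simp_all add: l_minus a_minus_def[symmetric] minus_eq_zero_iff)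
qed

text \<open>Moving \<open>u i\<close> by a multiple of some \<open>w\<close> outside the span gives
  another system of \<open>k\<close> pairs, whose span must contain the image of
  \<open>eigen_shift l\<close> as well. Comparing the two expansions makes the coordinates
  \<open>(x i, y i)\<close> of every image vector proportional to
  \<open>(p i, inv s \<oplus> q i)\<close>. The image of \<open>u i\<close> itself has coordinates
  \<open>(\<zero>, \<one>)\<close>, so \<open>p i\<close> vanishes, and with it \<open>x i\<close>
  for every \<open>v\<close>.\<close>

lemma scalar_modulo_pairs_image:
  assumes g: "indep_pairs \<zero> u k" and b: "dim_ge (2 * k + 2)" and n: "\<nexists>u. indep_pairs \<zero> u (Suc k)"
    and l: "l \<in> K" and st: "\<forall>v\<in>carrier R. eigen_shift l v \<in> Span K (pairs \<zero> u k)"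
    and v: "v \<in> carrier R" and xy: "\<forall>i<k. x i \<in> K" "\<forall>i<k. y i \<in> K" "eigen_shift l v = pair_comb l x y u k"
    and i: "i < k"
  shows "x i = \<zero>"
proof -
  have gl: "indep_pairs l u k" using indep_pairs_shift[OF _ l g] by simp
  have u: "\<forall>i<k. u i \<in> carrier R" using indep_pairsD(1)[OF g] .
  have horner: "Span K (pairs \<zero> u k) = Span K (pairs l u k)" using Span_pairs_shift[OF _ l u] by simp
  have pc: "set (pairs l u k) \<subseteq> carrier R" using pairs_carrier u l by simp
  obtain w where w: "w \<in> carrier R" "w \<notin> Span K (pairs l u k)" using dim_geD[OF b pc] by auto
  have "eigen_shift l w \<in> Span K (pairs l u k)" using st w horner by simp
  then obtain p q where pq: "\<forall>i<k. p i \<in> K" "\<forall>i<k. q i \<in> K" "eigen_shift l w = pair_comb l p q u k"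
    using mem_Span_pairs[OF l u] by blast
  have iK: "q i \<in> K" "p i \<in> K" using pq i by auto
  \<comment> \<open>The choice \<open>\<one>\<close> serves unless \<open>q i\<close> is
    \<open>- 1\<close>, and then \<open>a\<close> does, because \<open>a\<close> differs from
    \<open>\<one>\<close>.\<close>
  obtain s where s: "s \<in> K" "s \<noteq> \<zero>" "\<one> \<oplus> s \<otimes> q i \<noteq> \<zero>"
  proof (cases "\<one> \<oplus> \<one> \<otimes> q i = \<zero>")
    case False
    then show ?thesis using that[of \<one>] by simp
  next
    case True
    then have "q i \<oplus> \<one> = \<zero>" using iK by (simp add: a_comm)
    then have "q i = \<ominus> \<one>" using iK by (metis K_carrier minus_equality one_closed)
    then have "\<one> \<oplus> a \<otimes> q i = \<one> \<ominus> a" by (simp add: r_minus a_minus_def)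
    then have "\<one> \<oplus> a \<otimes> q i \<noteq> \<zero>" using a_neq by (metis a_carrier minus_eq_zero_iff one_closed)
    then show ?thesis using that[of a] a_neq a_in_K by simp
  qed
  let ?u = "u(i := u i \<oplus> s \<otimes> w)"
  have g': "indep_pairs l ?u k" by (rule indep_pairs_perturb[OF l gl i w pq s])
  have u': "\<forall>j<k. ?u j \<in> carrier R" using indep_pairsD(1)[OF g'] .
  have g0: "indep_pairs \<zero> ?u k" using indep_pairs_shift[OF l _ g'] by simp
  obtain l' where l': "l' \<in> K" "\<forall>v\<in>carrier R. eigen_shift l' v \<in> Span K (pairs \<zero> ?u k)"
    using scalar_modulo_pairs[OF g0 b n] by blast
  have pe': "Span K (pairs \<zero> ?u k) = Span K (pairs l ?u k)"
    by (rule Span_pairs_shift[OF K_closed(1) l u'])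
  have wL: "set (w # pairs l u k) \<subseteq> carrier R" using w pc by simp
  have sub: "Span K (pairs l u k) \<subseteq> Span K (w # pairs l u k)"
    by (rule mono_Span[OF subfield_K pc w(1)])
  have sub': "Span K (pairs l ?u k) \<subseteq> Span K (w # pairs l u k)"
  proof
    fix z assume "z \<in> Span K (pairs l ?u k)"
    then obtain \<alpha> \<beta> where ab: "\<forall>i<k. \<alpha> i \<in> K" "\<forall>i<k. \<beta> i \<in> K" "z = pair_comb l \<alpha> \<beta> ?u k"
      using mem_Span_pairs[OF l u'] by blast
    have abi: "\<alpha> i \<in> K" "\<beta> i \<in> K" using ab i by auto
    have z: "z = pair_comb l \<alpha> \<beta> u k \<oplus> (\<alpha> i \<otimes> s) \<otimes> w \<oplus> (\<beta> i \<otimes> s) \<otimes> eigen_shift l w"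
      using pair_comb_update[OF l ab(1,2) u i w(1) s(1)] ab(3) by simp
    have "pair_comb l \<alpha> \<beta> u k \<in> Span K (w # pairs l u k)" using pair_comb_in_Span[OF l u ab(1,2)] sub by blast
    moreover have "(\<alpha> i \<otimes> s) \<otimes> w \<in> Span K (w # pairs l u k)"
      using Span_K(5)[OF wL, of "\<alpha> i \<otimes> s" w] Span_base_incl[OF subfield_K wL] abi s by auto
    moreover have "(\<beta> i \<otimes> s) \<otimes> eigen_shift l w \<in> Span K (w # pairs l u k)"
      using Span_K(5)[OF wL, of "\<beta> i \<otimes> s" "eigen_shift l w"] pair_comb_in_Span[OF l u pq(1,2)] pq(3) sub abi s by auto
    ultimately show "z \<in> Span K (w # pairs l u k)" unfolding z using Span_K(3)[OF wL] by blast
  qed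
  \<comment> \<open>Both spans lie in \<open>Span K (w # pairs l u k)\<close>, which has
    \<open>2 k + 1\<close> generators and so misses some \<open>v\<close>. If the scalars differed,
    \<open>(l' - l) v\<close> would lie in it, and \<open>v\<close> too.\<close>
  have "l' = l"
  proof (rule ccontr)
    assume ne: "l' \<noteq> l"
    have "length (w # pairs l u k) < 2 * k + 2" by simp
    then obtain v where v: "v \<in> carrier R" "v \<notin> Span K (w # pairs l u k)" using dim_geD[OF b wL] by blast
    have "eigen_shift l' v \<in> Span K (w # pairs l u k)" using l'(2) v(1) pe' sub' by blast
    moreover have "eigen_shift l v \<in> Span K (w # pairs l u k)" using st v(1) horner sub by blast
    ultimately have "eigen_shift l v \<ominus> eigen_shift l' v \<in> Span K (w # pairs l u k)" using Span_K_minus[OF wL] by blast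
    moreover have "eigen_shift l v \<ominus> eigen_shift l' v = (l' \<ominus> l) \<otimes> v"
      unfolding eigen_shift_def using a_carrier v(1) K_carrier[OF l] K_carrier[OF l'(1)] by algebra
    moreover have "l' \<ominus> l \<noteq> \<zero>" using ne l l' by (simp add: minus_eq_zero_iff)
    ultimately show False using Span_K_divide[OF wL, of "l' \<ominus> l" v] v l l' by auto
  qed
  then have st': "\<forall>v\<in>carrier R. eigen_shift l v \<in> Span K (pairs l ?u k)" using l'(2) pe' by simp
  have key: "\<exists>t\<in>K. x i = t \<otimes> p i \<and> y i = t \<otimes> (inv s \<oplus> q i)"
    if v: "v \<in> carrier R" and xy: "\<forall>i<k. x i \<in> K" "\<forall>i<k. y i \<in> K" "eigen_shift l v = pair_comb l x y u k" for v x y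
  proof -
    obtain \<alpha> \<beta> where ab: "\<forall>i<k. \<alpha> i \<in> K" "\<forall>i<k. \<beta> i \<in> K" "eigen_shift l v = pair_comb l \<alpha> \<beta> ?u k"
      using mem_Span_pairs[OF l u'] st' v by blast
    have abi: "\<alpha> i \<in> K" "\<beta> i \<in> K" using ab i by auto
    have c: "pair_comb l \<alpha> \<beta> u k \<in> carrier R" "pair_comb l p q u k \<in> carrier R" "pair_comb l x y u k \<in> carrier R"
      using ab(1,2) pq(1,2) xy(1,2) l u by auto
    have z: "pair_comb l x y u k = pair_comb l \<alpha> \<beta> u k \<oplus> (\<alpha> i \<otimes> s) \<otimes> w \<oplus> (\<beta> i \<otimes> s) \<otimes> pair_comb l p q u k"
      using pair_comb_update[OF l ab(1,2) u i w(1) s(1)] ab(3) xy(3) pq(3) by simp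
    let ?t = "\<beta> i \<otimes> s"
    have t: "?t \<in> K" using abi s by simp
    let ?A = "\<lambda>j. \<alpha> j \<oplus> ?t \<otimes> p j" and ?B = "\<lambda>j. \<beta> j \<oplus> ?t \<otimes> q j"
    have cl: "pair_comb l ?A ?B u k = pair_comb l \<alpha> \<beta> u k \<oplus> ?t \<otimes> pair_comb l p q u k"
      by (rule pair_comb_linear[OF l ab(1,2) pq(1,2) u t])
    have AB: "\<forall>j<k. ?A j \<in> K" "\<forall>j<k. ?B j \<in> K" using ab pq t by auto
    have ABc: "pair_comb l ?A ?B u k \<in> carrier R" using AB l u by auto
    have asw: "(\<alpha> i \<otimes> s) \<otimes> w \<in> carrier R" using abi s w by simp
    have z2: "pair_comb l x y u k = pair_comb l ?A ?B u k \<oplus> (\<alpha> i \<otimes> s) \<otimes> w"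
      unfolding cl z using c asw t by (simp add: a_ac)
    then have "(\<alpha> i \<otimes> s) \<otimes> w = pair_comb l x y u k \<ominus> pair_comb l ?A ?B u k"
      using ABc asw by (simp add: a_minus_def a_ac r_neg r_neg1 r_neg2)
    then have "(\<alpha> i \<otimes> s) \<otimes> w \<in> Span K (pairs l u k)"
      using Span_K_minus[OF pc pair_comb_in_Span[OF l u xy(1,2)] pair_comb_in_Span[OF l u AB]] by simp
    then have "\<alpha> i \<otimes> s = \<zero>" using Span_K_divide[OF pc, of "\<alpha> i \<otimes> s" w] abi s w by auto
    then have a0: "\<alpha> i = \<zero>" using abi s by simp
    then have "pair_comb l x y u k = pair_comb l ?A ?B u k" using z2 ABc w s by simp
    then have "x i = ?A i" "y i = ?B i" using indep_pairs_unique[OF l gl xy(1,2) AB _ i] by blast+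
    then have "x i = ?t \<otimes> p i" "y i = ?t \<otimes> (inv s \<oplus> q i)"
      using a0 abi s iK by (simp_all add: r_distr m_assoc)
    then show ?thesis using t by blast
  qed
  have d: "\<forall>j<k. (\<lambda>_. \<zero>) j \<in> K" "\<forall>j<k. (\<lambda>j. if j = i then \<one> else \<zero>) j \<in> K" by auto
  have "pair_comb l (\<lambda>_. \<zero>) (\<lambda>j. if j = i then \<one> else \<zero>) u k = eigen_shift l (u i)"
  proof -
    have "lincomb (\<lambda>_. \<zero>) u k = \<zero>" by (rule lincomb_zero_left) (use u in auto)
    moreover have "lincomb (\<lambda>j. if j = i then \<one> else \<zero>) (\<lambda>j. eigen_shift l (u j)) k = eigen_shift l (u i)"
      by (rule lincomb_delta[OF i]) (use u l in auto)
    ultimately show ?thesis unfolding pair_comb_def using u l i by simp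
  qed
  then have "\<exists>t\<in>K. \<zero> = t \<otimes> p i \<and> \<one> = t \<otimes> (inv s \<oplus> q i)"
    using key[of "u i" "\<lambda>_. \<zero>" "\<lambda>j. if j = i then \<one> else \<zero>"] d u i by simp
  then obtain t where t: "t \<in> K" "\<zero> = t \<otimes> p i" "\<one> = t \<otimes> (inv s \<oplus> q i)" by blast
  have "t \<noteq> \<zero>" using t(3) s iK by force
  then have "p i = \<zero>" using t(1,2) iK by (metis K_carrier mult_eq_zero_iff)
  then show ?thesis using key[OF v xy] by force
qed

text \<open>If no system of \<open>k + 1\<close> pairs exists, the image of
  \<open>eigen_shift l\<close> is spanned by the images of the \<open>u i\<close>, so
  \<open>D\<close> is the sum of the span of \<open>u\<close> and the kernel \<open>Z\<close>. Take
  \<open>h\<close> not commuting with \<open>a\<close> and \<open>k + 1\<close> independent vectors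
  of \<open>Z\<close>. Modulo \<open>Z\<close> their products with \<open>h\<close> come from a
  space spanned by \<open>k\<close> vectors, so some nonzero \<open>x\<close> in \<open>Z\<close>
  has \<open>x h\<close> in \<open>Z\<close>. Then \<open>x (h a - a h) = 0\<close>, which is
  impossible.\<close>

lemma exists_indep_pairs: "dim_ge (2 * k) \<Longrightarrow> \<exists>u. indep_pairs \<zero> u k"
proof (induction k)
  case 0
  show ?case by (simp add: indep_pairs_def)
next
  case (Suc k)
  have b: "dim_ge (2 * k + 2)" using Suc.prems by simp
  then have "dim_ge (2 * k)" by (rule dim_ge_mono) simp
  then obtain u where g: "indep_pairs \<zero> u k" using Suc.IH by blast
  show ?case
  proof (rule ccontr)
    assume n: "\<not> ?case"
    obtain l where l: "l \<in> K" and st: "\<forall>v\<in>carrier R. eigen_shift l v \<in> Span K (pairs \<zero> u k)"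
      using scalar_modulo_pairs[OF g b n] by blast
    have u: "\<forall>i<k. u i \<in> carrier R" using indep_pairsD(1)[OF g] .
    have horner: "Span K (pairs \<zero> u k) = Span K (pairs l u k)" using Span_pairs_shift[OF _ l u] by simp
    define Z where "Z = {z \<in> carrier R. eigen_shift l z = \<zero>}"
    \<comment> \<open>As the \<open>u i\<close> components vanish, \<open>eigen_shift l\<close>
      takes the same value at \<open>v\<close> and at \<open>lincomb y u k\<close>, so their
      difference is in the kernel.\<close>
    have dec: "\<exists>\<beta> z. (\<forall>i<k. \<beta> i \<in> K) \<and> z \<in> Z \<and> v = lincomb \<beta> u k \<oplus> z" if v: "v \<in> carrier R" for v
    proof -
      have "eigen_shift l v \<in> Span K (pairs l u k)" using st v horner by simp
      then obtain x y where xy: "\<forall>i<k. x i \<in> K" "\<forall>i<k. y i \<in> K" "eigen_shift l v = pair_comb l x y u k"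
        using mem_Span_pairs[OF l u] by blast
      have x0: "x i = \<zero>" if "i < k" for i by (rule scalar_modulo_pairs_image[OF g b n l st v xy that])
      have lcy: "lincomb y u k \<in> carrier R" using xy u by simp
      have "lincomb x u k = \<zero>" using x0 u by (intro lincomb_zero_left) auto
      then have "eigen_shift l v = eigen_shift l (lincomb y u k)"
        using xy l u K_linear_lincomb[OF K_linear_eigen_shift[OF l] K_sub, of k y u] unfolding pair_comb_def by simp
      then have "v \<ominus> lincomb y u k \<in> Z"
        unfolding Z_def using v lcy l by (simp add: K_linear_minus[OF K_linear_eigen_shift[OF l]] minus_eq_zero_iff)
      moreover have "v = lincomb y u k \<oplus> (v \<ominus> lincomb y u k)"
        using v lcy by (simp add: a_minus_def a_ac r_neg r_neg1 r_neg2)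
      ultimately show ?thesis using xy by blast
    qed
    have uc: "set (family u k) \<subseteq> carrier R" using u by auto
    have "\<exists>z. (\<forall>i<j. z i \<in> Z) \<and> independent K (family z j)" if "j \<le> Suc k" for j
      using that
    proof (induction j)
      case 0
      show ?case by (simp add: li_Nil)
    next
      case (Suc j)
      then obtain z where z: "\<forall>i<j. z i \<in> Z" "independent K (family z j)" by auto
      have zc: "set (family z j) \<subseteq> carrier R" using z unfolding Z_def by auto
      \<comment> \<open>At most \<open>2 k\<close> vectors are present so far. The \<open>Z\<close>
        part of a vector outside their span is outside the span of the \<open>z i\<close>.\<close>
      obtain v where v: "v \<in> carrier R" "v \<notin> Span K (family z j @ family u k)"
        using dim_geD[OF b, of "family z j @ family u k"] zc uc Suc.prems by auto
      obtain \<beta> z' where bz: "\<forall>i<k. \<beta> i \<in> K" "z' \<in> Z" "v = lincomb \<beta> u k \<oplus> z'" using dec v by blast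
      have "z' \<notin> Span K (family z j)"
      proof
        assume "z' \<in> Span K (family z j)"
        then have "z' \<in> Span K (family z j @ family u k)"
          using mono_Span_append(1)[OF subfield_K zc uc] by blast
        moreover have "lincomb \<beta> u k \<in> Span K (family u k)"
          by (rule Span_familyI[OF K_sub]) (use u bz in auto)
        then have "lincomb \<beta> u k \<in> Span K (family z j @ family u k)"
          using mono_Span_append(2)[OF subfield_K uc zc] by blast
        ultimately show False using v bz(3) Span_K(3)[of "family z j @ family u k"] zc uc by auto
      qed
      moreover have "family (z(j := z')) j = family z j" by (rule family_cong) simp
      ultimately have "independent K (family (z(j := z')) (Suc j))"
        using z(2) bz(2) unfolding Z_def by (simp add: independent_Cons_iff)
      moreover have "\<forall>i<Suc j. (z(j := z')) i \<in> Z" using z bz by (auto simp: less_Suc_eq)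
      ultimately show ?case by blast
    qed
    then obtain z where z: "\<forall>i<Suc k. z i \<in> Z" "independent K (family z (Suc k))" by blast
    have zc: "z i \<in> carrier R" "z i \<otimes> a = l \<otimes> z i" if "i < Suc k" for i
      using z(1) that l unfolding Z_def eigen_shift_def by (auto simp: minus_eq_zero_iff)
    obtain h where h: "h \<in> carrier R" "h \<otimes> a \<noteq> a \<otimes> h" using noncommuting by blast
    have "\<exists>\<beta> z'. (\<forall>j<k. \<beta> j \<in> K) \<and> z' \<in> Z \<and> z i \<otimes> h = lincomb \<beta> u k \<oplus> z'" if "i < Suc k" for i
      using dec zc(1)[OF that] h by simp
    then obtain \<beta> z' where bz: "\<And>i. i < Suc k \<Longrightarrow> \<forall>j<k. \<beta> i j \<in> K" "\<And>i. i < Suc k \<Longrightarrow> z' i \<in> Z"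
        "\<And>i. i < Suc k \<Longrightarrow> z i \<otimes> h = lincomb (\<beta> i) u k \<oplus> z' i" by metis
    let ?f = "\<lambda>i. lincomb (\<beta> i) u k"
    have fc: "?f i \<in> carrier R" if "i < Suc k" for i using bz(1)[OF that] u by simp
    have "?f i \<in> Span K (family u k)" if "i < Suc k" for i
      by (rule Span_familyI[OF K_sub]) (use u bz(1)[OF that] in auto)
    then have fS: "set (family ?f (Suc k)) \<subseteq> Span K (family u k)" by auto
    have "\<not> independent K (family ?f (Suc k))"
    proof
      assume i: "independent K (family ?f (Suc k))"
      have "independent K (family u k)"
      proof (subst independent_family_iff[OF subfield_K])
        show "u i \<in> carrier R" if "i < k" for i using u that by simp
        show "\<forall>\<alpha>. (\<forall>i<k. \<alpha> i \<in> K) \<longrightarrow> lincomb \<alpha> u k = \<zero> \<longrightarrow> (\<forall>i<k. \<alpha> i = \<zero>)"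
        proof (intro allI impI)
          fix \<alpha> i assume al: "\<forall>i<k. \<alpha> i \<in> K" "lincomb \<alpha> u k = \<zero>" "i < k"
          have "lincomb (\<lambda>_. \<zero>) (\<lambda>i. eigen_shift \<zero> (u i)) k = \<zero>" by (rule lincomb_zero_left) (use u in auto)
          then have "pair_comb \<zero> \<alpha> (\<lambda>_. \<zero>) u k = \<zero>" unfolding pair_comb_def using al by simp
          then show "\<alpha> i = \<zero>" using indep_pairsD(2)[OF g al(1), of "\<lambda>_. \<zero>" i] al(3) by simp
        qed
      qed
      then have "length (family ?f (Suc k)) \<le> length (family u k)"
        using independent_length_le[OF subfield_K i] fS by blast
      then show False by simp
    qed
    then obtain \<alpha> i where al: "\<forall>i<Suc k. \<alpha> i \<in> K" "lincomb \<alpha> ?f (Suc k) = \<zero>" "i < Suc k" "\<alpha> i \<noteq> \<zero>"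
      using independent_family_iff[OF subfield_K, of "Suc k" ?f] fc by blast
    have z'c: "z' i \<in> carrier R" "z' i \<otimes> a = l \<otimes> z' i" if "i < Suc k" for i
      using bz(2)[OF that] l unfolding Z_def eigen_shift_def by (auto simp: minus_eq_zero_iff)
    define x where "x = lincomb \<alpha> z (Suc k)"
    have xc: "x \<in> carrier R" unfolding x_def by (rule lincomb_closed) (use al zc in auto)
    have "lincomb \<alpha> z (Suc k) \<otimes> h = lincomb \<alpha> (\<lambda>i. z i \<otimes> h) (Suc k)"
      by (rule lincomb_rmult[symmetric]) (use al zc h in auto)
    also have "\<dots> = lincomb \<alpha> (\<lambda>i. ?f i \<oplus> z' i) (Suc k)"
      by (rule lincomb_cong) (use bz in auto)
    also have "\<dots> = lincomb \<alpha> ?f (Suc k) \<oplus> lincomb \<alpha> z' (Suc k)"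
      by (rule lincomb_add_right) (use al fc z'c in auto)
    finally have xh: "x \<otimes> h = lincomb \<alpha> z' (Suc k)"
      using al(2) lincomb_closed[of "Suc k" \<alpha> z'] al(1) z'c unfolding x_def by (simp del: lincomb.simps)
    \<comment> \<open>The kernel of a \<open>K\<close>-linear map is closed under combinations with
      coefficients in \<open>K\<close>; this is applied to \<open>x\<close> and to
      \<open>x h\<close>.\<close>
    have kerlc: "lincomb \<alpha> f (Suc k) \<otimes> a = l \<otimes> lincomb \<alpha> f (Suc k)"
      if f: "\<And>i. i < Suc k \<Longrightarrow> f i \<in> carrier R" "\<And>i. i < Suc k \<Longrightarrow> f i \<otimes> a = l \<otimes> f i" for f
    proof -
      have "eigen_shift l (lincomb \<alpha> f (Suc k)) = lincomb \<alpha> (\<lambda>i. eigen_shift l (f i)) (Suc k)"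
        by (rule K_linear_lincomb[OF K_linear_eigen_shift[OF l] K_sub]) (use al f in auto)
      also have "\<dots> = lincomb \<alpha> (\<lambda>i. \<zero>) (Suc k)"
        by (rule lincomb_cong) (use f l in \<open>auto simp: eigen_shift_def minus_eq_zero_iff\<close>)
      also have "\<dots> = \<zero>" using al(1) K_carrier by (induction k) auto
      finally show ?thesis
        using lincomb_closed[of "Suc k" \<alpha> f] al(1) f l unfolding eigen_shift_def
        by (simp add: minus_eq_zero_iff del: lincomb.simps)
    qed
    have "x \<otimes> h \<otimes> a = l \<otimes> (x \<otimes> h)" unfolding xh by (rule kerlc) (use z'c in auto)
    moreover have "x \<otimes> a = l \<otimes> x" unfolding x_def by (rule kerlc) (use zc in auto)
    ultimately have "x \<otimes> (h \<otimes> a) = x \<otimes> (a \<otimes> h)" using xc h l by (simp add: m_assoc[symmetric])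
    then have "x \<otimes> (h \<otimes> a \<ominus> a \<otimes> h) = \<zero>" using xc h by (simp add: a_minus_def r_distr r_minus r_neg)
    then have "x = \<zero>" using xc h by (simp add: minus_eq_zero_iff)
    then have "\<forall>i<Suc k. \<alpha> i = \<zero>"
      using z(2) zc(1) al(1) independent_family_iff[OF subfield_K, of "Suc k" z] unfolding x_def by blast
    then show False using al by blast
  qed
qed

end

lemma (in ring) Span_dimension_le:
  assumes K: "subfield K R" and "set Us \<subseteq> carrier R"
  shows "\<exists>n\<le>length Us. dimension n K (Span K Us)"
  using assms(2)
proof (induction Us)
  case Nil
  show ?case using zero_dim by simp
next
  case (Cons u Us)
  then obtain n where n: "n \<le> length Us" "dimension n K (Span K Us)" by auto
  have u: "u \<in> carrier R" "set Us \<subseteq> carrier R" using Cons.prems by auto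
  show ?case
  proof (cases "u \<in> Span K Us")
    case True
    then have "set (u # Us) \<subseteq> Span K Us" using Span_base_incl[OF K u(2)] by simp
    then have "Span K (u # Us) \<subseteq> Span K Us" using mono_Span_subset[OF K _ u(2)] by blast
    then have "Span K (u # Us) = Span K Us" using mono_Span[OF K u(2,1)] by blast
    then show ?thesis using n by (auto intro: le_SucI)
  next
    case False
    have "dimension (Suc n) K (Span K (u # Us))"
      unfolding Span_Cons by (rule Suc_dim[OF u(1) False n(2)])
    then show ?thesis using n by auto
  qed
qed

lemma (in ring) independent_family_mono:
  assumes "independent K (family f n)" "m \<le> n"
  shows "independent K (family f m)"
  using assms(2,1) by (induction n rule: dec_induct) (auto dest: independent_backwards)

context max_subfield
begin

lemma Span_family_mono:
  assumes "\<And>i. i < n \<Longrightarrow> f i \<in> carrier R" "m \<le> n"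
  shows "Span K (family f m) \<subseteq> Span K (family f n)"
  by (rule mono_Span_sublist[OF subfield_K]) (use assms in auto)

lemma mem_Span_family_base:
  assumes "\<And>i. i < n \<Longrightarrow> f i \<in> carrier R" "m < n"
  shows "f m \<in> Span K (family f n)"
  using Span_base_incl[OF subfield_K, of "family f n"] assms by auto

subsection \<open>Krylov sequences\<close>

text \<open>By \<open>H\<close> the matrix of \<open>Y\<close> is upper Hessenberg with nonzero
  subdiagonal, so the \<open>i\<close>-th iterate of \<open>f 0\<close> is a nonzero multiple of
  \<open>f i\<close> plus a combination of earlier vectors. The condition stops at
  \<open>Suc i < n\<close>, so the last column is free.\<close>

lemma hessenberg:
  fixes Y :: "'a \<Rightarrow> 'a"
  assumes ind: "independent K (family f n)" and Y: "K_linear K Y"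
    and H: "\<And>i. Suc i < n \<Longrightarrow> \<exists>k\<in>K. \<exists>s\<in>Span K (family f (Suc i)). k \<noteq> \<zero> \<and> Y (f i) = k \<otimes> f (Suc i) \<oplus> s"
  shows "independent K (family (\<lambda>i. (Y ^^ i) (f 0)) n)"
proof -
  have fc: "f i \<in> carrier R" if "i < n" for i
    using independent_in_carrier[OF ind] that by auto
  have uc: "set (family f m) \<subseteq> carrier R" if "m \<le> n" for m using that fc by auto
  \<comment> \<open>\<open>Y\<close> raises the filtration by spans of initial segments by at most
    one step.\<close>
  have Xin: "Y s \<in> Span K (family f (Suc i))" if s: "s \<in> Span K (family f i)" and i: "i < n" for s i
  proof -
    have fci: "f j \<in> carrier R" if "j < i" for j using fc that i by simp
    obtain \<alpha> where al: "\<forall>j<i. \<alpha> j \<in> K" "s = lincomb \<alpha> f i"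
      by (rule Span_familyE[OF s K_sub fci])
    have eq: "Y s = lincomb \<alpha> (\<lambda>j. Y (f j)) i"
      unfolding al(2) by (rule K_linear_lincomb[OF Y K_sub]) (use al fci in auto)
    have mem: "lincomb \<alpha> (\<lambda>j. Y (f j)) j \<in> Span K (family f (Suc i))" if "j \<le> i" for j
      using that
    proof (induction j)
      case 0
      have "set (family f (Suc i)) \<subseteq> carrier R" by (rule uc) (use i in simp)
      then show ?case by (simp add: Span_K(2) del: family_simps)
    next
      case (Suc j)
      then have "Suc j < n" using i by simp
      then obtain k t where kt: "k \<in> K" "t \<in> Span K (family f (Suc j))" "Y (f j) = k \<otimes> f (Suc j) \<oplus> t"
        using H by metis
      have u: "set (family f (Suc i)) \<subseteq> carrier R" by (rule uc) (use i in simp)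
      have "f (Suc j) \<in> Span K (family f (Suc i))"
        by (rule mem_Span_family_base) (use fc i Suc.prems in auto)
      moreover have "Span K (family f (Suc j)) \<subseteq> Span K (family f (Suc i))"
        by (rule Span_family_mono) (use fc i Suc.prems in auto)
      ultimately have "Y (f j) \<in> Span K (family f (Suc i))"
        unfolding kt(3) using kt(1,2) Span_K(3)[OF u] Span_K(5)[OF u] by blast
      then have "\<alpha> j \<otimes> Y (f j) \<in> Span K (family f (Suc i))"
        by (rule Span_K(5)[OF u, rotated]) (use al(1) Suc.prems in simp)
      moreover have "lincomb \<alpha> (\<lambda>j. Y (f j)) j \<in> Span K (family f (Suc i))"
        using Suc.IH Suc.prems by (simp del: family_simps)
      ultimately show ?case unfolding lincomb.simps by (intro Span_K(3)[OF u])
    qed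
    show ?thesis unfolding eq by (rule mem) simp
  qed
  let ?g = "\<lambda>i. (Y ^^ i) (f 0)"
  have rep: "\<exists>k\<in>K. \<exists>s\<in>Span K (family f i). k \<noteq> \<zero> \<and> ?g i = k \<otimes> f i \<oplus> s" if "i < n" for i
    using that
  proof (induction i)
    case 0
    then have "?g 0 = \<one> \<otimes> f 0 \<oplus> \<zero>" "\<zero> \<in> Span K (family f 0)" using fc[of 0] by simp_all
    then show ?case using K_closed(2) one_not_zero by blast
  next
    case (Suc i)
    have "i < n" using Suc.prems by simp
    then obtain k s where ks: "k \<in> K" "s \<in> Span K (family f i)" "k \<noteq> \<zero>" "?g i = k \<otimes> f i \<oplus> s"
      using Suc.IH by metis
    obtain k' t where kt: "k' \<in> K" "t \<in> Span K (family f (Suc i))" "k' \<noteq> \<zero>" "Y (f i) = k' \<otimes> f (Suc i) \<oplus> t"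
      using H[OF Suc.prems] by metis
    have u: "set (family f (Suc i)) \<subseteq> carrier R" "set (family f i) \<subseteq> carrier R"
      by (rule uc, use Suc.prems in simp)+
    have sc: "s \<in> carrier R" "t \<in> carrier R" using ks kt Span_K(1)[OF u(1)] Span_K(1)[OF u(2)] by auto
    have "?g (Suc i) = Y (k \<otimes> f i \<oplus> s)" using ks by simp
    also have "\<dots> = k \<otimes> (k' \<otimes> f (Suc i) \<oplus> t) \<oplus> Y s"
      using Y ks kt fc[of i] Suc.prems sc by (simp add: K_linear_add K_linear_smult)
    also have "\<dots> = (k \<otimes> k') \<otimes> f (Suc i) \<oplus> (k \<otimes> t \<oplus> Y s)"
      using ks kt sc fc[of "Suc i"] Suc.prems K_linear_closed[OF Y sc(1)] by (simp add: r_distr m_assoc a_assoc)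
    finally have "?g (Suc i) = (k \<otimes> k') \<otimes> f (Suc i) \<oplus> (k \<otimes> t \<oplus> Y s)" .
    moreover have "k \<otimes> t \<oplus> Y s \<in> Span K (family f (Suc i))"
      using Span_K(3)[OF u(1) Span_K(5)[OF u(1) ks(1) kt(2)] Xin[OF ks(2) \<open>i < n\<close>]] .
    moreover have "k \<otimes> k' \<in> K" "k \<otimes> k' \<noteq> \<zero>" using ks kt by auto
    ultimately show ?case by blast
  qed
  have "independent K (family ?g m) \<and> Span K (family ?g m) \<subseteq> Span K (family f m)" if "m \<le> n" for m
    using that
  proof (induction m)
    case 0
    show ?case by (simp add: li_Nil)
  next
    case (Suc m)
    then have m: "m < n" by simp
    have IH: "independent K (family ?g m)" "Span K (family ?g m) \<subseteq> Span K (family f m)" using Suc by auto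
    obtain k s where ks: "k \<in> K" "s \<in> Span K (family f m)" "k \<noteq> \<zero>" "?g m = k \<otimes> f m \<oplus> s"
      using rep[OF m] by metis
    have u: "set (family f m) \<subseteq> carrier R" "set (family f (Suc m)) \<subseteq> carrier R"
      by (rule uc, use m in simp)+
    have sc: "s \<in> carrier R" using ks Span_K(1)[OF u(1)] by auto
    have gc: "?g m \<in> carrier R" unfolding ks(4) using ks(1) sc fc[OF m] by simp
    have nf: "f m \<notin> Span K (family f m)"
      using independent_family_mono[OF ind, of "Suc m"] m by (simp add: independent_Cons_iff)
    have "?g m \<notin> Span K (family ?g m)"
    proof
      assume "?g m \<in> Span K (family ?g m)"
      then have "?g m \<in> Span K (family f m)" using IH(2) by blast
      then have "?g m \<ominus> s \<in> Span K (family f m)" using Span_K_minus[OF u(1)] ks(2) by blast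
      moreover have "?g m \<ominus> s = k \<otimes> f m" unfolding ks(4) using ks(1) sc fc[OF m]
        by (simp add: a_minus_def a_assoc r_neg)
      ultimately show False using Span_K_divide[OF u(1) ks(1,3) fc[OF m]] nf by simp
    qed
    then have i: "independent K (family ?g (Suc m))" using IH(1) gc by (simp add: independent_Cons_iff)
    have "set (family ?g (Suc m)) \<subseteq> Span K (family f (Suc m))"
    proof -
      have gcs: "set (family ?g m) \<subseteq> carrier R" using independent_in_carrier[OF IH(1)] .
      have mono: "Span K (family f m) \<subseteq> Span K (family f (Suc m))"
        by (rule Span_family_mono) (use fc m in auto)
      have "set (family ?g m) \<subseteq> Span K (family f (Suc m))"
        using Span_base_incl[OF subfield_K gcs] IH(2) mono by blast
      moreover have "?g m \<in> Span K (family f (Suc m))"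
        unfolding family_simps(2) Span_Cons_iff using ks by blast
      ultimately show ?thesis by (simp del: family_simps(4))
    qed
    then have "Span K (family ?g (Suc m)) \<subseteq> Span K (family f (Suc m))"
      by (rule mono_Span_subset[OF subfield_K _ u(2)])
    then show ?case using i by blast
  qed
  then show ?thesis by blast
qed

text \<open>Each right factor becomes an additive commutator of \<open>a\<close>, the kind of
  element that the degree hypothesis governs. \<open>sandwich_bracket\<close> identifies the
  resulting operator.\<close>

definition bracket :: "('a \<times> 'a) list \<Rightarrow> ('a \<times> 'a) list" where
  "bracket ps = map (\<lambda>(k, c). (k, c \<otimes> a \<ominus> a \<otimes> c)) ps"

lemma bracket_set: "set ps \<subseteq> K \<times> carrier R \<Longrightarrow> set (bracket ps) \<subseteq> K \<times> carrier R"
  unfolding bracket_def by auto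

lemma sandwich_bracket:
  assumes "set ps \<subseteq> K \<times> carrier R" "v \<in> carrier R"
  shows "sandwich (bracket ps) v = sandwich ps v \<otimes> a \<ominus> sandwich ps (v \<otimes> a)"
  using assms(1)
proof (induction ps)
  case Nil
  show ?case by (simp add: bracket_def a_minus_def)
next
  case (Cons kc ps)
  obtain k c where kc: "kc = (k, c)" by (cases kc)
  have "k \<in> carrier R" "c \<in> carrier R" "set ps \<subseteq> carrier R \<times> carrier R"
    using Cons.prems kc K_sub by auto
  moreover from this have "sandwich ps v \<in> carrier R" "sandwich ps (v \<otimes> a) \<in> carrier R" using assms(2) by auto
  moreover have "sandwich (bracket (kc # ps)) v = k \<otimes> v \<otimes> (c \<otimes> a \<ominus> a \<otimes> c) \<oplus> (sandwich ps v \<otimes> a \<ominus> sandwich ps (v \<otimes> a))"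
    using Cons kc by (simp add: bracket_def)
  moreover have "sandwich (kc # ps) v \<otimes> a \<ominus> sandwich (kc # ps) (v \<otimes> a) =
      (k \<otimes> v \<otimes> c \<oplus> sandwich ps v) \<otimes> a \<ominus> (k \<otimes> (v \<otimes> a) \<otimes> c \<oplus> sandwich ps (v \<otimes> a))"
    using kc by simp
  moreover have "k \<otimes> v \<otimes> (c \<otimes> a \<ominus> a \<otimes> c) \<oplus> (x \<otimes> a \<ominus> y) =
      (k \<otimes> v \<otimes> c \<oplus> x) \<otimes> a \<ominus> (k \<otimes> (v \<otimes> a) \<otimes> c \<oplus> y)"
    if "k \<in> carrier R" "c \<in> carrier R" "x \<in> carrier R" "y \<in> carrier R" for x y
    using that assms(2) a_carrier by algebra
  ultimately show ?case by simp
qed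

text \<open>The operator commutes with multiplication by \<open>l\<close> in \<open>K\<close>, so
  the scalar cancels and any shift may stand for right multiplication by \<open>a\<close>.\<close>

lemma sandwich_bracket_shift:
  assumes "set ps \<subseteq> K \<times> carrier R" "v \<in> carrier R" "l \<in> K"
  shows "sandwich (bracket ps) v = eigen_shift l (sandwich ps v) \<ominus> sandwich ps (eigen_shift l v)"
proof -
  have T: "K_linear K (sandwich ps)" by (rule K_linear_sandwich[OF assms(1)])
  have c: "sandwich ps v \<in> carrier R" "sandwich ps (v \<otimes> a) \<in> carrier R" "l \<in> carrier R"
    using K_linear_closed[OF T] assms by auto
  have "sandwich ps (eigen_shift l v) = sandwich ps (v \<otimes> a) \<ominus> l \<otimes> sandwich ps v"
    unfolding eigen_shift_def using assms by (simp add: K_linear_minus[OF T] K_linear_smult[OF T])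
  then show ?thesis unfolding sandwich_bracket[OF assms(1,2)] unfolding eigen_shift_def using c
    by (simp add: a_minus_def minus_add a_ac r_neg1 r_neg2)
qed

lemma density_K:
  assumes "independent K (family f n)" "\<forall>i<n. c i \<in> carrier R" "set zs \<subseteq> carrier R"
  obtains ps where "set ps \<subseteq> K \<times> carrier R" "\<forall>j<n. sandwich ps (f j) = c j"
    "\<forall>z\<in>set zs. sandwich ps z \<in> Span K (family c n)"
proof -
  have "\<exists>ps. set ps \<subseteq> K \<times> carrier R \<and> (\<forall>j<n. sandwich ps (f j) = c j) \<and>
      (\<forall>z\<in>set zs. sandwich ps z \<in> Span (centralizer K) (family c n))"
    by (rule density_extend) (use assms K_sub subfield_K in \<open>auto simp: centralizer_K\<close>)
  then show thesis using that unfolding centralizer_K by blast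
qed

text \<open>Let \<open>T\<close> kill each \<open>u i\<close>, send \<open>u i a\<close> to
  \<open>- u (i + 1)\<close>, and send the last \<open>u i a\<close> to \<open>u 0 a\<close>. Then
  the bracket, \<open>T v a - T (v a)\<close> at \<open>v\<close>, leads from each
  \<open>u i\<close> to the next, from the last one to \<open>- u 0 a\<close>, and on from each
  \<open>u i a\<close> to \<open>- u (i + 1) a\<close> plus earlier vectors.\<close>

lemma chain_even:
  assumes g: "indep_pairs \<zero> u k" and k: "k > 0"
  shows "\<exists>ps v. set ps \<subseteq> K \<times> carrier R \<and> v \<in> carrier R \<and>
    independent K (family (\<lambda>i. (sandwich (bracket ps) ^^ i) v) (k + k))"
proof -
  let ?f = "pairs_fun \<zero> u k"
  have u: "\<forall>i<k. u i \<in> carrier R" using indep_pairsD(1)[OF g] .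
  have fc: "?f i \<in> carrier R" if "i < k + k" for i using pairs_fun_carrier[OF _ u that] by simp
  have ind: "independent K (family ?f (k + k))" by (rule indep_pairs_independent[OF _ g]) simp
  define c where "c i = (if i < k then \<zero> else if Suc i < k + k then \<ominus> u (Suc i - k) else ?f k)" for i
  have cc: "\<forall>i<k+k. c i \<in> carrier R"
    unfolding c_def using u fc[of k] k by auto
  \<comment> \<open>At \<open>u i a\<close> the bracket also evaluates \<open>T\<close> at
    \<open>u i a a\<close>, where nothing is prescribed; these vectors are passed to
    \<open>density_K\<close> to keep them under control.\<close>
  define zs where "zs = map (\<lambda>i. eigen_shift \<zero> (eigen_shift \<zero> (u i))) [0..<k]"
  have "set zs \<subseteq> carrier R" unfolding zs_def using u by auto
  then obtain ps where ps: "set ps \<subseteq> K \<times> carrier R" "\<forall>j<k+k. sandwich ps (?f j) = c j"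
      "\<forall>z\<in>set zs. sandwich ps z \<in> Span K (family c (k + k))"
    by (rule density_K[OF ind cc])
  have fu: "set (family ?f m) \<subseteq> carrier R" if "m \<le> k + k" for m using fc that by auto
  \<comment> \<open>All prescribed values lie in the span of the first \<open>k + 1\<close> basis
    vectors, so in the second half of the chain they count as earlier vectors.\<close>
  have cS: "Span K (family c (k + k)) \<subseteq> Span K (family ?f (Suc k))"
  proof (rule mono_Span_subset[OF subfield_K])
    have S: "set (family ?f (Suc k)) \<subseteq> carrier R" by (rule fu) (use k in simp)
    then show "set (family ?f (Suc k)) \<subseteq> carrier R" .
    have b: "?f i \<in> Span K (family ?f (Suc k))" if "i < Suc k" for i
      by (rule mem_Span_family_base) (use fc that k in auto)
    have "c i \<in> Span K (family ?f (Suc k))" if "i < k + k" for i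
    proof -
      consider "i < k" | "k \<le> i" "Suc i < k + k" | "k \<le> i" "\<not> Suc i < k + k" by linarith
      then show ?thesis
      proof cases
        case 1
        then show ?thesis unfolding c_def using Span_K(2)[OF S] by simp
      next
        case 2
        then have "?f (Suc i - k) \<in> Span K (family ?f (Suc k))" by (intro b) simp
        moreover have "Suc i - k < k" using 2 by linarith
        then have "?f (Suc i - k) = u (Suc i - k)" by (simp add: pairs_fun_def)
        moreover have "c i = \<ominus> u (Suc i - k)" using 2 by (simp add: c_def)
        ultimately show ?thesis using Span_K(4)[OF S] by metis
      next
        case 3
        then show ?thesis unfolding c_def using b[of k] by simp
      qed
    qed
    then show "set (family c (k + k)) \<subseteq> Span K (family ?f (Suc k))" by auto
  qed
  let ?Y = "sandwich (bracket ps)"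
  have Y: "K_linear K ?Y" by (rule K_linear_sandwich[OF bracket_set[OF ps(1)]])
  have T: "K_linear K (sandwich ps)" by (rule K_linear_sandwich[OF ps(1)])
  have Yv: "?Y v = eigen_shift \<zero> (sandwich ps v) \<ominus> sandwich ps (eigen_shift \<zero> v)" if "v \<in> carrier R" for v
    using sandwich_bracket_shift[OF ps(1) that] by simp
  have b0: "eigen_shift \<zero> \<zero> = \<zero>" by (simp add: eigen_shift_def a_minus_def)
  have "independent K (family (\<lambda>i. (?Y ^^ i) (?f 0)) (k + k))"
  proof (rule hessenberg[OF ind Y])
    fix i assume i: "Suc i < k + k"
    have S: "set (family ?f (Suc i)) \<subseteq> carrier R" by (rule fu) (use i in simp)
    have zero: "\<zero> \<in> Span K (family ?f (Suc i))" using Span_K(2)[OF S] .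
    have mK: "\<ominus> \<one> \<in> K" "\<ominus> \<one> \<noteq> \<zero>" by (auto dest: arg_cong[of _ _ "\<lambda>x. \<ominus> x"])
    consider "Suc i < k" | "Suc i = k" | "k \<le> i" by linarith
    then show "\<exists>l\<in>K. \<exists>s\<in>Span K (family ?f (Suc i)). l \<noteq> \<zero> \<and> ?Y (?f i) = l \<otimes> ?f (Suc i) \<oplus> s"
    proof cases
      case 1
      have "eigen_shift \<zero> (?f i) = ?f (k + i)" using 1 by (simp add: pairs_fun_def)
      then have "?Y (?f i) = \<zero> \<ominus> c (k + i)"
        using Yv[of "?f i"] fc[of i] ps(2) 1 i b0 by (simp add: c_def)
      also have "\<dots> = \<one> \<otimes> ?f (Suc i) \<oplus> \<zero>"
        using 1 u by (simp add: c_def pairs_fun_def a_minus_def)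
      finally show ?thesis using zero K_closed(2) one_not_zero by blast
    next
      case 2
      have "eigen_shift \<zero> (?f i) = ?f (k + i)" using 2 by (simp add: pairs_fun_def)
      then have "?Y (?f i) = \<zero> \<ominus> c (k + i)"
        using Yv[of "?f i"] fc[of i] ps(2) 2 i b0 by (simp add: c_def)
      also have "\<dots> = \<ominus> \<one> \<otimes> ?f (Suc i) \<oplus> \<zero>"
        using 2 fc[of k] k by (simp add: c_def a_minus_def l_minus)
      finally show ?thesis using zero mK by blast
    next
      case 3
      let ?z = "eigen_shift \<zero> (eigen_shift \<zero> (u (i - k)))"
      have ui: "u (i - k) \<in> carrier R" "u (Suc i - k) \<in> carrier R" using u i 3 by auto
      have fi: "?f i = eigen_shift \<zero> (u (i - k))" using 3 by (simp add: pairs_fun_def)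
      have "?z \<in> set zs" unfolding zs_def using i 3 by auto
      then have Tz: "sandwich ps ?z \<in> Span K (family ?f (Suc k))" using ps(3) cS by blast
      moreover have "Span K (family ?f (Suc k)) \<subseteq> Span K (family ?f (Suc i))"
        by (rule Span_family_mono) (use fc i 3 in auto)
      ultimately have s: "\<ominus> sandwich ps ?z \<in> Span K (family ?f (Suc i))" using Span_K(4)[OF S] by blast
      have "sandwich ps (eigen_shift \<zero> (u (i - k))) = c i" using ps(2)[rule_format, of i] i fi by simp
      then have "?Y (?f i) = eigen_shift \<zero> (c i) \<ominus> sandwich ps ?z"
        using Yv[of "?f i"] fc[of i] i fi by simp
      also have "eigen_shift \<zero> (c i) = \<ominus> eigen_shift \<zero> (u (Suc i - k))"
        using 3 i ui K_linear_uminus[OF K_linear_eigen_shift] by (simp add: c_def)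
      also have "\<dots> = \<ominus> \<one> \<otimes> ?f (Suc i)"
        using 3 ui by (simp add: pairs_fun_def l_minus)
      finally have "?Y (?f i) = \<ominus> \<one> \<otimes> ?f (Suc i) \<oplus> \<ominus> sandwich ps ?z" by (simp add: a_minus_def)
      then show ?thesis using s mK by blast
    qed
  qed
  then show ?thesis using ps(1) fc[of 0] k by (intro exI[of _ ps] exI[of _ "?f 0"]) auto
qed

text \<open>Here the dimension is exactly \<open>2 k + 1\<close>, and a vector \<open>w\<close>
  outside the pairs heads the basis. Write \<open>B\<close> for \<open>eigen_shift l\<close>;
  \<open>w\<close> is adjusted so that \<open>B w\<close> is \<open>B (u (k - 1))\<close> up to a
  combination of the \<open>u i\<close>. Let \<open>T\<close> send \<open>w\<close> to
  \<open>u 0\<close>, each \<open>u i\<close> to \<open>\<zero>\<close>, \<open>B (u i)\<close> to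
  \<open>- u (i + 1)\<close> and the last \<open>B (u i)\<close> to \<open>B (u 0) + u 0\<close>.
  The bracket then maps \<open>w\<close> to \<open>- u 0\<close> and continues as in the even
  case.\<close>

lemma chain_odd:
  assumes g: "indep_pairs \<zero> u k" and k: "k > 0" and b: "dim_ge (2 * k + 1)" and nb: "\<not> dim_ge (2 * k + 2)"
  shows "\<exists>ps v. set ps \<subseteq> K \<times> carrier R \<and> v \<in> carrier R \<and>
    independent K (family (\<lambda>i. (sandwich (bracket ps) ^^ i) v) (Suc (k + k)))"
proof -
  have u: "\<forall>i<k. u i \<in> carrier R" using indep_pairsD(1)[OF g] .
  have pc0: "set (pairs \<zero> u k) \<subseteq> carrier R" using pairs_carrier u by simp
  obtain w0 where w0: "w0 \<in> carrier R" "w0 \<notin> Span K (pairs \<zero> u k)" using dim_geD[OF b pc0] by auto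
  obtain xs where xs: "set xs \<subseteq> carrier R" "length xs < 2 * k + 2" "Span K xs = carrier R"
    using nb unfolding dim_ge_def by blast
  obtain n where n: "n \<le> length xs" "dimension n K (carrier R)"
    using Span_dimension_le[OF subfield_K xs(1)] xs(3) by auto
  have ind0: "independent K (w0 # pairs \<zero> u k)"
    using indep_pairs_independent[OF _ g] w0 by (simp add: pairs_eq_family independent_Cons_iff)
  \<comment> \<open>A vector outside would extend \<open>2 k + 1\<close> independent vectors beyond
    the dimension.\<close>
  have all: "v \<in> Span K (w0 # pairs \<zero> u k)" if "v \<in> carrier R" for v
  proof (rule ccontr)
    assume "v \<notin> Span K (w0 # pairs \<zero> u k)"
    then have i: "independent K (v # w0 # pairs \<zero> u k)"
      using ind0 that independent_Cons_iff by blast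
    have "length (v # w0 # pairs \<zero> u k) \<le> n"
      by (rule independent_length_le_dimension[OF subfield_K n(2) i independent_in_carrier[OF i]])
    then show False using n(1) xs(2) by simp
  qed
  have "w0 \<otimes> a \<in> Span K (w0 # pairs \<zero> u k)" using all w0 by simp
  then obtain l s0 where l: "l \<in> K" "s0 \<in> Span K (pairs \<zero> u k)" "w0 \<otimes> a = l \<otimes> w0 \<oplus> s0"
    unfolding Span_Cons_iff by blast
  have s0c: "s0 \<in> carrier R" using l(2) Span_K(1)[OF pc0] by blast
  have gl: "indep_pairs l u k" using indep_pairs_shift[OF _ l(1) g] by simp
  have horner: "Span K (pairs \<zero> u k) = Span K (pairs l u k)" using Span_pairs_shift[OF _ l(1) u] by simp
  have pc: "set (pairs l u k) \<subseteq> carrier R" using pairs_carrier u l by simp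
  have "eigen_shift l w0 = s0" unfolding eigen_shift_def l(3) using s0c w0 l(1) by (simp add: a_minus_def a_ac r_neg1 r_neg2 r_neg)
  then obtain p q where pq: "\<forall>i<k. p i \<in> K" "\<forall>i<k. q i \<in> K" "eigen_shift l w0 = pair_comb l p q u k"
    using mem_Span_pairs[OF l(1) u] l(2) horner by metis
  let ?B = "eigen_shift l" and ?U = "u (k - 1)"
  have BL: "K_linear K ?B" by (rule K_linear_eigen_shift[OF l(1)])
  have Uc: "?U \<in> carrier R" using u k by simp
  have lq: "lincomb q u k \<in> carrier R" "lincomb p u k \<in> carrier R" using pq u by auto
  \<comment> \<open>Subtracting \<open>lincomb q u k\<close> removes the components of
    \<open>B w0\<close> along the \<open>B (u i)\<close>, and adding \<open>?U\<close> installs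
    \<open>B ?U\<close> in their place.\<close>
  define w where "w = w0 \<oplus> (?U \<ominus> lincomb q u k)"
  have wc: "w \<in> carrier R" unfolding w_def using w0 Uc lq by simp
  have Bw: "?B w = lincomb p u k \<oplus> ?B ?U"
  proof -
    have "?B w0 = lincomb p u k \<oplus> ?B (lincomb q u k)"
      using pq K_linear_lincomb[OF BL K_sub, of k q u] u unfolding pair_comb_def by simp
    moreover have "?B w = ?B w0 \<oplus> (?B ?U \<ominus> ?B (lincomb q u k))"
      unfolding w_def using w0 Uc lq by (simp add: K_linear_add[OF BL] K_linear_minus[OF BL])
    moreover have "?B (lincomb q u k) \<in> carrier R" "?B ?U \<in> carrier R" using l lq Uc by auto
    ultimately show ?thesis using lq by (simp add: a_minus_def a_ac r_neg1 r_neg2 r_neg)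
  qed
  have inU: "lincomb \<alpha> u k \<in> Span K (pairs l u k)" if "\<forall>i<k. \<alpha> i \<in> K" for \<alpha>
  proof -
    have "lincomb \<alpha> u k \<in> Span K (family u k)" by (rule Span_familyI[OF K_sub]) (use u that in auto)
    moreover have "Span K (family u k) \<subseteq> Span K (pairs l u k)"
      by (rule mono_Span_sublist[OF subfield_K _ pc]) (simp add: pairs_def)
    ultimately show ?thesis by blast
  qed
  have US: "?U \<in> Span K (pairs l u k)"
  proof -
    have "?U = lincomb (\<lambda>j. if j = k - 1 then \<one> else \<zero>) u k"
      by (rule lincomb_delta[symmetric]) (use k u in auto)
    also have "\<dots> \<in> Span K (pairs l u k)" by (rule inU) simp
    finally show ?thesis .
  qed
  have ws: "w \<notin> Span K (pairs l u k)"
  proof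
    assume "w \<in> Span K (pairs l u k)"
    then have "w \<ominus> (?U \<ominus> lincomb q u k) \<in> Span K (pairs l u k)"
      using US inU[OF pq(2)] Span_K_minus[OF pc] by blast
    moreover have "w \<ominus> (?U \<ominus> lincomb q u k) = w0"
      unfolding w_def using w0 Uc lq by (simp add: a_minus_def a_assoc minus_add a_ac r_neg r_neg1 r_neg2)
    ultimately show False using w0 horner by simp
  qed
  let ?h = "pairs_fun l u k"
  have hc: "?h i \<in> carrier R" if "i < k + k" for i by (rule pairs_fun_carrier[OF l(1) u that])
  let ?n = "Suc (k + k)"
  define f where "f i = (case i of 0 \<Rightarrow> w | Suc j \<Rightarrow> ?h j)" for i
  have f_simps [simp]: "f 0 = w" "f (Suc j) = ?h j" for j unfolding f_def by simp_all
  have fc: "f i \<in> carrier R" if "i < ?n" for i using wc hc that by (cases i) auto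
  have indw: "independent K (w # family ?h (k + k))"
    using indep_pairs_independent[OF l(1) gl] ws wc by (simp add: pairs_eq_family independent_Cons_iff)
  have "f ` {..<?n} = insert w (?h ` {..<k + k})"
    by (auto simp: lessThan_Suc_eq_insert_0 image_image)
  then have "set (w # family ?h (k + k)) = set (family f ?n)" by (simp del: family_simps(2))
  then have ind: "independent K (family f ?n)"
    by (rule independent_same_set[OF subfield_K _ _ indw]) (simp del: family_simps(2))
  \<comment> \<open>The extra \<open>u 0\<close> in the last value is what remains of the bracket at
    \<open>w\<close>, namely \<open>B (u 0) - (B (u 0) + u 0)\<close>; its term
    \<open>B (u 0)\<close> carries the chain from the \<open>u i\<close> to the
    \<open>B (u i)\<close>.\<close>
  define c where "c i = (if i = 0 then u 0 else if i \<le> k then \<zero> else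
      if Suc i < ?n then \<ominus> u (i - k) else f (Suc k) \<oplus> u 0)" for i
  have u0: "u 0 \<in> carrier R" using u k by simp
  have fk: "f (Suc k) = ?B (u 0)" using k by (simp add: pairs_fun_def)
  have cc: "\<forall>i<?n. c i \<in> carrier R"
    unfolding c_def fk using u u0 l k by auto
  define zs where "zs = map (\<lambda>i. ?B (?B (u i))) [0..<k]"
  have "set zs \<subseteq> carrier R" unfolding zs_def using u l by auto
  then obtain ps where ps: "set ps \<subseteq> K \<times> carrier R" "\<forall>j<?n. sandwich ps (f j) = c j"
      "\<forall>z\<in>set zs. sandwich ps z \<in> Span K (family c ?n)"
    by (rule density_K[OF ind cc])
  have fu: "set (family f m) \<subseteq> carrier R" if "m \<le> ?n" for m using fc that by auto
  have cS: "Span K (family c ?n) \<subseteq> Span K (family f (Suc (Suc k)))"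
  proof (rule mono_Span_subset[OF subfield_K])
    have S: "set (family f (Suc (Suc k))) \<subseteq> carrier R" by (rule fu) (use k in simp)
    then show "set (family f (Suc (Suc k))) \<subseteq> carrier R" .
    have b: "f i \<in> Span K (family f (Suc (Suc k)))" if "i < Suc (Suc k)" for i
      by (rule mem_Span_family_base) (use fc that k in auto)
    have b': "u i \<in> Span K (family f (Suc (Suc k)))" if "i < k" for i
      using b[of "Suc i"] that by (simp add: pairs_fun_def del: family_simps(2))
    have "c i \<in> Span K (family f (Suc (Suc k)))" if "i < ?n" for i
    proof -
      consider "i = 0" | "0 < i" "i \<le> k" | "k < i" "Suc i < ?n" | "k < i" "\<not> Suc i < ?n" by linarith
      then show ?thesis
      proof cases
        case 1
        then show ?thesis using b'[OF k] by (simp add: c_def)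
      next
        case 2
        then show ?thesis unfolding c_def using Span_K(2)[OF S] by simp
      next
        case 3
        then have "c i = \<ominus> u (i - k)" "u (i - k) \<in> Span K (family f (Suc (Suc k)))"
          using b' by (auto simp: c_def)
        then show ?thesis using Span_K(4)[OF S] by metis
      next
        case 4
        then have "c i = f (Suc k) \<oplus> u 0" by (simp add: c_def)
        then show ?thesis using Span_K(3)[OF S b[of "Suc k"] b'[OF k]] by simp
      qed
    qed
    then show "set (family c ?n) \<subseteq> Span K (family f (Suc (Suc k)))" by (auto simp del: family_simps(2))
  qed
  let ?Y = "sandwich (bracket ps)"
  have Y: "K_linear K ?Y" by (rule K_linear_sandwich[OF bracket_set[OF ps(1)]])
  have T: "K_linear K (sandwich ps)" by (rule K_linear_sandwich[OF ps(1)])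
  have Yv: "?Y v = ?B (sandwich ps v) \<ominus> sandwich ps (?B v)" if "v \<in> carrier R" for v
    using sandwich_bracket_shift[OF ps(1) that l(1)] .
  have B0: "?B \<zero> = \<zero>" by (rule K_linear_zero[OF BL])
  have Tu: "sandwich ps (u j) = \<zero>" if "j < k" for j
    using ps(2)[rule_format, of "Suc j"] that by (simp add: pairs_fun_def c_def)
  have TB: "sandwich ps (?B (u j)) = c (Suc (k + j))" if "j < k" for j
    using ps(2)[rule_format, of "Suc (k + j)"] that by (simp add: pairs_fun_def)
  have "independent K (family (\<lambda>i. (?Y ^^ i) (f 0)) ?n)"
  proof (rule hessenberg[OF ind Y])
    fix i assume i: "Suc i < ?n"
    have S: "set (family f (Suc i)) \<subseteq> carrier R" by (rule fu) (use i in simp)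
    have zero: "\<zero> \<in> Span K (family f (Suc i))" using Span_K(2)[OF S] .
    have mK: "\<ominus> \<one> \<in> K" "\<ominus> \<one> \<noteq> \<zero>" by (auto dest: arg_cong[of _ _ "\<lambda>x. \<ominus> x"])
    consider "i = 0" | j where "i = Suc j" "Suc j < k" | "i = k" | j where "i = Suc (k + j)" "Suc j < k"
    proof -
      have "i = 0 \<or> (\<exists>j. i = Suc j \<and> Suc j < k) \<or> i = k \<or> (\<exists>j. i = Suc (k + j) \<and> Suc j < k)"
        using i by presburger
      then show thesis using that by blast
    qed
    then show "\<exists>m\<in>K. \<exists>s\<in>Span K (family f (Suc i)). m \<noteq> \<zero> \<and> ?Y (f i) = m \<otimes> f (Suc i) \<oplus> s"
    proof cases
      case 1
      have "sandwich ps (lincomb p u k) = lincomb p (\<lambda>i. sandwich ps (u i)) k"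
        by (rule K_linear_lincomb[OF T K_sub]) (use pq u in auto)
      also have "\<dots> = lincomb p (\<lambda>i. \<zero>) k" by (rule lincomb_cong) (use Tu in auto)
      also have "\<dots> = \<zero>"
      proof -
        have "lincomb p (\<lambda>i. \<zero>) j = \<zero>" if "j \<le> k" for j using that pq(1) by (induction j) auto
        then show ?thesis by simp
      qed
      finally have Tp: "sandwich ps (lincomb p u k) = \<zero>" .
      have "sandwich ps (?B w) = sandwich ps (?B ?U)"
        unfolding Bw using lq Uc l Tp K_linear_closed[OF T] by (simp add: K_linear_add[OF T])
      also have "\<dots> = ?B (u 0) \<oplus> u 0"
        using TB[of "k - 1"] k fk unfolding c_def by simp
      finally have "?Y w = ?B (u 0) \<ominus> (?B (u 0) \<oplus> u 0)"
        using Yv[OF wc] ps(2)[rule_format, of 0] by (simp add: c_def)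
      also have "\<dots> = \<ominus> \<one> \<otimes> u 0 \<oplus> \<zero>"
        using u0 l(1) by (simp add: a_minus_def l_minus minus_add a_ac r_neg r_neg1 r_neg2)
      finally have "?Y (f i) = \<ominus> \<one> \<otimes> f (Suc i) \<oplus> \<zero>" using 1 k by (simp add: pairs_fun_def)
      then show ?thesis using zero mK by blast
    next
      case (2 j)
      have uj: "u j \<in> carrier R" "u (Suc j) \<in> carrier R" using u 2 by auto
      have "?Y (u j) = \<one> \<otimes> u (Suc j) \<oplus> \<zero>"
        using Yv[OF uj(1)] Tu[of j] TB[of j] B0 2 uj by (simp add: c_def a_minus_def)
      then have "?Y (f i) = \<one> \<otimes> f (Suc i) \<oplus> \<zero>" using 2 by (simp add: pairs_fun_def)
      then show ?thesis using zero K_closed(2) one_not_zero by blast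
    next
      case 3
      obtain j where j: "k = Suc j" using k by (cases k) auto
      have uj: "u j \<in> carrier R" using u j by auto
      have "?Y (u j) = \<ominus> \<one> \<otimes> f (Suc k) \<oplus> \<ominus> u 0"
        using Yv[OF uj] Tu[of j] TB[of j] B0 j uj u0 l fk by (simp add: c_def a_minus_def l_minus minus_add)
      moreover have "f i = u j" using 3 j by (simp add: pairs_fun_def)
      moreover have "u 0 \<in> Span K (family f (Suc i))"
        using mem_Span_family_base[of "Suc i" f 1] fc i 3 k by (simp add: pairs_fun_def del: family_simps(2))
      then have "\<ominus> u 0 \<in> Span K (family f (Suc i))" using Span_K(4)[OF S] by blast
      ultimately show ?thesis using mK 3 by metis
    next
      case (4 j)
      let ?z = "?B (?B (u j))"
      have uj: "u j \<in> carrier R" "u (Suc j) \<in> carrier R" using u 4 by auto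
      have fi: "f i = ?B (u j)" "f (Suc i) = ?B (u (Suc j))" using 4 by (simp_all add: pairs_fun_def)
      have "?z \<in> set zs" unfolding zs_def using 4 by auto
      then have Tz: "sandwich ps ?z \<in> Span K (family f (Suc (Suc k)))" using ps(3) cS by blast
      moreover have "Span K (family f (Suc (Suc k))) \<subseteq> Span K (family f (Suc i))"
        by (rule Span_family_mono) (use fc i 4 in auto)
      ultimately have s: "\<ominus> sandwich ps ?z \<in> Span K (family f (Suc i))" using Span_K(4)[OF S] by blast
      have "?Y (?B (u j)) = ?B (\<ominus> u (Suc j)) \<ominus> sandwich ps ?z"
        using Yv[of "?B (u j)"] TB[of j] 4 uj l by (simp add: c_def)
      also have "?B (\<ominus> u (Suc j)) = \<ominus> \<one> \<otimes> f (Suc i)"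
        using fi uj l by (simp add: K_linear_uminus[OF BL] l_minus)
      finally have "?Y (f i) = \<ominus> \<one> \<otimes> f (Suc i) \<oplus> \<ominus> sandwich ps ?z" using fi by (simp add: a_minus_def)
      then show ?thesis using s mK by blast
    qed
  qed
  then show ?thesis using ps(1) wc by (intro exI[of _ ps] exI[of _ w]) (auto simp del: family_simps(2))
qed

end

subsection \<open>Polynomial dependence on a scalar\<close>

context ring
begin

text \<open>A polynomial whose coefficients in \<open>D\<close> stand to the right of the powers of
  \<open>t\<close>. The variable will range over the commutative \<open>K\<close> but need not
  commute with the coefficients.\<close>

primrec horner :: "'a list \<Rightarrow> 'a \<Rightarrow> 'a" where
  "horner [] t = \<zero>"
| "horner (w # ws) t = w \<oplus> t \<otimes> horner ws t"

lemma horner_closed [simp]: "set ws \<subseteq> carrier R \<Longrightarrow> t \<in> carrier R \<Longrightarrow> horner ws t \<in> carrier R"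
  by (induction ws) auto

end

context max_subfield
begin

text \<open>Synthetic division by \<open>t - s\<close>. The linear factor can be pulled to the left
  because \<open>t\<close> and \<open>s\<close> commute.\<close>

lemma horner_divide:
  assumes s: "s \<in> K" and ws: "set ws \<subseteq> carrier R"
  shows "\<exists>gs. length gs = length ws - 1 \<and> set gs \<subseteq> carrier R \<and>
    (\<forall>t\<in>K. horner ws t \<ominus> horner ws s = (t \<ominus> s) \<otimes> horner gs t)"
  using ws
proof (induction ws)
  case Nil
  show ?case by (intro exI[of _ "[]"]) (simp add: s a_minus_def)
next
  case (Cons w ws)
  show ?case
  proof (cases ws)
    case Nil
    then show ?thesis using Cons.prems s by (intro exI[of _ "[]"]) (simp add: a_minus_def r_neg)
  next
    case (Cons w' ws')
    obtain gs where gs: "length gs = length ws - 1" "set gs \<subseteq> carrier R"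
        "\<forall>t\<in>K. horner ws t \<ominus> horner ws s = (t \<ominus> s) \<otimes> horner gs t"
      using Cons.IH Cons.prems by auto
    have "horner (w # ws) t \<ominus> horner (w # ws) s = (t \<ominus> s) \<otimes> horner (horner ws s # gs) t" if t: "t \<in> K" for t
    proof -
      have c: "w \<in> carrier R" "t \<in> carrier R" "s \<in> carrier R" "horner ws t \<in> carrier R" "horner ws s \<in> carrier R"
          "horner gs t \<in> carrier R"
        using Cons.prems t s gs by auto
      have "horner (w # ws) t \<ominus> horner (w # ws) s = t \<otimes> (horner ws t \<ominus> horner ws s) \<oplus> (t \<ominus> s) \<otimes> horner ws s"
        unfolding horner.simps using c by algebra
      also have "t \<otimes> (horner ws t \<ominus> horner ws s) = (t \<otimes> (t \<ominus> s)) \<otimes> horner gs t"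
        using gs(3) t c by (simp add: m_assoc)
      also have "t \<otimes> (t \<ominus> s) = (t \<ominus> s) \<otimes> t" using K_comm t s by blast
      finally show ?thesis unfolding horner.simps using c by algebra
    qed
    moreover have "set (horner ws s # gs) \<subseteq> carrier R" using Cons.prems s gs by auto
    moreover have "length (horner ws s # gs) = length (w # ws) - 1" using gs(1) Cons by simp
    ultimately show ?thesis by blast
  qed
qed

text \<open>Each root splits off a linear factor and shortens the coefficient list by one. The other
  roots remain roots of the quotient, as there are no zero divisors.\<close>

lemma horner_roots:
  assumes "set ws \<subseteq> carrier R" "Z \<subseteq> K" "finite Z" "length ws \<le> card Z"
    "\<And>s. s \<in> Z \<Longrightarrow> horner ws s = \<zero>" "t \<in> K"
  shows "horner ws t = \<zero>"
  using assms
proof (induction "length ws" arbitrary: ws Z t)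
  case 0
  then show ?case by simp
next
  case (Suc n)
  have "Z \<noteq> {}" using Suc.hyps(2) Suc.prems(4) by auto
  then obtain s where sZ: "s \<in> Z" by blast
  then have s: "s \<in> K" "horner ws s = \<zero>" using Suc.prems(2,5) by auto
  obtain gs where gs: "length gs = length ws - 1" "set gs \<subseteq> carrier R"
      "\<forall>t\<in>K. horner ws t \<ominus> horner ws s = (t \<ominus> s) \<otimes> horner gs t"
    using horner_divide[OF s(1) Suc.prems(1)] by blast
  have e: "horner ws t = (t \<ominus> s) \<otimes> horner gs t" if "t \<in> K" for t
    using gs(3) that s Suc.prems(1) by (simp add: a_minus_def)
  have "horner gs t = \<zero>"
  proof (rule Suc.hyps(1))
    show "n = length gs" using gs(1) Suc.hyps(2) by simp
    show "set gs \<subseteq> carrier R" "Z - {s} \<subseteq> K" "finite (Z - {s})" "t \<in> K"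
      using gs(2) Suc.prems by auto
    show "length gs \<le> card (Z - {s})"
      using gs(1) Suc.hyps(2) Suc.prems(3,4) sZ by (simp add: card_Diff_singleton)
    fix r assume r: "r \<in> Z - {s}"
    then have "(r \<ominus> s) \<otimes> horner gs r = \<zero>" using e[of r] Suc.prems(2,5) by auto
    moreover have "r \<ominus> s \<noteq> \<zero>" using r s(1) Suc.prems(2) by (auto simp: minus_eq_zero_iff)
    ultimately show "horner gs r = \<zero>" using r s(1) Suc.prems(2) gs(2) by auto
  qed
  then show ?case using e[OF Suc.prems(6)] Suc.prems(6) s(1) by simp
qed

text \<open>\<open>S\<close> records where the coefficients lie: \<open>K\<close> for scalar
  functions, \<open>carrier R\<close> for vectors, a finite-dimensional span where coordinates are
  taken.\<close>

definition poly_fun :: "'a set \<Rightarrow> ('a \<Rightarrow> 'a) \<Rightarrow> bool" where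
  "poly_fun S \<phi> \<longleftrightarrow> (\<exists>ws. set ws \<subseteq> S \<and> (\<forall>t\<in>K. \<phi> t = horner ws t))"

definition K_subspace :: "'a set \<Rightarrow> bool" where
  "K_subspace S \<longleftrightarrow> S \<subseteq> carrier R \<and> \<zero> \<in> S \<and> (\<forall>x\<in>S. \<forall>y\<in>S. x \<oplus> y \<in> S) \<and> (\<forall>k\<in>K. \<forall>x\<in>S. k \<otimes> x \<in> S)"

lemma K_subspaceD: "K_subspace S \<Longrightarrow> S \<subseteq> carrier R" "K_subspace S \<Longrightarrow> \<zero> \<in> S"
  "K_subspace S \<Longrightarrow> x \<in> S \<Longrightarrow> y \<in> S \<Longrightarrow> x \<oplus> y \<in> S" "K_subspace S \<Longrightarrow> k \<in> K \<Longrightarrow> x \<in> S \<Longrightarrow> k \<otimes> x \<in> S"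
  unfolding K_subspace_def by blast+

lemma K_subspace_K: "K_subspace K" and K_subspace_carrier: "K_subspace (carrier R)"
  unfolding K_subspace_def using K_sub by auto

lemma K_subspace_Span: "set Us \<subseteq> carrier R \<Longrightarrow> K_subspace (Span K Us)"
  unfolding K_subspace_def by (intro conjI ballI Span_K)

lemma horner_in: "K_subspace S \<Longrightarrow> set ws \<subseteq> S \<Longrightarrow> t \<in> K \<Longrightarrow> horner ws t \<in> S"
proof (induction ws)
  case (Cons w ws)
  then have "horner ws t \<in> S" "w \<in> S" by auto
  then show ?case unfolding horner.simps using Cons.prems by (intro K_subspaceD)
qed (simp add: K_subspaceD(2))

lemma poly_fun_in: "K_subspace S \<Longrightarrow> poly_fun S \<phi> \<Longrightarrow> t \<in> K \<Longrightarrow> \<phi> t \<in> S"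
  unfolding poly_fun_def using horner_in by metis

lemma poly_fun_const:
  assumes "K_subspace S" "w \<in> S"
  shows "poly_fun S (\<lambda>_. w)"
proof -
  have "w \<in> carrier R" using assms(2) K_subspaceD(1)[OF assms(1)] by blast
  then show ?thesis unfolding poly_fun_def using assms(2) by (intro exI[of _ "[w]"]) simp
qed

lemma poly_fun_add:
  assumes S: "K_subspace S" and "poly_fun S \<phi>" "poly_fun S \<psi>"
  shows "poly_fun S (\<lambda>t. \<phi> t \<oplus> \<psi> t)"
proof -
  have "\<exists>us. set us \<subseteq> S \<and> (\<forall>t\<in>K. horner ws t \<oplus> horner vs t = horner us t)"
    if "set ws \<subseteq> S" "set vs \<subseteq> S" for ws vs
    using that
  proof (induction ws arbitrary: vs)
    case Nil
    have "set vs \<subseteq> carrier R" using Nil K_subspaceD(1)[OF S] by auto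
    then show ?case using Nil by (intro exI[of _ vs]) simp
  next
    case (Cons w ws)
    have ws: "set (w # ws) \<subseteq> carrier R" using Cons.prems K_subspaceD(1)[OF S] by auto
    show ?case
    proof (cases vs)
      case Nil
      then show ?thesis using Cons.prems ws by (intro exI[of _ "w # ws"]) simp
    next
      case v: (Cons v vs')
      obtain us where us: "set us \<subseteq> S" "\<forall>t\<in>K. horner ws t \<oplus> horner vs' t = horner us t"
        using Cons.IH[of vs'] Cons.prems v by auto
      have vs: "set (v # vs') \<subseteq> carrier R" using Cons.prems v K_subspaceD(1)[OF S] by auto
      have "horner (w # ws) t \<oplus> horner vs t = horner ((w \<oplus> v) # us) t" if t: "t \<in> K" for t
      proof -
        have "w \<in> carrier R" "v \<in> carrier R" "horner ws t \<in> carrier R" "horner vs' t \<in> carrier R" "t \<in> carrier R"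
          using ws vs t by auto
        then have "(w \<oplus> t \<otimes> horner ws t) \<oplus> (v \<oplus> t \<otimes> horner vs' t) = (w \<oplus> v) \<oplus> t \<otimes> (horner ws t \<oplus> horner vs' t)"
          by (rule_tac add_smult_swap)
        then show ?thesis using us(2) t unfolding v horner.simps by simp
      qed
      moreover have "set ((w \<oplus> v) # us) \<subseteq> S" using us(1) Cons.prems v K_subspaceD(3)[OF S] by auto
      ultimately show ?thesis by blast
    qed
  qed
  then show ?thesis using assms(2,3) unfolding poly_fun_def by (metis (no_types, lifting))
qed

lemma poly_fun_shift:
  assumes S: "K_subspace S" and "poly_fun S \<phi>"
  shows "poly_fun S (\<lambda>t. t \<otimes> \<phi> t)"
proof -
  obtain ws where ws: "set ws \<subseteq> S" "\<forall>t\<in>K. \<phi> t = horner ws t" using assms(2) unfolding poly_fun_def by blast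
  have "set ws \<subseteq> carrier R" using ws(1) K_subspaceD(1)[OF S] by blast
  then have "\<forall>t\<in>K. t \<otimes> \<phi> t = horner (\<zero> # ws) t" using ws(2) by simp
  moreover have "set (\<zero> # ws) \<subseteq> S" using ws(1) K_subspaceD(2)[OF S] by simp
  ultimately show ?thesis unfolding poly_fun_def by blast
qed

text \<open>A linear map passes through the powers of \<open>t\<close> and acts on the coefficients
  alone.\<close>

lemma poly_fun_image:
  assumes S: "K_subspace S" and S': "K_subspace S'" and "poly_fun S \<phi>"
    and T: "\<And>x. x \<in> S \<Longrightarrow> T x \<in> S'" "\<And>x y. x \<in> S \<Longrightarrow> y \<in> S \<Longrightarrow> T (x \<oplus> y) = T x \<oplus> T y"
      "\<And>k x. k \<in> K \<Longrightarrow> x \<in> S \<Longrightarrow> T (k \<otimes> x) = k \<otimes> T x"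
  shows "poly_fun S' (\<lambda>t. T (\<phi> t))"
proof -
  obtain ws where ws: "set ws \<subseteq> S" "\<forall>t\<in>K. \<phi> t = horner ws t" using assms(3) unfolding poly_fun_def by blast
  have T0: "T \<zero> = \<zero>"
  proof -
    have "T (\<zero> \<otimes> \<zero>) = \<zero> \<otimes> T \<zero>" using T(3) K_subspaceD(2)[OF S] by blast
    moreover have "T \<zero> \<in> carrier R" using T(1) K_subspaceD(2)[OF S] K_subspaceD(1)[OF S'] by blast
    ultimately show ?thesis by simp
  qed
  have "T (horner ws t) = horner (map T ws) t" if t: "t \<in> K" for t
    using ws(1)
  proof (induction ws)
    case Nil
    then show ?case using T0 by simp
  next
    case (Cons w ws)
    then have "w \<in> S" "horner ws t \<in> S" using horner_in[OF S _ t] by auto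
    then show ?case using T t Cons K_subspaceD(4)[OF S] by simp
  qed
  moreover have "set (map T ws) \<subseteq> S'" using ws(1) T(1) by auto
  ultimately show ?thesis unfolding poly_fun_def using ws(2) by (intro exI[of _ "map T ws"]) simp
qed

lemma poly_fun_mult:
  assumes S: "K_subspace S" and "poly_fun K \<phi>" "poly_fun S \<psi>"
  shows "poly_fun S (\<lambda>t. \<phi> t \<otimes> \<psi> t)"
proof -
  obtain ws where ws: "set ws \<subseteq> K" "\<forall>t\<in>K. \<phi> t = horner ws t" using assms(2) unfolding poly_fun_def by blast
  have \<psi>: "\<psi> t \<in> carrier R" if "t \<in> K" for t using poly_fun_in[OF S assms(3) that] K_subspaceD(1)[OF S] by blast
  have "poly_fun S (\<lambda>t. horner ws t \<otimes> \<psi> t)"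
    using ws(1)
  proof (induction ws)
    case Nil
    have "poly_fun S (\<lambda>_. \<zero>)" using poly_fun_const[OF S K_subspaceD(2)[OF S]] .
    then show ?case unfolding poly_fun_def using \<psi> by simp
  next
    case (Cons w ws)
    have 1: "poly_fun S (\<lambda>t. w \<otimes> \<psi> t)"
    proof (rule poly_fun_image[OF S S assms(3)])
      fix k x assume k: "k \<in> K" "x \<in> S"
      then have "x \<in> carrier R" "w \<in> K" using K_subspaceD(1)[OF S] Cons.prems by auto
      then show "w \<otimes> (k \<otimes> x) = k \<otimes> (w \<otimes> x)" using k K_comm[of w k] by (simp add: m_assoc[symmetric])
    qed (use Cons.prems S in \<open>auto simp: K_subspaceD r_distr subsetD[OF K_subspaceD(1)[OF S]]\<close>)
    have 2: "poly_fun S (\<lambda>t. t \<otimes> (horner ws t \<otimes> \<psi> t))"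
      using poly_fun_shift[OF S] Cons by simp
    have "(w \<oplus> t \<otimes> horner ws t) \<otimes> \<psi> t = w \<otimes> \<psi> t \<oplus> t \<otimes> (horner ws t \<otimes> \<psi> t)" if t: "t \<in> K" for t
    proof -
      have "w \<in> carrier R" "t \<in> carrier R" "horner ws t \<in> carrier R"
        using t Cons.prems K_sub by auto
      then show ?thesis using \<psi>[OF t] by (simp add: l_distr m_assoc)
    qed
    then show ?case using poly_fun_add[OF S 1 2] unfolding poly_fun_def by simp
  qed
  then show ?thesis unfolding poly_fun_def using ws(2) by simp
qed

lemma poly_fun_uminus:
  assumes S: "K_subspace S" and "poly_fun S \<psi>"
  shows "poly_fun S (\<lambda>t. \<ominus> \<psi> t)"
proof -
  have "poly_fun S (\<lambda>t. \<ominus> \<one> \<otimes> \<psi> t)" by (rule poly_fun_mult[OF S poly_fun_const[OF K_subspace_K] assms(2)]) simp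
  moreover have "\<psi> t \<in> carrier R" if "t \<in> K" for t using poly_fun_in[OF S assms(2) that] K_subspaceD(1)[OF S] by blast
  ultimately show ?thesis unfolding poly_fun_def by (simp add: l_minus)
qed

lemma poly_fun_roots:
  assumes S: "K_subspace S" and "poly_fun S \<phi>" "t0 \<in> K" "\<phi> t0 \<noteq> \<zero>"
  shows "finite {t \<in> K. \<phi> t = \<zero>}"
proof (rule ccontr)
  assume i: "infinite {t \<in> K. \<phi> t = \<zero>}"
  obtain ws where ws: "set ws \<subseteq> S" "\<forall>t\<in>K. \<phi> t = horner ws t" using assms(2) unfolding poly_fun_def by blast
  have eq: "{t \<in> K. \<phi> t = \<zero>} = {t \<in> K. horner ws t = \<zero>}" using ws(2) by auto
  have wc: "set ws \<subseteq> carrier R" using ws(1) K_subspaceD(1)[OF S] by blast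
  obtain Z where Z: "finite Z" "card Z = length ws" "Z \<subseteq> {t \<in> K. horner ws t = \<zero>}"
    using infinite_arbitrarily_large[OF i[unfolded eq]] by metis
  have "horner ws s = \<zero>" if "s \<in> Z" for s using Z(3) that by blast
  moreover have "Z \<subseteq> K" "length ws \<le> card Z" using Z by auto
  ultimately have "horner ws t0 = \<zero>"
    using horner_roots[OF wc _ Z(1) _ _ assms(3)] by blast
  then show False using ws(2) assms(3,4) by simp
qed

lemma coordinate:
  assumes ind: "independent K (u # Us)"
  obtains \<mu> where "\<forall>x\<in>Span K (u # Us). \<mu> x \<in> K"
    "\<forall>x\<in>Span K (u # Us). \<forall>y\<in>Span K (u # Us). \<mu> (x \<oplus> y) = \<mu> x \<oplus> \<mu> y"
    "\<forall>k\<in>K. \<forall>x\<in>Span K (u # Us). \<mu> (k \<otimes> x) = k \<otimes> \<mu> x"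
    "\<mu> u = \<one>" "\<forall>x\<in>Span K Us. \<mu> x = \<zero>"
proof -
  have uc: "u \<in> carrier R" "u \<notin> Span K Us" "set Us \<subseteq> carrier R"
    using ind independent_in_carrier by (auto simp: independent_Cons_iff)
  define \<mu> where "\<mu> x = (SOME k. k \<in> K \<and> x \<ominus> k \<otimes> u \<in> Span K Us)" for x
  have val: "\<mu> (k \<otimes> u \<oplus> s) = k" if "k \<in> K" "s \<in> Span K Us" for k s
  proof -
    have sc: "s \<in> carrier R" using that uc Span_K(1) by blast
    have "k \<otimes> u \<oplus> s \<ominus> k \<otimes> u = s" using that uc sc by (simp add: a_minus_def a_ac r_neg1 r_neg2 r_neg)
    then have "k \<in> K \<and> k \<otimes> u \<oplus> s \<ominus> k \<otimes> u \<in> Span K Us" using that by simp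
    then have m: "\<mu> (k \<otimes> u \<oplus> s) \<in> K \<and> k \<otimes> u \<oplus> s \<ominus> \<mu> (k \<otimes> u \<oplus> s) \<otimes> u \<in> Span K Us"
      unfolding \<mu>_def by (rule someI)
    let ?m = "\<mu> (k \<otimes> u \<oplus> s)"
    have "k \<otimes> u \<oplus> s \<ominus> ?m \<otimes> u \<ominus> s \<in> Span K Us" using m that Span_K_minus[OF uc(3)] by blast
    moreover have "k \<otimes> u \<oplus> s \<ominus> m \<otimes> u \<ominus> s = (k \<ominus> m) \<otimes> u" if "m \<in> carrier R" for m
      using that \<open>k \<in> K\<close>[THEN K_carrier] uc(1) sc by algebra
    ultimately have "(k \<ominus> ?m) \<otimes> u \<in> Span K Us" using m by simp
    then have "k \<ominus> ?m = \<zero>" using Span_K_divide[OF uc(3), of "k \<ominus> ?m" u] uc that m by auto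
    then show ?thesis using that m by (simp add: minus_eq_zero_iff)
  qed
  show thesis
  proof (rule that; (intro ballI)?)
    fix x assume "x \<in> Span K (u # Us)"
    then obtain k s where x: "k \<in> K" "s \<in> Span K Us" "x = k \<otimes> u \<oplus> s" unfolding Span_Cons_iff by blast
    then show "\<mu> x \<in> K" using val by simp
    have sc: "s \<in> carrier R" using x uc Span_K(1) by blast
    {
      fix y assume "y \<in> Span K (u # Us)"
      then obtain k' s' where y: "k' \<in> K" "s' \<in> Span K Us" "y = k' \<otimes> u \<oplus> s'" unfolding Span_Cons_iff by blast
      have sc': "s' \<in> carrier R" using y uc Span_K(1) by blast
      have "x \<oplus> y = (k \<oplus> k') \<otimes> u \<oplus> (s \<oplus> s')"
        unfolding x(3) y(3) using K_carrier[OF x(1)] K_carrier[OF y(1)] uc(1) sc sc' by algebra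
      moreover have "s \<oplus> s' \<in> Span K Us" using x y Span_K(3)[OF uc(3)] by blast
      ultimately show "\<mu> (x \<oplus> y) = \<mu> x \<oplus> \<mu> y" using val x y by simp
    }
    fix k' assume k': "k' \<in> K"
    have "k' \<otimes> x = (k' \<otimes> k) \<otimes> u \<oplus> k' \<otimes> s"
      unfolding x(3) using K_carrier[OF x(1)] K_carrier[OF k'] uc(1) sc by algebra
    moreover have "k' \<otimes> s \<in> Span K Us" using x k' Span_K(5)[OF uc(3)] by blast
    ultimately show "\<mu> (k' \<otimes> x) = k' \<otimes> \<mu> x" using val x k' by simp
  next
    have "\<mu> (\<one> \<otimes> u \<oplus> \<zero>) = \<one>" by (rule val) (use Span_K(2)[OF uc(3)] in auto)
    then show "\<mu> u = \<one>" using uc by simp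
    fix x assume x: "x \<in> Span K Us"
    then have "\<mu> (\<zero> \<otimes> u \<oplus> x) = \<zero>" by (intro val) auto
    moreover have "x \<in> carrier R" using x uc Span_K(1) by blast
    ultimately show "\<mu> x = \<zero>" using uc by simp
  qed
qed

text \<open>Gaussian elimination in place of determinants. A coordinate functional
  \<open>\<mu>\<close> gives a pivot \<open>q t = \<mu> (\<phi> n t)\<close> with value
  \<open>\<one>\<close> at \<open>t0\<close>, and
  \<open>g i = q \<phi> i - \<mu> (\<phi> i) \<phi> n\<close> clears this coordinate from the other
  vectors while staying polynomial in \<open>t\<close>. Every exceptional \<open>t\<close> is a root
  of \<open>q\<close> or an exception for \<open>g\<close>.\<close>

lemma independent_generic:
  assumes "\<And>i. i < n \<Longrightarrow> poly_fun (carrier R) (\<phi> i)" "t0 \<in> K"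
    "independent K (family (\<lambda>i. \<phi> i t0) n)"
  shows "finite {t \<in> K. \<not> independent K (family (\<lambda>i. \<phi> i t) n)}"
  using assms(1,3)
proof (induction n arbitrary: \<phi>)
  case 0
  show ?case by simp
next
  case (Suc n)
  have \<phi>c: "\<phi> i t \<in> carrier R" if "i < Suc n" "t \<in> K" for i t
    by (rule poly_fun_in[OF K_subspace_carrier Suc.prems(1)[OF that(1)] that(2)])
  have "\<exists>ws. set ws \<subseteq> carrier R \<and> (\<forall>t\<in>K. \<phi> i t = horner ws t)" if "i < Suc n" for i
    using Suc.prems(1)[OF that] unfolding poly_fun_def .
  then obtain ws where ws: "\<And>i. i < Suc n \<Longrightarrow> set (ws i) \<subseteq> carrier R"
      "\<And>i t. i < Suc n \<Longrightarrow> t \<in> K \<Longrightarrow> \<phi> i t = horner (ws i) t" by metis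
  \<comment> \<open>The coefficients span a finite-dimensional \<open>?E\<close> that contains every
    \<open>\<phi> i t\<close>, so the vectors at \<open>t0\<close> extend to a basis of it and
    \<open>\<mu>\<close> is defined on all of it.\<close>
  define C where "C = concat (map ws [0..<Suc n])"
  have Cc: "set C \<subseteq> carrier R" 
  proof
    fix x assume "x \<in> set C"
    then obtain i where "i < Suc n" "x \<in> set (ws i)" unfolding C_def by (auto simp del: upt_Suc)
    then show "x \<in> carrier R" using ws(1) by blast
  qed
  let ?E = "Span K C"
  have E: "K_subspace ?E" by (rule K_subspace_Span[OF Cc])
  have \<phi>E: "poly_fun ?E (\<phi> i)" if "i < Suc n" for i
  proof -
    have "set (ws i) \<subseteq> set C" unfolding C_def using that by (auto simp del: upt_Suc)
    then have "set (ws i) \<subseteq> ?E" using Span_base_incl[OF subfield_K Cc] by blast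
    then show ?thesis unfolding poly_fun_def using ws(2)[OF that] by blast
  qed
  obtain m where m: "dimension m K ?E" using Span_finite_dimension[OF subfield_K Cc] by blast
  let ?L = "family (\<lambda>i. \<phi> i t0) n"
  have "set (family (\<lambda>i. \<phi> i t0) (Suc n)) \<subseteq> ?E"
    using poly_fun_in[OF E \<phi>E assms(2)] by (auto simp del: family_simps(2))
  then obtain Vs where V: "independent K (Vs @ family (\<lambda>i. \<phi> i t0) (Suc n))"
      "Span K (Vs @ family (\<lambda>i. \<phi> i t0) (Suc n)) = ?E"
    using complete_base[OF subfield_K m Suc.prems(2)] by blast
  have st: "set (Vs @ family (\<lambda>i. \<phi> i t0) (Suc n)) = set (\<phi> n t0 # Vs @ ?L)" by auto
  have ind: "independent K (\<phi> n t0 # Vs @ ?L)"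
    by (rule independent_same_set[OF subfield_K st _ V(1)]) simp
  have Ee: "Span K (\<phi> n t0 # Vs @ ?L) = ?E"
    using Span_same_set[OF subfield_K independent_in_carrier[OF V(1)] st] V(2) by simp
  obtain \<mu> where mu': "\<forall>x\<in>?E. \<mu> x \<in> K"
    "\<forall>x\<in>?E. \<forall>y\<in>?E. \<mu> (x \<oplus> y) = \<mu> x \<oplus> \<mu> y"
    "\<forall>k\<in>K. \<forall>x\<in>?E. \<mu> (k \<otimes> x) = k \<otimes> \<mu> x"
    "\<mu> (\<phi> n t0) = \<one>" "\<forall>x\<in>Span K (Vs @ ?L). \<mu> x = \<zero>"
    by (rule coordinate[OF ind, unfolded Ee])
  note mu = mu'(1)[rule_format] mu'(2)[rule_format] mu'(3)[rule_format] mu'(4) mu'(5)[rule_format]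
  define q where "q t = \<mu> (\<phi> n t)" for t
  define g where "g i t = q t \<otimes> \<phi> i t \<oplus> \<ominus> (\<mu> (\<phi> i t) \<otimes> \<phi> n t)" for i t
  have pmu: "poly_fun K (\<lambda>t. \<mu> (\<phi> i t))" if "i < Suc n" for i
    by (rule poly_fun_image[OF E K_subspace_K \<phi>E[OF that]]) (use mu in auto)
  have qp: "poly_fun K q" unfolding q_def using pmu by simp
  have gp: "poly_fun (carrier R) (g i)" if "i < n" for i
    unfolding g_def using that
    by (intro poly_fun_add poly_fun_uminus poly_fun_mult K_subspace_carrier qp pmu Suc.prems(1)) auto
  have q0: "q t0 = \<one>" unfolding q_def by (rule mu(4))
  \<comment> \<open>\<open>\<mu>\<close> vanishes on the other \<open>\<phi> i t0\<close>, so
    elimination changes nothing at \<open>t0\<close> and the induction hypothesis applies to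
    \<open>g\<close>.\<close>
  have g0: "g i t0 = \<phi> i t0" if "i < n" for i
  proof -
    have "\<phi> i t0 \<in> set (Vs @ ?L)" using that by auto
    moreover have "set (Vs @ ?L) \<subseteq> carrier R" using independent_in_carrier[OF ind] by auto
    ultimately have "\<mu> (\<phi> i t0) = \<zero>" using mu(5) Span_base_incl[OF subfield_K] by blast
    then show ?thesis unfolding g_def q0 using \<phi>c assms(2) that by simp
  qed
  have "family (\<lambda>i. g i t0) n = ?L" by (rule family_cong) (rule g0)
  then have "independent K (family (\<lambda>i. g i t0) n)"
    using Suc.prems(2) by (simp add: independent_Cons_iff)
  then have fin1: "finite {t \<in> K. \<not> independent K (family (\<lambda>i. g i t) n)}"
    using gp by (intro Suc.IH[of g])
  have fin2: "finite {t \<in> K. q t = \<zero>}"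
    by (rule poly_fun_roots[OF K_subspace_K qp assms(2)]) (simp add: q0)
  have "independent K (family (\<lambda>i. \<phi> i t) (Suc n))"
    if t: "t \<in> K" "q t \<noteq> \<zero>" "independent K (family (\<lambda>i. g i t) n)" for t
  proof (subst independent_family_iff[OF subfield_K])
    show "\<phi> i t \<in> carrier R" if "i < Suc n" for i using \<phi>c that t by simp
    have gc: "g i t \<in> carrier R" if "i < n" for i by (rule poly_fun_in[OF K_subspace_carrier gp[OF that] t(1)])
    have \<phi>Et: "\<phi> i t \<in> ?E" if "i < Suc n" for i by (rule poly_fun_in[OF E \<phi>E[OF that] t(1)])
    have qK: "q t \<in> K" unfolding q_def using mu(1) \<phi>Et by simp
    have muK: "\<mu> (\<phi> i t) \<in> K" if "i < Suc n" for i using mu(1) \<phi>Et that by simp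
    show "\<forall>\<alpha>. (\<forall>i<Suc n. \<alpha> i \<in> K) \<longrightarrow> lincomb \<alpha> (\<lambda>i. \<phi> i t) (Suc n) = \<zero> \<longrightarrow> (\<forall>i<Suc n. \<alpha> i = \<zero>)"
    proof (intro allI impI)
      fix \<alpha> i assume al: "\<forall>i<Suc n. \<alpha> i \<in> K" "lincomb \<alpha> (\<lambda>i. \<phi> i t) (Suc n) = \<zero>" and i: "i < Suc n"
      have alc: "\<alpha> j \<in> K" if "j < Suc n" for j using al that by simp
      \<comment> \<open>By linearity the combination of the \<open>g i\<close> is
        \<open>q s - \<mu> s \<phi> n\<close>, where \<open>s\<close> is the same combination of the
        \<open>\<phi> i\<close>. A relation among the \<open>\<phi> i\<close> therefore yields one
        among the \<open>g i\<close>.\<close>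
      have main: "lincomb \<alpha> (\<lambda>i. \<phi> i t) m \<in> ?E \<and> \<mu> (lincomb \<alpha> (\<lambda>i. \<phi> i t) m) \<in> K \<and>
          lincomb \<alpha> (\<lambda>i. g i t) m = q t \<otimes> lincomb \<alpha> (\<lambda>i. \<phi> i t) m \<ominus> \<mu> (lincomb \<alpha> (\<lambda>i. \<phi> i t) m) \<otimes> \<phi> n t"
        if "m \<le> n" for m
        using that
      proof (induction m)
        case 0
        have "\<mu> \<zero> = \<zero>" using mu(5) Span_K(2)[of "Vs @ ?L"] independent_in_carrier[OF ind] by simp
        then show ?case using K_subspaceD(2)[OF E] qK \<phi>c[of n t] t by (simp add: a_minus_def)
      next
        case (Suc m)
        let ?s = "lincomb \<alpha> (\<lambda>i. \<phi> i t) m"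
        have IH: "?s \<in> ?E" "\<mu> ?s \<in> K" "lincomb \<alpha> (\<lambda>i. g i t) m = q t \<otimes> ?s \<ominus> \<mu> ?s \<otimes> \<phi> n t"
          using Suc by auto
        have mE: "\<phi> m t \<in> ?E" "\<alpha> m \<in> K" using \<phi>Et alc Suc.prems by simp_all
        have aE: "\<alpha> m \<otimes> \<phi> m t \<in> ?E" using K_subspaceD(4)[OF E mE(2,1)] .
        have sE: "?s \<oplus> \<alpha> m \<otimes> \<phi> m t \<in> ?E" using K_subspaceD(3)[OF E IH(1) aE] .
        have mu1: "\<mu> (?s \<oplus> \<alpha> m \<otimes> \<phi> m t) = \<mu> ?s \<oplus> \<alpha> m \<otimes> \<mu> (\<phi> m t)"
          using mu(2)[OF IH(1) aE] mu(3)[OF mE(2,1)] by simp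
        have c: "?s \<in> carrier R" "\<mu> ?s \<in> carrier R" "q t \<in> carrier R" "\<alpha> m \<in> carrier R"
            "\<phi> m t \<in> carrier R" "\<phi> n t \<in> carrier R" "\<mu> (\<phi> m t) \<in> carrier R"
          using IH K_subspaceD(1)[OF E] qK mE \<phi>c[of m t] \<phi>c[of n t] t muK[of m] Suc.prems by auto
        have com: "\<alpha> m \<otimes> q t = q t \<otimes> \<alpha> m" using K_comm mE qK by simp
        have "q t \<otimes> (x \<oplus> r \<otimes> y) \<ominus> (z \<oplus> r \<otimes> p) \<otimes> w =
            (q t \<otimes> x \<ominus> z \<otimes> w) \<oplus> ((q t \<otimes> r) \<otimes> y \<ominus> r \<otimes> (p \<otimes> w))"
          if "x \<in> carrier R" "r \<in> carrier R" "y \<in> carrier R" "z \<in> carrier R" "p \<in> carrier R" "w \<in> carrier R" for x r y z p w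
          using that c(3) by algebra
        then have "q t \<otimes> (?s \<oplus> \<alpha> m \<otimes> \<phi> m t) \<ominus> (\<mu> ?s \<oplus> \<alpha> m \<otimes> \<mu> (\<phi> m t)) \<otimes> \<phi> n t =
            (q t \<otimes> ?s \<ominus> \<mu> ?s \<otimes> \<phi> n t) \<oplus> ((q t \<otimes> \<alpha> m) \<otimes> \<phi> m t \<ominus> \<alpha> m \<otimes> (\<mu> (\<phi> m t) \<otimes> \<phi> n t))"
          using c by simp
        also have "(q t \<otimes> \<alpha> m) \<otimes> \<phi> m t \<ominus> \<alpha> m \<otimes> (\<mu> (\<phi> m t) \<otimes> \<phi> n t) = \<alpha> m \<otimes> g m t"
          unfolding g_def com[symmetric] using c by (simp add: a_minus_def r_distr r_minus m_assoc)
        finally have "lincomb \<alpha> (\<lambda>i. g i t) (Suc m) = q t \<otimes> lincomb \<alpha> (\<lambda>i. \<phi> i t) (Suc m) \<ominus>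
            \<mu> (lincomb \<alpha> (\<lambda>i. \<phi> i t) (Suc m)) \<otimes> \<phi> n t"
          unfolding lincomb.simps mu1 IH(3) by simp
        moreover have "\<mu> (lincomb \<alpha> (\<lambda>i. \<phi> i t) (Suc m)) \<in> K"
          unfolding lincomb.simps mu1 using IH(2) mE muK[of m] Suc.prems by simp
        ultimately show ?case using sE unfolding lincomb.simps by blast
      qed
      let ?s = "lincomb \<alpha> (\<lambda>i. \<phi> i t) n"
      have S: "?s \<in> ?E" "\<mu> ?s \<in> K" "lincomb \<alpha> (\<lambda>i. g i t) n = q t \<otimes> ?s \<ominus> \<mu> ?s \<otimes> \<phi> n t"
        using main[of n] by auto
      have anK: "\<alpha> n \<in> K" using alc by simp
      have nE: "\<phi> n t \<in> ?E" using \<phi>Et by simp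
      have c: "?s \<in> carrier R" "\<mu> ?s \<in> carrier R" "q t \<in> carrier R" "\<alpha> n \<in> carrier R" "\<phi> n t \<in> carrier R"
        using S K_subspaceD(1)[OF E] qK anK nE by auto
      have z: "?s \<oplus> \<alpha> n \<otimes> \<phi> n t = \<zero>" using al(2) by simp
      have "\<mu> (?s \<oplus> \<alpha> n \<otimes> \<phi> n t) = \<mu> ?s \<oplus> \<alpha> n \<otimes> q t"
        unfolding q_def using mu(2)[OF S(1) K_subspaceD(4)[OF E anK nE]] mu(3)[OF anK nE] by simp
      moreover have "\<mu> \<zero> = \<zero>" using mu(5) Span_K(2)[of "Vs @ ?L"] independent_in_carrier[OF ind] by simp
      ultimately have z2: "\<mu> ?s \<oplus> \<alpha> n \<otimes> q t = \<zero>" using z by simp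
      have "q t \<otimes> ?s \<ominus> \<mu> ?s \<otimes> \<phi> n t =
          q t \<otimes> (?s \<oplus> \<alpha> n \<otimes> \<phi> n t) \<ominus> (\<mu> ?s \<oplus> q t \<otimes> \<alpha> n) \<otimes> \<phi> n t"
      proof -
        have "q t \<otimes> x \<ominus> y \<otimes> w = q t \<otimes> (x \<oplus> r \<otimes> w) \<ominus> (y \<oplus> q t \<otimes> r) \<otimes> w"
          if "x \<in> carrier R" "r \<in> carrier R" "y \<in> carrier R" "w \<in> carrier R" for x y r w
          using that c(3) by algebra
        from this[OF c(1,4,2,5)] show ?thesis .
      qed
      also have "q t \<otimes> \<alpha> n = \<alpha> n \<otimes> q t" by (rule K_comm[OF qK anK])
      finally have "lincomb \<alpha> (\<lambda>i. g i t) n = \<zero>"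
        unfolding S(3) z z2 using c by (simp add: a_minus_def)
      then have a0: "\<forall>j<n. \<alpha> j = \<zero>"
        using independent_family_iff[OF subfield_K, of n "\<lambda>i. g i t"] t(3) gc alc by simp
      have "?s = \<zero>" by (rule lincomb_zero_left) (use a0 \<phi>c t in auto)
      then have "\<alpha> n \<otimes> \<phi> n t = \<zero>" using z c by simp
      moreover have "\<phi> n t \<noteq> \<zero>"
      proof
        assume "\<phi> n t = \<zero>"
        then have "q t = \<zero>" unfolding q_def using \<open>\<mu> \<zero> = \<zero>\<close> by simp
        then show False using t by simp
      qed
      ultimately have "\<alpha> n = \<zero>" using c by simp
      then show "\<alpha> i = \<zero>" using a0 i by (auto simp: less_Suc_eq)
    qed
  qed
  then have "{t \<in> K. \<not> independent K (family (\<lambda>i. \<phi> i t) (Suc n))} \<subseteq>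
      {t \<in> K. \<not> independent K (family (\<lambda>i. g i t) n)} \<union> {t \<in> K. q t = \<zero>}" by blast
  then show ?case using fin1 fin2 finite_subset by blast
qed

lemma poly_fun_lincomb:
  assumes "K_linear K T" "poly_fun (carrier R) \<phi>"
  shows "poly_fun (carrier R) (\<lambda>t. T (\<phi> t))"
  by (rule poly_fun_image[OF K_subspace_carrier K_subspace_carrier assms(2)])
    (use assms(1) in \<open>auto simp: K_linear_closed K_linear_add K_linear_smult\<close>)

section \<open>Additive commutators of \<open>a\<close> and the passage to central
  coefficients\<close>

definition commutators :: "'a set" where
  "commutators = {c \<otimes> a \<ominus> a \<otimes> c | c. c \<in> carrier R}"

lemma commutators_carrier: "x \<in> commutators \<Longrightarrow> x \<in> carrier R"
  unfolding commutators_def by auto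

text \<open>The theorem writes these commutators with the opposite sign; replacing \<open>c\<close>
  by its negative reconciles the two.\<close>

lemma commutatorsE: "x \<in> commutators \<Longrightarrow> \<exists>c\<in>carrier R. x = a \<otimes> c \<ominus> c \<otimes> a"
proof -
  assume "x \<in> commutators"
  then obtain c where c: "c \<in> carrier R" "x = c \<otimes> a \<ominus> a \<otimes> c" unfolding commutators_def by blast
  have "c \<otimes> a \<ominus> a \<otimes> c = a \<otimes> (\<ominus> c) \<ominus> (\<ominus> c) \<otimes> a" using c(1) a_carrier by algebra
  then show ?thesis using c by (intro bexI[of _ "\<ominus> c"]) auto
qed

lemma commutators_add: "x \<in> commutators \<Longrightarrow> y \<in> commutators \<Longrightarrow> x \<oplus> y \<in> commutators"
proof -
  assume "x \<in> commutators" "y \<in> commutators"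
  then obtain c c' where c: "c \<in> carrier R" "x = c \<otimes> a \<ominus> a \<otimes> c" "c' \<in> carrier R" "y = c' \<otimes> a \<ominus> a \<otimes> c'"
    unfolding commutators_def by blast
  have "x \<oplus> y = (c \<oplus> c') \<otimes> a \<ominus> a \<otimes> (c \<oplus> c')" unfolding c using c(1,3) a_carrier by algebra
  then show ?thesis unfolding commutators_def using c by blast
qed

lemma commutators_zero: "\<zero> \<in> commutators"
  unfolding commutators_def by (auto intro!: exI[of _ \<zero>] simp: a_minus_def)

lemma commutators_central: "f \<in> ring_center R \<Longrightarrow> x \<in> commutators \<Longrightarrow> f \<otimes> x \<in> commutators"
proof -
  assume f: "f \<in> ring_center R" and "x \<in> commutators"
  then obtain c where c: "c \<in> carrier R" "x = c \<otimes> a \<ominus> a \<otimes> c" unfolding commutators_def by blast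
  have fc: "f \<in> carrier R" and fa: "f \<otimes> a = a \<otimes> f" using f unfolding ring_center_def by auto
  have "f \<otimes> x = (f \<otimes> c) \<otimes> a \<ominus> (f \<otimes> a) \<otimes> c" unfolding c(2) using c(1) fc a_carrier by algebra
  also have "\<dots> = (f \<otimes> c) \<otimes> a \<ominus> a \<otimes> (f \<otimes> c)" unfolding fa using c(1) fc by (simp add: m_assoc)
  finally show ?thesis unfolding commutators_def using c fc by blast
qed

text \<open>A central coefficient moves across \<open>v\<close>, so the operator collapses to right
  multiplication by one element. It is again a commutator of \<open>a\<close>, since these form a
  vector space over the center.\<close>

lemma sandwich_central:
  assumes "set ps \<subseteq> ring_center R \<times> commutators"
  shows "\<exists>y\<in>commutators. \<forall>v\<in>carrier R. sandwich ps v = v \<otimes> y"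
  using assms
proof (induction ps)
  case Nil
  show ?case using commutators_zero by (intro bexI[of _ \<zero>]) auto
next
  case (Cons fx ps)
  obtain f x where fx: "fx = (f, x)" by (cases fx)
  have f: "f \<in> ring_center R" "x \<in> commutators" using Cons.prems fx by auto
  obtain y where y: "y \<in> commutators" "\<forall>v\<in>carrier R. sandwich ps v = v \<otimes> y" using Cons by auto
  have c: "f \<in> carrier R" "x \<in> carrier R" "y \<in> carrier R"
    using f y commutators_carrier center_K K_sub by auto
  have "sandwich (fx # ps) v = v \<otimes> (f \<otimes> x \<oplus> y)" if v: "v \<in> carrier R" for v
  proof -
    have "f \<otimes> v = v \<otimes> f" using f(1) v unfolding ring_center_def by blast
    then show ?thesis using y(2) v c fx by (simp add: r_distr m_assoc[symmetric])
  qed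
  moreover have "f \<otimes> x \<oplus> y \<in> commutators" using commutators_add[OF commutators_central[OF f] y(1)] .
  ultimately show ?case by blast
qed

lemma sandwich_iterate_central:
  assumes "\<forall>v\<in>carrier R. sandwich ps v = v \<otimes> y" "y \<in> carrier R" "v \<in> carrier R"
  shows "(sandwich ps ^^ i) v = v \<otimes> y [^] i"
  using assms by (induction i) (auto simp: m_assoc)

text \<open>The list \<open>qs\<close> holds the summands whose coefficients are still in \<open>K\<close>. They are moved to \<open>ps\<close> one at a
  time: independence survives for all but finitely many values of a coefficient in \<open>K\<close>, hence for
  some value in the infinite center.\<close>

lemma transfer:
  assumes inf: "infinite (ring_center R)"
    and deg: "\<And>y. y \<in> commutators \<Longrightarrow> \<exists>\<alpha>. (\<forall>i<n. \<alpha> i \<in> ring_center R) \<and> lincomb \<alpha> (\<lambda>i. y [^] i) n = \<zero> \<and> (\<exists>i<n. \<alpha> i \<noteq> \<zero>)"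
    and ps: "set ps \<subseteq> ring_center R \<times> commutators" and qs: "set qs \<subseteq> K \<times> commutators" and v: "v \<in> carrier R"
  shows "\<not> independent K (family (\<lambda>i. (sandwich (ps @ qs) ^^ i) v) n)"
  using ps qs
proof (induction qs arbitrary: ps)
  case Nil
  obtain y where y: "y \<in> commutators" "\<forall>v\<in>carrier R. sandwich ps v = v \<otimes> y" using sandwich_central[OF Nil(1)] by blast
  have yc: "y \<in> carrier R" using y commutators_carrier by blast
  have e: "family (\<lambda>i. (sandwich (ps @ []) ^^ i) v) n = family (\<lambda>i. v \<otimes> y [^] i) n"
    by (rule family_cong) (simp add: sandwich_iterate_central[OF y(2) yc v])
  obtain \<alpha> where al: "\<forall>i<n. \<alpha> i \<in> ring_center R" "lincomb \<alpha> (\<lambda>i. y [^] i) n = \<zero>" "\<exists>i<n. \<alpha> i \<noteq> \<zero>"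
    using deg[OF y(1)] by blast
  have alK: "\<forall>i<n. \<alpha> i \<in> K" using al(1) center_K by blast
  have "lincomb \<alpha> (\<lambda>i. v \<otimes> y [^] i) m = v \<otimes> lincomb \<alpha> (\<lambda>i. y [^] i) m" if "m \<le> n" for m
    using that
  proof (induction m)
    case (Suc m)
    have am: "\<alpha> m \<in> ring_center R" "\<alpha> m \<in> carrier R" using al(1) alK Suc.prems by auto
    have "lincomb \<alpha> (\<lambda>i. y [^] i) m \<in> carrier R" by (rule lincomb_closed) (use alK Suc.prems yc in auto)
    moreover have "\<alpha> m \<otimes> v = v \<otimes> \<alpha> m" using am v unfolding ring_center_def by blast
    then have "\<alpha> m \<otimes> (v \<otimes> y [^] m) = v \<otimes> (\<alpha> m \<otimes> y [^] m)" using am v yc by (simp add: m_assoc[symmetric])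
    ultimately show ?case using Suc v yc am by (simp add: r_distr)
  qed (use v in simp)
  then have "lincomb \<alpha> (\<lambda>i. v \<otimes> y [^] i) n = \<zero>" using al(2) v by simp
  then show ?case unfolding e
    using independent_family_iff[OF subfield_K, of n "\<lambda>i. v \<otimes> y [^] i"] alK al(3) v yc by auto
next
  case (Cons kx qs)
  obtain k x where kx: "kx = (k, x)" by (cases kx)
  have k: "k \<in> K" "x \<in> commutators" "x \<in> carrier R" using Cons.prems kx commutators_carrier by auto
  show ?case
  proof
    assume ind: "independent K (family (\<lambda>i. (sandwich (ps @ kx # qs) ^^ i) v) n)"
    define \<phi> where "\<phi> i t = (sandwich (ps @ (t, x) # qs) ^^ i) v" for i t
    have psK: "set ps \<subseteq> K \<times> carrier R" "set qs \<subseteq> K \<times> carrier R"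
      using Cons.prems center_K commutators_carrier by auto
    have psR: "set ps \<subseteq> carrier R \<times> carrier R" "set qs \<subseteq> carrier R \<times> carrier R"
      using psK K_sub by auto
    have step: "sandwich (ps @ (t, x) # qs) w = sandwich (ps @ qs) w \<oplus> t \<otimes> (w \<otimes> x)" if "t \<in> K" "w \<in> carrier R" for t w
    proof -
      have c: "sandwich ps w \<in> carrier R" "sandwich qs w \<in> carrier R" using psR that by auto
      have tx: "set ((t, x) # qs) \<subseteq> carrier R \<times> carrier R" using that k psR by auto
      show ?thesis using that c k sandwich_append[OF psR(1) tx that(2)] sandwich_append[OF psR that(2)]
        by (simp add: a_ac m_assoc)
    qed
    \<comment> \<open>Each application of the operator contributes one more factor \<open>t\<close>,
      through the single pair \<open>(t, x)\<close>.\<close>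
    have pp: "poly_fun (carrier R) (\<phi> i)" for i
    proof (induction i)
      case 0
      show ?case unfolding \<phi>_def using poly_fun_const[OF K_subspace_carrier v] by simp
    next
      case (Suc i)
      have c: "\<phi> i t \<in> carrier R" if "t \<in> K" for t by (rule poly_fun_in[OF K_subspace_carrier Suc that])
      have "poly_fun (carrier R) (\<lambda>t. sandwich (ps @ qs) (\<phi> i t) \<oplus> t \<otimes> (\<phi> i t \<otimes> x))"
      proof (intro poly_fun_add poly_fun_shift K_subspace_carrier)
        show "poly_fun (carrier R) (\<lambda>t. sandwich (ps @ qs) (\<phi> i t))"
          by (rule poly_fun_lincomb[OF K_linear_sandwich Suc]) (use psK in simp)
        show "poly_fun (carrier R) (\<lambda>t. \<phi> i t \<otimes> x)"
          by (rule poly_fun_lincomb[OF K_linearI Suc]) (use k in \<open>auto simp: l_distr m_assoc\<close>)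
      qed
      moreover have "\<phi> (Suc i) t = sandwich (ps @ qs) (\<phi> i t) \<oplus> t \<otimes> (\<phi> i t \<otimes> x)" if "t \<in> K" for t
        using step[OF that c[OF that]] unfolding \<phi>_def by simp
      ultimately show ?case unfolding poly_fun_def by simp
    qed
    have ind': "independent K (family (\<lambda>i. \<phi> i k) n)" using ind unfolding \<phi>_def kx .
    have "finite {t \<in> K. \<not> independent K (family (\<lambda>i. \<phi> i t) n)}"
      by (rule independent_generic[OF pp k(1) ind'])
    then have "\<not> ring_center R \<subseteq> {t \<in> K. \<not> independent K (family (\<lambda>i. \<phi> i t) n)}"
      using inf finite_subset by blast
    then obtain t where t: "t \<in> ring_center R" "independent K (family (\<lambda>i. \<phi> i t) n)"
      using center_K by blast
    have "\<not> independent K (family (\<lambda>i. (sandwich ((ps @ [(t, x)]) @ qs) ^^ i) v) n)"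
      by (rule Cons.IH) (use Cons.prems t k in auto)
    then show False using t(2) unfolding \<phi>_def by simp
  qed
qed

lemma bracket_commutators: "set ps \<subseteq> K \<times> carrier R \<Longrightarrow> set (bracket ps) \<subseteq> K \<times> commutators"
  unfolding bracket_def commutators_def by auto

text \<open>For odd \<open>n = 2 k + 1\<close> with room for \<open>k + 1\<close> pairs, the even
  chain is cut short by one. Otherwise the dimension is exactly \<open>n\<close> and
  \<open>chain_odd\<close> applies; \<open>2 \<le> n\<close> ensures \<open>k > 0\<close>
  there.\<close>

lemma dim_ge_chain:
  assumes "dim_ge n" "2 \<le> n"
  shows "\<exists>ps v. set ps \<subseteq> K \<times> carrier R \<and> v \<in> carrier R \<and>
    independent K (family (\<lambda>i. (sandwich (bracket ps) ^^ i) v) n)"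
proof -
  have even: ?thesis if b: "dim_ge (2 * k)" and k: "0 < k" "n \<le> 2 * k" for k
  proof -
    obtain u where g: "indep_pairs \<zero> u k" using exists_indep_pairs[OF b] by blast
    obtain ps v where pv: "set ps \<subseteq> K \<times> carrier R" "v \<in> carrier R"
        "independent K (family (\<lambda>i. (sandwich (bracket ps) ^^ i) v) (k + k))"
      using chain_even[OF g k(1)] by blast
    have "independent K (family (\<lambda>i. (sandwich (bracket ps) ^^ i) v) n)"
      by (rule independent_family_mono[OF pv(3)]) (use k in simp)
    then show ?thesis using pv(1,2) by blast
  qed
  show ?thesis
  proof (cases "even n")
    case True
    then obtain k where "n = 2 * k" by blast
    then show ?thesis using even[of k] assms by simp
  next
    case False
    then obtain k where n: "n = 2 * k + 1" by (metis oddE)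
    show ?thesis
    proof (cases "dim_ge (2 * (k + 1))")
      case True
      then show ?thesis using even[of "k + 1"] n by simp
    next
      case False
      have "dim_ge (2 * k)" using dim_ge_mono[OF assms(1)] n by simp
      then obtain u where g: "indep_pairs \<zero> u k" using exists_indep_pairs by blast
      have "0 < k" using n assms(2) by simp
      have b: "dim_ge (2 * k + 1)" and nb: "\<not> dim_ge (2 * k + 2)" and e: "n = Suc (k + k)"
        using False assms(1) n by simp_all
      show ?thesis unfolding e by (rule chain_odd[OF g \<open>0 < k\<close> b nb])
    qed
  qed
qed

text \<open>A chain of length \<open>d + 1\<close> over \<open>K\<close> would survive the passage
  to central coefficients and contradict the relation of degree at most \<open>d\<close>.\<close>

lemma not_dim_ge_infinite:
  assumes inf: "infinite (ring_center R)" and d: "0 < d"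
    and deg: "\<And>y. y \<in> commutators \<Longrightarrow> \<exists>\<alpha>. (\<forall>i<Suc d. \<alpha> i \<in> ring_center R) \<and>
      lincomb \<alpha> (\<lambda>i. y [^] i) (Suc d) = \<zero> \<and> (\<exists>i<Suc d. \<alpha> i \<noteq> \<zero>)"
  shows "\<not> dim_ge (Suc d)"
proof
  assume b: "dim_ge (Suc d)"
  have "2 \<le> Suc d" using d by simp
  then obtain ps v where pv: "set ps \<subseteq> K \<times> carrier R" "v \<in> carrier R"
      "independent K (family (\<lambda>i. (sandwich (bracket ps) ^^ i) v) (Suc d))"
    using dim_ge_chain[OF b] by blast
  have "\<not> independent K (family (\<lambda>i. (sandwich ([] @ bracket ps) ^^ i) v) (Suc d))"
    by (rule transfer[OF inf deg _ bracket_commutators[OF pv(1)] pv(2)]) auto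
  then show False using pv(3) by simp
qed

end

lemma (in ring) finsum_eq_lincomb:
  "(\<And>i. i < n \<Longrightarrow> \<alpha> i \<in> carrier R) \<Longrightarrow> (\<And>i. i < n \<Longrightarrow> f i \<in> carrier R) \<Longrightarrow>
   (\<Oplus>i\<in>{..<n}. \<alpha> i \<otimes> f i) = lincomb \<alpha> f n"
proof (induction n)
  case (Suc n)
  have "(\<Oplus>i\<in>{..<n}. \<alpha> i \<otimes> f i) = lincomb \<alpha> f n" using Suc by simp
  moreover have "(\<Oplus>i\<in>insert n {..<n}. \<alpha> i \<otimes> f i) = \<alpha> n \<otimes> f n \<oplus> (\<Oplus>i\<in>{..<n}. \<alpha> i \<otimes> f i)"
    using Suc.prems by (intro finsum_insert) auto
  ultimately show ?case using Suc.prems by (simp add: lessThan_Suc a_comm)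
qed simp

subsection \<open>From dimension over \<open>K\<close> to dimension over the center\<close>

context skew_field
begin

text \<open>Gaussian elimination over a division ring, with the unknowns to the right of the
  coefficients. An unknown \<open>p\<close> with nonzero coefficient in the last equation is
  expressed by the others, and \<open>B\<close> is the reduced system.\<close>

lemma homogeneous_system:
  assumes "finite J" "m < card J" "\<And>i j. i < m \<Longrightarrow> j \<in> J \<Longrightarrow> A i j \<in> carrier R"
  shows "\<exists>d. (\<forall>j\<in>J. d j \<in> carrier R) \<and> (\<exists>j\<in>J. d j \<noteq> \<zero>) \<and> (\<forall>i<m. (\<Oplus>j\<in>J. A i j \<otimes> d j) = \<zero>)"
  using assms
proof (induction m arbitrary: J A)
  case 0
  then obtain j where "j \<in> J" by fastforce
  then show ?case by (intro exI[of _ "\<lambda>_. \<one>"]) auto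
next
  case (Suc m)
  show ?case
  proof (cases "\<forall>j\<in>J. A m j = \<zero>")
    case True
    have "\<exists>d. (\<forall>j\<in>J. d j \<in> carrier R) \<and> (\<exists>j\<in>J. d j \<noteq> \<zero>) \<and> (\<forall>i<m. (\<Oplus>j\<in>J. A i j \<otimes> d j) = \<zero>)"
      by (rule Suc.IH) (use Suc.prems in auto)
    then obtain d where d: "\<forall>j\<in>J. d j \<in> carrier R" "\<exists>j\<in>J. d j \<noteq> \<zero>" "\<forall>i<m. (\<Oplus>j\<in>J. A i j \<otimes> d j) = \<zero>"
      by blast
    have "(\<Oplus>j\<in>J. A m j \<otimes> d j) = \<zero>" using True d(1) by (intro add.finprod_one_eqI) auto
    then show ?thesis using d by (intro exI[of _ d]) (auto simp: less_Suc_eq)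
  next
    case False
    then obtain p where p: "p \<in> J" "A m p \<noteq> \<zero>" by blast
    have Ac: "A i j \<in> carrier R" if "i < Suc m" "j \<in> J" for i j using Suc.prems(3) that by blast
    let ?J = "J - {p}"
    let ?v = "inv (A m p)"
    have vc: "?v \<in> carrier R" "A m p \<in> carrier R" "A m p \<otimes> ?v = \<one>" using p Ac by auto
    define B where "B i j = A i j \<ominus> A i p \<otimes> ?v \<otimes> A m j" for i j
    have "\<exists>d. (\<forall>j\<in>?J. d j \<in> carrier R) \<and> (\<exists>j\<in>?J. d j \<noteq> \<zero>) \<and> (\<forall>i<m. (\<Oplus>j\<in>?J. B i j \<otimes> d j) = \<zero>)"
    proof (rule Suc.IH)
      show "finite ?J" "m < card ?J" using Suc.prems(1,2) p by auto
      show "B i j \<in> carrier R" if "i < m" "j \<in> ?J" for i j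
        unfolding B_def using that Ac p vc by auto
    qed
    then obtain d where d: "\<forall>j\<in>?J. d j \<in> carrier R" "\<exists>j\<in>?J. d j \<noteq> \<zero>" "\<forall>i<m. (\<Oplus>j\<in>?J. B i j \<otimes> d j) = \<zero>"
      by blast
    define S where "S i = (\<Oplus>j\<in>?J. A i j \<otimes> d j)" for i
    have Sc: "S i \<in> carrier R" if "i < Suc m" for i
      unfolding S_def using that Ac d by (intro finsum_closed) auto
    define e where "e j = (if j = p then \<ominus> (?v \<otimes> S m) else d j)" for j
    have ec: "e j \<in> carrier R" if "j \<in> J" for j unfolding e_def using d that vc Sc by auto
    have sum: "(\<Oplus>j\<in>J. A i j \<otimes> e j) = A i p \<otimes> (\<ominus> (?v \<otimes> S m)) \<oplus> S i" if i: "i < Suc m" for i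
    proof -
      have "J = insert p ?J" using p by blast
      then have "(\<Oplus>j\<in>J. A i j \<otimes> e j) = (\<Oplus>j\<in>insert p ?J. A i j \<otimes> e j)" by simp
      also have "\<dots> = A i p \<otimes> e p \<oplus> (\<Oplus>j\<in>?J. A i j \<otimes> e j)"
        using Suc.prems(1) Ac[OF i] ec p by (intro finsum_insert) auto
      also have "(\<Oplus>j\<in>?J. A i j \<otimes> e j) = S i"
        unfolding S_def using Ac[OF i] d(1) by (intro finsum_cong') (auto simp: e_def)
      finally show ?thesis by (simp add: e_def)
    qed
    have "(\<Oplus>j\<in>J. A i j \<otimes> e j) = \<zero>" if i: "i < Suc m" for i
    proof (cases "i = m")
      case True
      have "A m p \<otimes> (\<ominus> (?v \<otimes> S m)) = \<ominus> S m"
        using vc Sc[of m] p by (simp add: r_minus)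
      then show ?thesis using sum[OF i] True Sc[of m] by (simp add: l_neg)
    next
      case False
      then have im: "i < m" using i by simp
      have c: "A i p \<in> carrier R" using Ac[OF i p(1)] .
      have "(\<Oplus>j\<in>?J. B i j \<otimes> d j) = (\<Oplus>j\<in>?J. A i j \<otimes> d j \<oplus> (\<ominus> (A i p \<otimes> ?v)) \<otimes> (A m j \<otimes> d j))"
      proof (rule finsum_cong')
        fix j assume j: "j \<in> ?J"
        have "A i j \<in> carrier R" "A m j \<in> carrier R" "d j \<in> carrier R" using Ac i d j by auto
        moreover have "(w \<ominus> x \<otimes> y) \<otimes> z = w \<otimes> z \<oplus> (\<ominus> x) \<otimes> (y \<otimes> z)"
          if "w \<in> carrier R" "x \<in> carrier R" "y \<in> carrier R" "z \<in> carrier R" for w x y z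
          using that by algebra
        ultimately show "B i j \<otimes> d j = A i j \<otimes> d j \<oplus> (\<ominus> (A i p \<otimes> ?v)) \<otimes> (A m j \<otimes> d j)"
          unfolding B_def using c vc by simp
      qed (use Ac i d c vc in auto)
      also have "\<dots> = S i \<oplus> (\<Oplus>j\<in>?J. (\<ominus> (A i p \<otimes> ?v)) \<otimes> (A m j \<otimes> d j))"
        unfolding S_def using Ac i d c vc by (intro finsum_addf) auto
      also have "(\<Oplus>j\<in>?J. (\<ominus> (A i p \<otimes> ?v)) \<otimes> (A m j \<otimes> d j)) = (\<ominus> (A i p \<otimes> ?v)) \<otimes> S m"
        unfolding S_def using Suc.prems(1) Ac d c vc by (intro finsum_rdistr[symmetric]) auto
      finally have "S i \<oplus> (\<ominus> (A i p \<otimes> ?v)) \<otimes> S m = \<zero>" using d(3) im by simp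
      then show ?thesis
        using sum[OF i] Sc[OF i] Sc[of m] c vc by (simp add: r_minus l_minus m_assoc a_comm)
    qed
    moreover have "\<exists>j\<in>J. e j \<noteq> \<zero>" using d(2) unfolding e_def by auto
    ultimately show ?thesis using ec by blast
  qed
qed

end

context max_subfield
begin

lemma subfield_center: "subfield (ring_center R) R"
  by (rule ring_center_subfield)

text \<open>With the whole ring as \<open>P\<close>, the centralizer is the center, so density gives
  an operator dual to \<open>f j0\<close>. Applying it to the factors \<open>f j\<close> turns the
  vanishing sums into \<open>d j0\<close>.\<close>

lemma center_independent_sum:
  assumes ind: "independent (ring_center R) (family f r)"
    and d: "\<And>j. j < r \<Longrightarrow> d j \<in> carrier R"
    and z: "\<And>v. v \<in> carrier R \<Longrightarrow> lincomb (\<lambda>j. f j \<otimes> v) d r = \<zero>" and j0: "j0 < r"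
  shows "d j0 = \<zero>"
proof -
  have fc: "f i \<in> carrier R" if "i < r" for i
    using independent_in_carrier[OF ind] that by auto
  have "\<exists>ps. set ps \<subseteq> carrier R \<times> carrier R \<and> (\<forall>j<r. sandwich ps (f j) = (if j = j0 then \<one> else \<zero>))"
    by (rule density) (use ind subfield_center in \<open>auto simp: centralizer_carrier\<close>)
  then obtain ps where ps: "set ps \<subseteq> carrier R \<times> carrier R"
      "\<forall>j<r. sandwich ps (f j) = (if j = j0 then \<one> else \<zero>)" by blast
  have "lincomb (\<lambda>j. sandwich ps (f j)) d r = \<zero>"
    using ps(1)
  proof (induction ps)
    case Nil
    show ?case by (rule lincomb_zero_left) (use d in auto)
  next
    case (Cons pc ps)
    obtain p c where pc: "pc = (p, c)" by (cases pc)
    have c: "p \<in> carrier R" "c \<in> carrier R" "set ps \<subseteq> carrier R \<times> carrier R" using Cons.prems pc by auto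
    have "lincomb (\<lambda>j. sandwich (pc # ps) (f j)) d r = lincomb (\<lambda>j. p \<otimes> (f j \<otimes> c) \<oplus> sandwich ps (f j)) d r"
      by (rule lincomb_cong) (use c pc fc in \<open>auto simp: m_assoc\<close>)
    also have "\<dots> = lincomb (\<lambda>j. p \<otimes> (f j \<otimes> c)) d r \<oplus> lincomb (\<lambda>j. sandwich ps (f j)) d r"
      by (rule lincomb_add_left) (use c fc d in auto)
    also have "lincomb (\<lambda>j. p \<otimes> (f j \<otimes> c)) d r = p \<otimes> lincomb (\<lambda>j. f j \<otimes> c) d r"
      by (rule lincomb_smult) (use c fc d in auto)
    finally show ?case using Cons.IH c z by simp
  qed
  moreover have "lincomb (\<lambda>j. sandwich ps (f j)) d r = lincomb (\<lambda>j. if j = j0 then \<one> else \<zero>) d r"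
    by (rule lincomb_cong) (use ps in auto)
  moreover have "\<dots> = d j0" by (rule lincomb_delta[OF j0]) (use d in auto)
  ultimately show ?thesis by simp
qed

text \<open>This yields \<open>[K:F] \<le> [D:K]\<close>. Given more independent \<open>f j\<close>
  than generators, choose a nonzero family \<open>d\<close> for which the sum of all
  \<open>f j x (d j)\<close> vanishes at every generator \<open>x\<close>. As a function of
  \<open>x\<close> this sum is \<open>K\<close>-linear, because the \<open>f j\<close> lie in the
  commutative \<open>K\<close>. So it vanishes on \<open>D\<close>, against
  \<open>center_independent_sum\<close>.\<close>

lemma center_independent_length:
  assumes xs: "set xs \<subseteq> carrier R" "Span K xs = carrier R"
    and ind: "independent (ring_center R) (family f r)" and f: "\<And>i. i < r \<Longrightarrow> f i \<in> K"
  shows "r \<le> length xs"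
proof (rule ccontr)
  assume "\<not> r \<le> length xs"
  then have "length xs < card {..<r}" by simp
  have xc: "xs ! i \<in> carrier R" if "i < length xs" for i using xs(1) that by auto
  have fc: "f i \<in> carrier R" if "i < r" for i using f that by simp
  have "\<exists>d. (\<forall>j\<in>{..<r}. d j \<in> carrier R) \<and> (\<exists>j\<in>{..<r}. d j \<noteq> \<zero>) \<and>
      (\<forall>i<length xs. (\<Oplus>j\<in>{..<r}. f j \<otimes> xs ! i \<otimes> d j) = \<zero>)"
    by (rule homogeneous_system[OF _ \<open>length xs < _\<close>]) (use xc fc in auto)
  then obtain d where d: "\<And>j. j < r \<Longrightarrow> d j \<in> carrier R" "\<exists>j<r. d j \<noteq> \<zero>"
      "\<forall>i<length xs. (\<Oplus>j\<in>{..<r}. f j \<otimes> xs ! i \<otimes> d j) = \<zero>" by auto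
  define G where "G v = lincomb (\<lambda>j. f j \<otimes> v) d r" for v
  have G: "K_linear K G"
  proof (rule K_linearI)
    fix x y k assume x: "x \<in> carrier R"
    show "G x \<in> carrier R" unfolding G_def using x fc d by auto
    show "G (x \<oplus> y) = G x \<oplus> G y" if y: "y \<in> carrier R"
    proof -
      have "G (x \<oplus> y) = lincomb (\<lambda>j. f j \<otimes> x \<oplus> f j \<otimes> y) d r"
        unfolding G_def by (rule lincomb_cong) (use x y fc in \<open>auto simp: r_distr\<close>)
      also have "\<dots> = G x \<oplus> G y" unfolding G_def by (rule lincomb_add_left) (use x y fc d in auto)
      finally show ?thesis .
    qed
    show "G (k \<otimes> x) = k \<otimes> G x" if k: "k \<in> K"
    proof -
      have "f j \<otimes> (k \<otimes> x) = k \<otimes> (f j \<otimes> x)" if "j < r" for j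
      proof -
        have "f j \<otimes> k = k \<otimes> f j" using K_comm f[OF that] k by blast
        then show ?thesis using fc[OF that] k x by (simp add: m_assoc[symmetric])
      qed
      then have "G (k \<otimes> x) = lincomb (\<lambda>j. k \<otimes> (f j \<otimes> x)) d r"
        unfolding G_def by (intro lincomb_cong) auto
      also have "\<dots> = k \<otimes> G x" unfolding G_def by (rule lincomb_smult) (use k x fc d in auto)
      finally show ?thesis .
    qed
  qed
  have Gx: "G x = \<zero>" if x: "x \<in> set xs" for x
  proof -
    obtain i where i: "i < length xs" "xs ! i = x" using x by (auto simp: in_set_conv_nth)
    have "(\<Oplus>j\<in>{..<r}. f j \<otimes> xs ! i \<otimes> d j) = lincomb (\<lambda>j. f j \<otimes> xs ! i) d r"
      by (rule finsum_eq_lincomb) (use fc xc i d in auto)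
    then show ?thesis unfolding G_def i(2) using d(3)[rule_format, OF i(1)] i(2) by simp
  qed
  have G0: "G v = \<zero>" if "v \<in> carrier R" for v
  proof -
    have "v \<in> Span K xs" using that xs by simp
    then show ?thesis using Gx xs(1)
    proof (induction xs arbitrary: v)
      case Nil
      then show ?case using K_linear_zero[OF G] by simp
    next
      case (Cons x xs)
      then obtain k w where kw: "k \<in> K" "w \<in> Span K xs" "v = k \<otimes> x \<oplus> w" unfolding Span_Cons_iff by blast
      have c: "x \<in> carrier R" "w \<in> carrier R" using Cons.prems kw Span_K(1)[of xs] by auto
      have "G w = \<zero>" by (rule Cons.IH[OF kw(2)]) (use Cons.prems in simp_all)
      then show ?case unfolding kw(3) using Cons.prems kw c
        by (simp add: K_linear_add[OF G] K_linear_smult[OF G])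
    qed
  qed
  have "d j = \<zero>" if "j < r" for j
  proof (rule center_independent_sum[OF ind _ _ that])
    show "d j \<in> carrier R" if "j < r" for j using d(1) that .
    show "lincomb (\<lambda>j. f j \<otimes> v) d r = \<zero>" if "v \<in> carrier R" for v using G0[OF that] unfolding G_def .
  qed
  then show False using d(2) by blast
qed

text \<open>A longest family in \<open>K\<close> that is independent over the center is a basis of
  \<open>K\<close>, and its length is at most \<open>d\<close>. The tower law multiplies this by the
  dimension of \<open>D\<close> over \<open>K\<close>.\<close>

lemma dimension_of_not_dim_ge:
  assumes "\<not> dim_ge (Suc d)"
  shows "\<exists>n\<le>d\<^sup>2. dimension n (ring_center R) (carrier R)"
proof -
  let ?F = "ring_center R"
  obtain xs where xs: "set xs \<subseteq> carrier R" "length xs \<le> d" "Span K xs = carrier R"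
    using assms unfolding dim_ge_def by (auto simp: less_Suc_eq_le)
  obtain m where m: "m \<le> length xs" "dimension m K (carrier R)"
    using Span_dimension_le[OF subfield_K xs(1)] xs(3) by auto
  define P where "P r \<longleftrightarrow> (\<exists>Us. length Us = r \<and> set Us \<subseteq> K \<and> independent ?F Us)" for r
  have bound: "r \<le> length xs" if r: "P r" for r
  proof -
    obtain Us where Us: "length Us = r" "set Us \<subseteq> K" "independent ?F Us" using r unfolding P_def by blast
    have e: "Us = family (\<lambda>i. rev Us ! i) r" using list_eq_family[of Us] Us(1) by simp
    show ?thesis
    proof (rule center_independent_length[OF xs(1,3)])
      show "independent ?F (family (\<lambda>i. rev Us ! i) r)" using Us(3) e by simp
      show "rev Us ! i \<in> K" if "i < r" for i
        using Us(1,2) that by (metis length_rev nth_mem set_rev subsetD)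
    qed
  qed
  have "P 0" unfolding P_def by auto
  then have "P (GREATEST r. P r)" by (rule GreatestI_nat[OF _ bound])
  define r where "r = (GREATEST r. P r)"
  have Pr: "P r" unfolding r_def by fact
  obtain Us where Us: "length Us = r" "set Us \<subseteq> K" "independent ?F Us" using Pr unfolding P_def by blast
  have Uc: "set Us \<subseteq> carrier R" using Us(2) K_sub by blast
  have "Span ?F Us = K"
  proof
    show "K \<subseteq> Span ?F Us"
    proof
      fix k assume k: "k \<in> K"
      show "k \<in> Span ?F Us"
      proof (rule ccontr)
        assume "k \<notin> Span ?F Us"
        then have "P (Suc r)" unfolding P_def using Us k
          by (intro exI[of _ "k # Us"]) (auto simp: independent_Cons_iff)
        then have "Suc r \<le> r" unfolding r_def by (rule Greatest_le_nat[OF _ bound])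
        then show False by simp
      qed
    qed
    have "subalgebra ?F K R"
    proof (rule subalgebra.intro)
      show "subgroup K (add_monoid R)"
        using subring.axioms(1)[OF subfieldE(1)[OF subfield_K]] .
      show "subalgebra_axioms ?F K R" by (rule subalgebra_axioms.intro) (use center_K in auto)
    qed
    then show "Span ?F Us \<subseteq> K" using subalgebra_Span_incl[OF subfield_center] Us(2) by blast
  qed
  then have "dimension r ?F K" using dimensionI[OF subfield_center Us(3)] Us(1) by simp
  then have "dimension (r * m) ?F (carrier R)"
    by (rule telescopic_base[OF subfield_center subfield_K _ m(2)])
  moreover have "r * m \<le> d\<^sup>2"
    unfolding power2_eq_square using bound[OF Pr] m(1) xs(2) by (intro mult_le_mono) auto
  ultimately show ?thesis by blast
qed

end

subsection \<open>Multilinear identities\<close>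

text \<open>\<open>words A {} n\<close> indexes the expansion of the \<open>n\<close>-th power of a
  sum over \<open>A\<close>, and \<open>words {} B n\<close> with \<open>n = card B\<close> lists
  the arrangements of \<open>B\<close>. Polarization moves letters from \<open>A\<close> to
  \<open>B\<close>.\<close>

definition words :: "nat set \<Rightarrow> nat set \<Rightarrow> nat \<Rightarrow> nat list set" where
  "words A B n = {w. length w = n \<and> B \<subseteq> set w \<and> set w \<subseteq> A \<union> B}"

lemma finite_words: "finite A \<Longrightarrow> finite B \<Longrightarrow> finite (words A B n)"
  unfolding words_def
  by (rule finite_subset[OF _ finite_lists_length_eq[of "A \<union> B" n]]) auto

context ring
begin

text \<open>Letters act from left to right, so right multiplications by \<open>x j\<close> build up
  the product in the order of the word.\<close>

definition apply_word :: "(nat \<Rightarrow> 'a \<Rightarrow> 'a) \<Rightarrow> nat list \<Rightarrow> 'a \<Rightarrow> 'a" where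
  "apply_word T w v = foldl (\<lambda>u j. T j u) v w"

lemma apply_word_simps [simp]: "apply_word T [] v = v" "apply_word T (j # w) v = apply_word T w (T j v)"
  unfolding apply_word_def by simp_all

lemma K_linear_apply_word:
  assumes "\<And>j. K_linear K (T j)"
  shows "K_linear K (apply_word T w)"
proof (induction w)
  case Nil
  show ?case by (rule K_linearI) auto
next
  case (Cons j w)
  show ?case
    by (rule K_linearI) (simp_all add: K_linear_closed[OF Cons] K_linear_add[OF Cons] K_linear_smult[OF Cons]
      K_linear_closed[OF assms] K_linear_add[OF assms] K_linear_smult[OF assms])
qed

text \<open>The letter \<open>k\<close> occurs exactly once in \<open>w\<close>, so the value is
  linear in the operator at that place.\<close>

lemma apply_word_multilinear:
  assumes T: "\<And>j. K_linear K (T j)" and Y: "K_linear K Y" and Z: "K_linear K Z" and c: "c \<in> K" "K \<subseteq> carrier R"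
    and v: "v \<in> carrier R" and w: "distinct w" "k \<in> set w"
  shows "apply_word (T(k := \<lambda>v. c \<otimes> Y v \<oplus> Z v)) w v = c \<otimes> apply_word (T(k := Y)) w v \<oplus> apply_word (T(k := Z)) w v"
  using v w
proof (induction w arbitrary: v)
  case (Cons j w)
  show ?case
  proof (cases "j = k")
    case True
    then have k: "k \<notin> set w" using Cons.prems by simp
    have e: "apply_word (T(k := S)) w u = apply_word T w u" for S u
      using k by (induction w arbitrary: u) auto
    have "Y v \<in> carrier R" "Z v \<in> carrier R"
      using K_linear_closed[OF Y Cons.prems(1)] K_linear_closed[OF Z Cons.prems(1)] .
    moreover have "c \<otimes> Y v \<in> carrier R" using c calculation by auto
    ultimately show ?thesis
      by (simp only: True apply_word_simps fun_upd_same e K_linear_add[OF K_linear_apply_word[OF T]] K_linear_smult[OF K_linear_apply_word[OF T] c(1)])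
  next
    case False
    then have "k \<in> set w" using Cons.prems(3) by simp
    moreover have "T j v \<in> carrier R" using K_linear_closed[OF T] Cons.prems by simp
    ultimately show ?thesis using Cons.IH[of "T j v"] Cons.prems False by simp
  qed
qed simp

text \<open>The distributive law, by splitting off the first letter.\<close>

lemma words_empty_sum:
  assumes A: "finite A" and x: "\<And>j. j \<in> A \<Longrightarrow> x j \<in> carrier R" and v: "v \<in> carrier R"
  shows "(\<Oplus>w\<in>words A {} n. apply_word (\<lambda>j u. u \<otimes> x j) w v) = v \<otimes> (\<Oplus>j\<in>A. x j) [^] n"
  using v
proof (induction n arbitrary: v)
  case 0
  have "words A {} 0 = {[]}" unfolding words_def by auto
  then show ?case using 0 by simp
next
  case (Suc n)
  let ?f = "\<lambda>v w. apply_word (\<lambda>j u. u \<otimes> x j) w v" and ?W = "words A {} n"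
  have fc: "?f u w \<in> carrier R" if "u \<in> carrier R" "set w \<subseteq> A" for u w
    using that by (induction w arbitrary: u) (auto simp: x)
  have s: "(\<Oplus>j\<in>A. x j) \<in> carrier R" using x by (intro finsum_closed) auto
  have W: "words A {} (Suc n) = (\<Union>j\<in>A. (#) j ` ?W)"
  proof (rule Set.set_eqI)
    fix w show "w \<in> words A {} (Suc n) \<longleftrightarrow> w \<in> (\<Union>j\<in>A. (#) j ` ?W)"
      by (cases w) (auto simp: words_def)
  qed
  have "(\<Oplus>w\<in>words A {} (Suc n). ?f v w) = (\<Oplus>j\<in>A. \<Oplus>w\<in>(#) j ` ?W. ?f v w)"
    unfolding W
  proof (rule add.finprod_UN_disjoint)
    show "\<And>j. j \<in> A \<Longrightarrow> finite ((#) j ` ?W)" using finite_words[OF A, of "{}"] by simp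
    show "pairwise (\<lambda>i j. disjnt ((#) i ` ?W) ((#) j ` ?W)) A" by (auto simp: pairwise_def disjnt_def)
    show "\<And>j w. j \<in> A \<Longrightarrow> w \<in> (#) j ` ?W \<Longrightarrow> ?f v w \<in> carrier R"
      using fc[OF Suc.prems] by (auto simp: words_def simp del: apply_word_simps)
  qed (rule A)
  also have "\<dots> = (\<Oplus>j\<in>A. v \<otimes> x j \<otimes> (\<Oplus>j\<in>A. x j) [^] n)"
  proof (rule finsum_cong')
    fix j assume j: "j \<in> A"
    have "(\<Oplus>w\<in>(#) j ` ?W. ?f v w) = (\<Oplus>w\<in>?W. ?f v (j # w))"
    proof (rule finsum_reindex)
      show "?f v \<in> (#) j ` ?W \<rightarrow> carrier R"
        using fc[OF Suc.prems] j by (auto simp: words_def simp del: apply_word_simps)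
    qed simp
    also have "\<dots> = v \<otimes> x j \<otimes> (\<Oplus>j\<in>A. x j) [^] n"
      using Suc.IH[of "v \<otimes> x j"] Suc.prems x[OF j] by simp
    finally show "(\<Oplus>w\<in>(#) j ` ?W. ?f v w) = v \<otimes> x j \<otimes> (\<Oplus>j\<in>A. x j) [^] n" .
  qed (use Suc.prems x s in auto)
  also have "\<dots> = (\<Oplus>j\<in>A. v \<otimes> x j) \<otimes> (\<Oplus>j\<in>A. x j) [^] n"
    using A Suc.prems x s by (intro finsum_ldistr[symmetric]) auto
  also have "(\<Oplus>j\<in>A. v \<otimes> x j) = v \<otimes> (\<Oplus>j\<in>A. x j)"
    using A Suc.prems x by (intro finsum_rdistr[symmetric]) auto
  finally show ?case using Suc.prems s nat_pow_Suc2[OF s, of n] by (simp add: m_assoc)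
qed

text \<open>Sorting words by whether \<open>b\<close> occurs turns \<open>b\<close> from an allowed
  letter into a required one.\<close>

lemma words_insert_sum:
  assumes "finite A" "finite B" "b \<notin> A" "b \<notin> B" and f: "\<And>w. set w \<subseteq> insert b (A \<union> B) \<Longrightarrow> f w \<in> carrier R"
  shows "(\<Oplus>w\<in>words (insert b A) B n. f w) = (\<Oplus>w\<in>words A (insert b B) n. f w) \<oplus> (\<Oplus>w\<in>words A B n. f w)"
proof -
  have "words (insert b A) B n = words A (insert b B) n \<union> words A B n"
    unfolding words_def by auto
  moreover have "words A (insert b B) n \<inter> words A B n = {}"
    using assms(3,4) unfolding words_def by auto
  moreover have "f \<in> words A (insert b B) n \<rightarrow> carrier R" "f \<in> words A B n \<rightarrow> carrier R"
    unfolding words_def by (intro Pi_I f; blast)+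
  ultimately show ?thesis
    using finsum_Un_disjoint[of "words A (insert b B) n" "words A B n" f] assms(1,2) finite_words by simp
qed

end

context max_subfield
begin

lemma commutators_finsum:
  assumes "finite A" "\<And>j. j \<in> A \<Longrightarrow> x j \<in> commutators"
  shows "(\<Oplus>j\<in>A. x j) \<in> commutators"
  using assms
proof (induction A)
  case empty
  show ?case using commutators_zero by simp
next
  case (insert j A)
  have "(\<Oplus>j\<in>insert j A. x j) = x j \<oplus> (\<Oplus>j\<in>A. x j)"
    using insert commutators_carrier by (intro finsum_insert) auto
  then show ?case using insert commutators_add by simp
qed

text \<open>The power identity is applied to sums of the \<open>x j\<close>, which are commutators
  again. Requiring one more letter \<open>b\<close> amounts to subtracting the identity over
  \<open>A\<close> from the one over \<open>insert b A\<close>.\<close>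

lemma polarize:
  assumes pow: "\<And>y. y \<in> commutators \<Longrightarrow> y [^] M = y" and x: "\<And>j. x j \<in> commutators" and v: "v \<in> carrier R"
    and "finite B" "finite A" "A \<inter> B = {}"
  shows "(\<Oplus>w\<in>words A B M. apply_word (\<lambda>j u. u \<otimes> x j) w v) = (\<Oplus>w\<in>words A B 1. apply_word (\<lambda>j u. u \<otimes> x j) w v)"
  using assms(4-6)
proof (induction B arbitrary: A)
  case empty
  have xc: "x j \<in> carrier R" for j using x commutators_carrier by blast
  have s: "(\<Oplus>j\<in>A. x j) \<in> commutators" by (rule commutators_finsum[OF empty(1) x])
  show ?case unfolding words_empty_sum[OF empty(1) xc v] using pow[OF s] s commutators_carrier by simp
next
  case (insert b B)
  let ?f = "\<lambda>w. apply_word (\<lambda>j u. u \<otimes> x j) w v"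
  have xc: "x j \<in> carrier R" for j using x commutators_carrier by blast
  have fc: "?f w \<in> carrier R" for w using v by (induction w arbitrary: v) (auto simp: xc)
  have b: "b \<notin> A" "A \<inter> B = {}" using insert.prems by auto
  have e: "(\<Oplus>w\<in>words (insert b A) B n. ?f w) = (\<Oplus>w\<in>words A (insert b B) n. ?f w) \<oplus> (\<Oplus>w\<in>words A B n. ?f w)" for n
    by (rule words_insert_sum[OF insert.prems(1) insert.hyps(1) b(1) insert.hyps(2) fc])
  have "(\<Oplus>w\<in>words (insert b A) B M. ?f w) = (\<Oplus>w\<in>words (insert b A) B 1. ?f w)"
    by (rule insert.IH) (use insert b in auto)
  moreover have "(\<Oplus>w\<in>words A B M. ?f w) = (\<Oplus>w\<in>words A B 1. ?f w)"
    by (rule insert.IH) (use insert b in auto)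
  moreover have "(\<Oplus>w\<in>words A C n. ?f w) \<in> carrier R" for C n using fc by (intro finsum_closed) auto
  ultimately show ?case unfolding e by (metis add.right_cancel)
qed

text \<open>With \<open>M\<close> required letters and length \<open>M\<close> the words are
  permutations, while no word of length \<open>1\<close> contains \<open>M \<ge> 2\<close> letters,
  so the right side of \<open>polarize\<close> is empty. As the identity is linear in each letter,
  right multiplications can be replaced by operators one letter at a time.\<close>

lemma multilinear_identity:
  assumes pow: "\<And>y. y \<in> commutators \<Longrightarrow> y [^] M = y" and M: "2 \<le> M"
    and qs: "\<And>j. set (qs j) \<subseteq> K \<times> commutators" and v: "v \<in> carrier R"
  shows "(\<Oplus>w\<in>words {} {..<M} M. apply_word (\<lambda>j. sandwich (qs j)) w v) = \<zero>"
proof -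
  let ?W = "words {} {..<M} M"
  have fW: "finite ?W" by (rule finite_words) auto
  have W: "distinct w" "k < M \<longrightarrow> k \<in> set w" if "w \<in> ?W" for w k
  proof -
    have e: "length w = M" "set w = {..<M}" using that unfolding words_def by auto
    then have "card (set w) = length w" by simp
    then show "distinct w" by (rule card_distinct)
    show "k < M \<longrightarrow> k \<in> set w" unfolding e by simp
  qed
  have linq: "K_linear K (sandwich ps)" if "set ps \<subseteq> K \<times> commutators" for ps
    by (rule K_linear_sandwich) (use that commutators_carrier in auto)
  have linx: "K_linear K (\<lambda>u. u \<otimes> x)" if "x \<in> commutators" for x
    by (rule K_linearI) (use commutators_carrier[OF that] in \<open>auto simp: l_distr m_assoc\<close>)
  \<comment> \<open>The letters below \<open>k\<close> are operators already, the others still right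
    multiplications by arbitrary commutators. Keeping \<open>x\<close> arbitrary lets each summand
    of the next operator use the induction hypothesis.\<close>
  have main: "(\<Oplus>w\<in>?W. apply_word (\<lambda>j. if j < k then sandwich (qs j) else (\<lambda>u. u \<otimes> x j)) w v) = \<zero>"
    if "k \<le> M" "\<And>j. x j \<in> commutators" for k x
    using that
  proof (induction k arbitrary: x)
    case 0
    have "words {} {..<M} 1 = {}"
    proof -
      have "card {..<M} \<le> 1" if "w \<in> words {} {..<M} 1" for w
        using that card_length[of w] card_mono[of "set w" "{..<M}"] unfolding words_def by auto
      then show ?thesis using M by auto
    qed
    then show ?case using polarize[OF pow 0(2) v, of "{..<M}" "{}"] by simp
  next
    case (Suc k)
    define T where "T j = (if j < k then sandwich (qs j) else (\<lambda>u. u \<otimes> x j))" for j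
    have T: "K_linear K (T j)" for j unfolding T_def using linq qs linx Suc.prems by simp
    have Tk: "(\<lambda>j. if j < Suc k then sandwich (qs j) else (\<lambda>u. u \<otimes> x j)) = T(k := sandwich (qs k))"
      unfolding T_def by (auto simp: less_Suc_eq)
    have closed: "apply_word (T(k := Y)) w v \<in> carrier R" if "K_linear K Y" for Y w
    proof -
      have "K_linear K ((T(k := Y)) j)" for j using T that by simp
      then show ?thesis by (rule K_linear_closed[OF K_linear_apply_word v])
    qed
    have "(\<Oplus>w\<in>?W. apply_word (T(k := sandwich ps)) w v) = \<zero>" if "set ps \<subseteq> K \<times> commutators" for ps
      using that
    proof (induction ps)
      case Nil
      have 0: "apply_word (T(k := (\<lambda>_. \<zero>))) w v = \<zero>" if "w \<in> ?W" for w
      proof -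
        have z: "K_linear K (\<lambda>_. \<zero>)" by (rule K_linearI) auto
        have "apply_word (T(k := \<lambda>v. \<one> \<otimes> \<zero> \<oplus> \<zero>)) w v = \<one> \<otimes> apply_word (T(k := (\<lambda>_. \<zero>))) w v \<oplus> apply_word (T(k := (\<lambda>_. \<zero>))) w v"
          by (rule apply_word_multilinear[OF T z z _ K_sub v W(1)[OF that] W(2)[OF that, rule_format]]) (use Suc.prems in auto)
        then have "apply_word (T(k := \<lambda>v. \<zero>)) w v = apply_word (T(k := (\<lambda>_. \<zero>))) w v \<oplus> apply_word (T(k := (\<lambda>_. \<zero>))) w v"
          using closed[OF z, of w] by simp
        then show ?thesis using closed[OF z, of w] by (metis add.r_cancel_one')
      qed
      have "sandwich [] = (\<lambda>_. \<zero>)" by auto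
      then show ?case by (simp only:) (intro add.finprod_one_eqI 0)
    next
      case (Cons cx ps)
      obtain c y where cx: "cx = (c, y)" by (cases cx)
      have c: "c \<in> K" "y \<in> commutators" "set ps \<subseteq> K \<times> commutators" using Cons.prems cx by auto
      have yc: "y \<in> carrier R" using commutators_carrier c by blast
      have "apply_word (T(k := sandwich (cx # ps))) w v = c \<otimes> apply_word (T(k := (\<lambda>u. u \<otimes> y))) w v \<oplus> apply_word (T(k := sandwich ps)) w v"
        if "w \<in> ?W" for w
      proof -
        have "apply_word (T(k := \<lambda>v. c \<otimes> (v \<otimes> y) \<oplus> sandwich ps v)) w v =
            c \<otimes> apply_word (T(k := (\<lambda>u. u \<otimes> y))) w v \<oplus> apply_word (T(k := sandwich ps)) w v"
          by (rule apply_word_multilinear[OF T linx[OF c(2)] linq[OF c(3)] c(1) K_sub v W(1)[OF that] W(2)[OF that, rule_format]])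
            (use Suc.prems in auto)
        moreover have "apply_word (T(k := \<lambda>v. c \<otimes> (v \<otimes> y) \<oplus> sandwich ps v)) w v = apply_word (T(k := sandwich (cx # ps))) w v"
        proof -
          have "u \<in> carrier R \<Longrightarrow> apply_word (T(k := \<lambda>v. c \<otimes> (v \<otimes> y) \<oplus> sandwich ps v)) w u = apply_word (T(k := sandwich (cx # ps))) w u" for u
          proof (induction w arbitrary: u)
            case (Cons j w)
            show ?case
            proof (cases "j = k")
              case True
              have "c \<otimes> (u \<otimes> y) \<oplus> sandwich ps u = sandwich (cx # ps) u" using cx c yc Cons.prems by (simp add: m_assoc)
              moreover have "sandwich (cx # ps) u \<in> carrier R"
                by (rule K_linear_closed[OF linq]) (use \<open>set (cx # ps) \<subseteq> K \<times> commutators\<close> Cons.prems in auto)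
              ultimately show ?thesis using True Cons.IH[of "sandwich (cx # ps) u"] by (simp del: sandwich.simps)
            next
              case False
              then show ?thesis using Cons.IH[of "T j u"] K_linear_closed[OF T Cons.prems] by simp
            qed
          qed simp
          then show ?thesis using v by simp
        qed
        ultimately show ?thesis by simp
      qed
      then have "(\<Oplus>w\<in>?W. apply_word (T(k := sandwich (cx # ps))) w v) =
          (\<Oplus>w\<in>?W. c \<otimes> apply_word (T(k := (\<lambda>u. u \<otimes> y))) w v \<oplus> apply_word (T(k := sandwich ps)) w v)"
        using closed[OF linx[OF c(2)]] closed[OF linq[OF c(3)]] c(1) by (intro finsum_cong') auto
      also have "\<dots> = (\<Oplus>w\<in>?W. c \<otimes> apply_word (T(k := (\<lambda>u. u \<otimes> y))) w v) \<oplus> (\<Oplus>w\<in>?W. apply_word (T(k := sandwich ps)) w v)"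
        using closed[OF linx[OF c(2)]] closed[OF linq[OF c(3)]] c(1) by (intro finsum_addf) auto
      also have "(\<Oplus>w\<in>?W. c \<otimes> apply_word (T(k := (\<lambda>u. u \<otimes> y))) w v) = c \<otimes> (\<Oplus>w\<in>?W. apply_word (T(k := (\<lambda>u. u \<otimes> y))) w v)"
        using closed[OF linx[OF c(2)]] c(1) fW by (intro finsum_rdistr[symmetric]) auto
      also have "(\<Oplus>w\<in>?W. apply_word (T(k := (\<lambda>u. u \<otimes> y))) w v) = \<zero>"
      proof -
        have "T(k := (\<lambda>u. u \<otimes> y)) = (\<lambda>j. if j < k then sandwich (qs j) else (\<lambda>u. u \<otimes> (x(k := y)) j))"
          unfolding T_def by auto
        then show ?thesis using Suc.IH[of "x(k := y)"] Suc.prems c(2) by simp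
      qed
      also have "(\<Oplus>w\<in>?W. apply_word (T(k := sandwich ps)) w v) = \<zero>" by (rule Cons.IH[OF c(3)])
      finally show ?case using c by simp
    qed
    then show ?case unfolding Tk using qs by blast
  qed
  have "(\<Oplus>w\<in>?W. apply_word (\<lambda>j. sandwich (qs j)) w v) =
      (\<Oplus>w\<in>?W. apply_word (\<lambda>j. if j < M then sandwich (qs j) else (\<lambda>u. u \<otimes> \<zero>)) w v)"
  proof (rule finsum_cong')
    fix w assume "w \<in> ?W"
    then have "set w \<subseteq> {..<M}" unfolding words_def by auto
    then show "apply_word (\<lambda>j. sandwich (qs j)) w v = apply_word (\<lambda>j. if j < M then sandwich (qs j) else (\<lambda>u. u \<otimes> \<zero>)) w v"
      by (induction w arbitrary: v) auto
  next
    have "K_linear K (if j < M then sandwich (qs j) else (\<lambda>u. u \<otimes> \<zero>))" for j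
      using linq qs linx[OF commutators_zero] by simp
    then show "(\<lambda>w. apply_word (\<lambda>j. if j < M then sandwich (qs j) else (\<lambda>u. u \<otimes> \<zero>)) w v) \<in> ?W \<rightarrow> carrier R"
      using K_linear_closed[OF K_linear_apply_word v, of K "\<lambda>j. if j < M then sandwich (qs j) else (\<lambda>u. u \<otimes> \<zero>)"] by blast
  qed simp
  then show ?thesis using main[of M "\<lambda>_. \<zero>"] commutators_zero by simp
qed

text \<open>With \<open>M + 1\<close> pairs there are brackets that send \<open>u i\<close> to
  \<open>u (i + 1)\<close> and the other \<open>u j\<close> to \<open>\<zero>\<close>. Among all
  permutations, applied to \<open>u 0\<close>, only the increasing one survives. Its value
  \<open>u M\<close> is nonzero, against \<open>multilinear_identity\<close>.\<close>

lemma not_dim_ge_power: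
  assumes pow: "\<And>y. y \<in> commutators \<Longrightarrow> y [^] M = y" and M: "2 \<le> M"
  shows "\<not> dim_ge (2 * Suc M)"
proof
  assume "dim_ge (2 * Suc M)"
  then obtain u where g: "indep_pairs \<zero> u (Suc M)" using exists_indep_pairs by blast
  let ?m = "Suc M"
  let ?f = "pairs_fun \<zero> u ?m"
  have u: "u i \<in> carrier R" if "i \<le> M" for i using indep_pairsD(1)[OF g] that by simp
  have ind: "independent K (family ?f (?m + ?m))" by (rule indep_pairs_independent[OF _ g]) simp
  have "\<exists>ps. set ps \<subseteq> K \<times> carrier R \<and> (\<forall>j\<le>M. sandwich (bracket ps) (u j) = (if j = i then u (Suc i) else \<zero>))"
    if i: "i < M" for i
  proof -
    \<comment> \<open>\<open>T\<close> is nonzero at \<open>u i a\<close> alone, listed at position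
      \<open>?m + i\<close>; the bracket undoes the sign.\<close>
    define c where "c l = (if l = ?m + i then \<ominus> u (Suc i) else \<zero>)" for l
    have cc: "\<forall>l<?m+?m. c l \<in> carrier R" unfolding c_def using u i by auto
    have "set [] \<subseteq> carrier R" by simp
    then obtain ps where ps: "set ps \<subseteq> K \<times> carrier R" "\<forall>j<?m+?m. sandwich ps (?f j) = c j"
      by (rule density_K[OF ind cc])
    have "sandwich (bracket ps) (u j) = (if j = i then u (Suc i) else \<zero>)" if j: "j \<le> M" for j
    proof -
      have 1: "sandwich ps (u j) = \<zero>" using ps(2)[rule_format, of j] j i by (simp add: pairs_fun_def c_def)
      have 2: "sandwich ps (eigen_shift \<zero> (u j)) = c (?m + j)"
        using ps(2)[rule_format, of "?m + j"] j by (simp add: pairs_fun_def)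
      have "eigen_shift \<zero> \<zero> = \<zero>" by (rule K_linear_zero[OF K_linear_eigen_shift]) simp
      then have "sandwich (bracket ps) (u j) = \<zero> \<ominus> c (?m + j)"
        using sandwich_bracket_shift[OF ps(1) u[OF j], of \<zero>] 1 2 by simp
      then show ?thesis using u[of "Suc i"] i by (simp add: c_def a_minus_def)
    qed
    then show ?thesis using ps(1) by blast
  qed
  then obtain P where P: "\<And>i. i < M \<Longrightarrow> set (P i) \<subseteq> K \<times> carrier R"
      "\<And>i j. i < M \<Longrightarrow> j \<le> M \<Longrightarrow> sandwich (bracket (P i)) (u j) = (if j = i then u (Suc i) else \<zero>)" by metis
  define qs where "qs j = (if j < M then bracket (P j) else [])" for j
  have qs: "set (qs j) \<subseteq> K \<times> commutators" for j
    unfolding qs_def using bracket_commutators P(1) by auto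
  have linq: "K_linear K (sandwich (qs j))" for j
    by (rule K_linear_sandwich) (use qs[of j] commutators_carrier in auto)
  have val: "apply_word (\<lambda>j. sandwich (qs j)) w (u i) = (if w = [i..<i + length w] then u (i + length w) else \<zero>)"
    if "i + length w \<le> M" "set w \<subseteq> {..<M}" for w i
    using that
  proof (induction w arbitrary: i)
    case (Cons j w)
    have j: "j < M" "i \<le> M" "i < i + length (j # w)" using Cons.prems by auto
    have e: "[i..<i + length (j # w)] = i # [Suc i..<Suc i + length w]"
      using upt_conv_Cons[OF j(3)] by simp
    have q: "sandwich (qs j) (u i) = (if i = j then u (Suc j) else \<zero>)"
      unfolding qs_def using P(2)[OF j(1,2)] j by simp
    show ?case
    proof (cases "i = j")
      case True
      then show ?thesis using Cons.IH[of "Suc i"] Cons.prems q e by auto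
    next
      case False
      then have "apply_word (\<lambda>j. sandwich (qs j)) (j # w) (u i) = apply_word (\<lambda>j. sandwich (qs j)) w \<zero>" using q by simp
      also have "\<dots> = \<zero>" by (rule K_linear_zero[OF K_linear_apply_word[OF linq]])
      finally show ?thesis using False e by auto
    qed
  qed simp
  let ?W = "words {} {..<M} M"
  have "(\<Oplus>w\<in>?W. apply_word (\<lambda>j. sandwich (qs j)) w (u 0)) = (\<Oplus>w\<in>?W. if [0..<M] = w then u M else \<zero>)"
  proof (rule finsum_cong')
    fix w assume "w \<in> ?W"
    then have "length w = M" "set w \<subseteq> {..<M}" unfolding words_def by auto
    then show "apply_word (\<lambda>j. sandwich (qs j)) w (u 0) = (if [0..<M] = w then u M else \<zero>)"
      using val[of 0 w] by auto
  qed (use u in auto)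
  also have "\<dots> = u M"
  proof -
    have "[0..<M] \<in> ?W" unfolding words_def by auto
    moreover have "finite ?W" by (rule finite_words) auto
    ultimately show ?thesis using finsum_singleton[of "[0..<M]" ?W "\<lambda>_. u M"] u by simp
  qed
  also have "(\<Oplus>w\<in>?W. apply_word (\<lambda>j. sandwich (qs j)) w (u 0)) = \<zero>"
    by (rule multilinear_identity[OF pow M qs]) (use u in auto)
  finally have "u M = \<zero>" by simp
  moreover have "?f M \<noteq> \<zero>"
  proof -
    have i: "independent K (family ?f (Suc M))" by (rule independent_family_mono[OF ind]) simp
    have "set (family ?f M) \<subseteq> carrier R" using independent_in_carrier[OF i] by simp
    then have "\<zero> \<in> Span K (family ?f M)" by (rule Span_K(2))
    then show ?thesis using i by (auto simp: independent_Cons_iff)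
  qed
  ultimately show False by (simp add: pairs_fun_def)
qed

end

subsection \<open>Finite division rings\<close>

lemma (in ring) lincomb_zero_right:
  "(\<And>i. i < n \<Longrightarrow> \<alpha> i \<in> carrier R) \<Longrightarrow> (\<And>i. i < n \<Longrightarrow> f i = \<zero>) \<Longrightarrow> lincomb \<alpha> f n = \<zero>"
  by (induction n) auto

context skew_field
begin

lemma finite_pow_one:
  assumes "finite (carrier R)" "y \<in> carrier R" "y \<noteq> \<zero>"
  shows "\<exists>n>0. y [^] (n::nat) = \<one>"
proof -
  have nz: "y [^] (n::nat) \<noteq> \<zero>" for n using assms by (induction n) auto
  have "\<not> inj (\<lambda>n::nat. y [^] n)"
  proof
    assume "inj (\<lambda>n::nat. y [^] n)"
    then have "infinite (range (\<lambda>n::nat. y [^] n))" by (simp add: finite_image_iff)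
    moreover have "range (\<lambda>n::nat. y [^] n) \<subseteq> carrier R" using assms by auto
    ultimately show False using assms(1) finite_subset by blast
  qed
  then obtain i j :: nat where "i \<noteq> j" "y [^] i = y [^] j" unfolding inj_def by blast
  then obtain i j :: nat where ij: "i < j" "y [^] i = y [^] j" by (metis nat_neq_iff)
  have "y [^] i \<otimes> y [^] (j - i) = y [^] (i + (j - i))" by (rule nat_pow_mult[OF assms(2)])
  also have "\<dots> = y [^] i \<otimes> \<one>" using ij assms(2) by simp
  finally have "y [^] i \<otimes> y [^] (j - i) = y [^] i \<otimes> \<one>" .
  then have "y [^] i \<otimes> (y [^] (j - i) \<ominus> \<one>) = \<zero>"
    using assms(2) by (simp add: a_minus_def r_distr r_minus r_neg)
  then have "y [^] (j - i) = \<one>" using nz[of i] assms(2) by (simp add: minus_eq_zero_iff)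
  then show ?thesis using ij by (intro exI[of _ "j - i"]) simp
qed

lemma pow_nonzero: "y \<in> carrier R \<Longrightarrow> y \<noteq> \<zero> \<Longrightarrow> y [^] (n::nat) \<noteq> \<zero>"
  by (induction n) auto

lemma geometric_sum:
  assumes "z \<in> carrier R"
  shows "(z \<ominus> \<one>) \<otimes> lincomb (\<lambda>_. \<one>) (\<lambda>i. z [^] i) n = z [^] n \<ominus> \<one>"
proof (induction n)
  case 0
  show ?case using assms by (simp add: a_minus_def r_neg)
next
  case (Suc n)
  let ?s = "lincomb (\<lambda>_. \<one>) (\<lambda>i. z [^] i) n"
  have c: "?s \<in> carrier R" "z [^] n \<in> carrier R" using assms by auto
  have "(z \<ominus> \<one>) \<otimes> (s \<oplus> p) = (z \<ominus> \<one>) \<otimes> s \<oplus> (z \<otimes> p \<ominus> p)" if "s \<in> carrier R" "p \<in> carrier R" for s p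
    using that assms by algebra
  then have "(z \<ominus> \<one>) \<otimes> (?s \<oplus> z [^] n) = (z [^] n \<ominus> \<one>) \<oplus> (z \<otimes> z [^] n \<ominus> z [^] n)"
    using Suc c by simp
  also have "\<dots> = z \<otimes> z [^] n \<ominus> \<one>"
  proof -
    have "(p \<ominus> \<one>) \<oplus> (q \<ominus> p) = q \<ominus> \<one>" if "p \<in> carrier R" "q \<in> carrier R" for p q
      using that one_closed by algebra
    then show ?thesis using c assms by simp
  qed
  also have "z \<otimes> z [^] n = z [^] Suc n" using nat_pow_Suc2[OF assms, of n] by simp
  finally show ?case using c by simp
qed

end

context max_subfield
begin

text \<open>Shifting \<open>j\<close> by one and subtracting \<open>\<mu> r\<close> times the
  original sum removes the last term and multiplies each other \<open>x i\<close> by the nonzero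
  \<open>\<mu> i - \<mu> r\<close>.\<close>

lemma vandermonde:
  assumes "\<And>i. i < r \<Longrightarrow> \<mu> i \<in> K" "\<And>i j. i < r \<Longrightarrow> j < r \<Longrightarrow> \<mu> i = \<mu> j \<Longrightarrow> i = j"
    "\<And>i. i < r \<Longrightarrow> x i \<in> carrier R" "\<And>j::nat. lincomb (\<lambda>i. \<mu> i [^] j) x r = \<zero>" "i < r"
  shows "x i = \<zero>"
  using assms
proof (induction r arbitrary: x i)
  case (Suc r)
  have mc: "\<mu> i \<in> carrier R" if "i < Suc r" for i using Suc.prems(1)[OF that] by simp
  have xc: "x i \<in> carrier R" if "i < Suc r" for i using Suc.prems(3)[OF that] .
  define y where "y i = (\<mu> i \<ominus> \<mu> r) \<otimes> x i" for i
  have pair_comb: "lincomb (\<lambda>i. \<mu> i [^] j) y m = lincomb (\<lambda>i. \<mu> i [^] Suc j) x m \<ominus> \<mu> r \<otimes> lincomb (\<lambda>i. \<mu> i [^] j) x m"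
    if "m \<le> r" for m and j :: nat
    using that
  proof (induction m)
    case 0
    show ?case using mc by (simp add: a_minus_def)
  next
    case (Suc m)
    have c: "\<mu> m \<in> carrier R" "\<mu> r \<in> carrier R" "x m \<in> carrier R" "\<mu> m [^] j \<in> carrier R"
      using mc xc Suc.prems by auto
    have l: "lincomb (\<lambda>i. \<mu> i [^] Suc j) x m \<in> carrier R" "lincomb (\<lambda>i. \<mu> i [^] j) x m \<in> carrier R"
      using mc xc Suc.prems by (auto simp del: nat_pow_Suc)
    have pK: "\<mu> m [^] j \<in> K" for j :: nat
      using Suc.prems \<open>\<And>i. i < Suc r \<Longrightarrow> \<mu> i \<in> K\<close> by (induction j) auto
    have com: "\<mu> m [^] j \<otimes> \<mu> r = \<mu> r \<otimes> \<mu> m [^] j"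
      using K_comm[OF pK] \<open>\<And>i. i < Suc r \<Longrightarrow> \<mu> i \<in> K\<close> by simp
    have d: "p \<otimes> ((m' \<ominus> s) \<otimes> x') = (p \<otimes> m') \<otimes> x' \<ominus> (p \<otimes> s) \<otimes> x'"
      if "p \<in> carrier R" "m' \<in> carrier R" "s \<in> carrier R" "x' \<in> carrier R" for p m' s x'
      using that by algebra
    have e: "\<mu> m [^] j \<otimes> y m = \<mu> m [^] Suc j \<otimes> x m \<ominus> \<mu> r \<otimes> (\<mu> m [^] j \<otimes> x m)"
      unfolding y_def d[OF c(4,1,2,3)] com using c by (simp add: m_assoc)
    have "(A \<ominus> s \<otimes> B) \<oplus> (C \<ominus> s \<otimes> E) = (A \<oplus> C) \<ominus> s \<otimes> (B \<oplus> E)"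
      if "A \<in> carrier R" "B \<in> carrier R" "C \<in> carrier R" "E \<in> carrier R" "s \<in> carrier R" for A B C E s
      using that by algebra
    then show ?case unfolding lincomb.simps using Suc.IH Suc.prems e l c by simp
  qed
  have r: "\<mu> r \<in> carrier R" "x r \<in> carrier R" using mc xc by auto
  have "lincomb (\<lambda>i. \<mu> i [^] j) y r = \<zero>" for j :: nat
  proof -
    have l: "lincomb (\<lambda>i. \<mu> i [^] j) x r \<in> carrier R" for j :: nat using mc xc by auto
    have p: "\<mu> r [^] j \<otimes> x r \<in> carrier R" for j :: nat using r by auto
    have z: "lincomb (\<lambda>i. \<mu> i [^] j) x r = \<ominus> (\<mu> r [^] j \<otimes> x r)" for j :: nat
      using Suc.prems(4)[of j] minus_equality[OF _ p l, of j j] by simp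
    have "\<mu> r \<otimes> (\<mu> r [^] j \<otimes> x r) = \<mu> r [^] Suc j \<otimes> x r"
      using r nat_pow_Suc2[OF r(1), of j] by (simp add: m_assoc)
    then show ?thesis unfolding pair_comb[OF order_refl] z[of "Suc j"] z[of j] using r p[of j] p[of "Suc j"]
      by (simp add: a_minus_def r_minus l_neg)
  qed
  note ys = this
  have y0: "y i = \<zero>" if i: "i < r" for i
  proof (rule Suc.IH[OF _ _ _ ys i])
    show "\<mu> i \<in> K" if "i < r" for i using Suc.prems(1)[of i] that by simp
    show "i = j" if "i < r" "j < r" "\<mu> i = \<mu> j" for i j using Suc.prems(2)[of i j] that by simp
    show "y i \<in> carrier R" if "i < r" for i unfolding y_def using mc[of i] mc[of r] xc[of i] that by simp
  qed
  have x0: "x i = \<zero>" if i: "i < r" for i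
  proof -
    have "\<mu> i \<noteq> \<mu> r" using Suc.prems(2)[of i r] i by auto
    then have "\<mu> i \<ominus> \<mu> r \<noteq> \<zero>" using mc i by (simp add: minus_eq_zero_iff)
    then show ?thesis using y0[OF i] mc[of i] mc[of r] xc[of i] i unfolding y_def by simp
  qed
  have "lincomb (\<lambda>i. \<mu> i [^] (0::nat)) x r = \<zero>"
    by (rule lincomb_zero_right) (use x0 mc in auto)
  then have "x r = \<zero>" using Suc.prems(4)[of 0] r by simp
  then show ?case using x0 Suc.prems(5) by (auto simp: less_Suc_eq)
qed simp

lemma generator:
  assumes "finite K"
  obtains \<theta> where "\<theta> \<in> K" "\<theta> \<noteq> \<zero>" "\<forall>k\<in>K. k \<noteq> \<zero> \<longrightarrow> (\<exists>i::nat. k = \<theta> [^] i)"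
    "\<forall>k\<in>K. k \<noteq> \<zero> \<longrightarrow> k [^] card (K - {\<zero>}) = \<one>"
proof -
  interpret F: field "R\<lparr>carrier := K\<rparr>" using subfield_iff(2)[OF subfield_K] .
  have pw: "x [^]\<^bsub>R\<lparr>carrier := K\<rparr>\<^esub> (n::nat) = x [^] n" for x n
    by (simp add: nat_pow_def)
  interpret G: group "Multiplicative_Group.mult_of (R\<lparr>carrier := K\<rparr>)" by (rule F.field_mult_group)
  have fin: "finite (carrier (R\<lparr>carrier := K\<rparr>))" using assms by simp
  obtain \<theta> where t: "\<theta> \<in> K - {\<zero>}" "K - {\<zero>} = {\<theta> [^] i | i::nat. i \<in> UNIV}"
    using F.finite_field_mult_group_has_gen[OF fin] by (auto simp: pw)
  have 1: "\<forall>k\<in>K. k \<noteq> \<zero> \<longrightarrow> (\<exists>i::nat. k = \<theta> [^] i)" using t(2) by blast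
  have "k [^] card (K - {\<zero>}) = \<one>" if "k \<in> K" "k \<noteq> \<zero>" for k
    using G.pow_order_eq_1[of k] that by (simp add: order_def pw Multiplicative_Group.mult_of_simps)
  then show thesis using that t(1) 1 by blast
qed

text \<open>Let \<open>N\<close> be the order of the unit group of \<open>K\<close>. The sum
  \<open>Y t w N\<close> of the terms \<open>t^i w \<theta>^i\<close> with \<open>i < N\<close>
  satisfies \<open>t Y \<theta> = Y\<close>, so it is an eigenvector for \<open>l = inv t\<close>,
  if nonzero. If it vanished whenever \<open>inv t \<noteq> \<theta>\<close>, then for
  \<open>w' = w \<theta> - \<theta> w\<close> the sum \<open>Y t w' N\<close> would vanish for every
  nonzero \<open>t\<close>. As a polynomial in \<open>t\<close> it has \<open>N\<close> coefficients
  and \<open>N\<close> roots, so its constant coefficient \<open>w'\<close> would be zero.\<close>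

lemma eigenvector:
  assumes fin: "finite K" and \<theta>: "\<theta> \<in> K" "\<theta> \<noteq> \<zero>" and one: "\<forall>k\<in>K. k \<noteq> \<zero> \<longrightarrow> k [^] card (K - {\<zero>}) = \<one>"
    and w: "w \<in> carrier R" "w \<otimes> \<theta> \<noteq> \<theta> \<otimes> w"
  obtains y l where "y \<in> carrier R" "y \<noteq> \<zero>" "l \<in> K" "l \<noteq> \<theta>" "y \<otimes> \<theta> = l \<otimes> y"
proof -
  define N where "N = card (K - {\<zero>})"
  have tc: "\<theta> \<in> carrier R" using \<theta> by simp
  define Y where "Y t w n = lincomb (\<lambda>i. t [^] i) (\<lambda>i. w \<otimes> \<theta> [^] i) n" for t w and n :: nat
  have Yc: "Y t w n \<in> carrier R" if "t \<in> carrier R" "w \<in> carrier R" for t w n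
    unfolding Y_def using that tc by auto
  \<comment> \<open>Multiplying by \<open>t\<close> on the left and \<open>\<theta>\<close> on the
    right shifts the summation index by one. The end terms cancel once
    \<open>t^N = \<theta>^N = 1\<close>.\<close>
  have shift: "t \<otimes> Y t w n \<otimes> \<theta> \<oplus> w = Y t w n \<oplus> t [^] n \<otimes> (w \<otimes> \<theta> [^] n)"
    if t: "t \<in> carrier R" "w \<in> carrier R" for t w n
  proof (induction n)
    case 0
    show ?case unfolding Y_def using t tc by simp
  next
    case (Suc n)
    let ?p = "t [^] n \<otimes> (w \<otimes> \<theta> [^] n)"
    have p: "?p \<in> carrier R" using t tc by simp
    have tp: "t \<otimes> ?p \<otimes> \<theta> = t [^] Suc n \<otimes> (w \<otimes> \<theta> [^] Suc n)"
      using t tc nat_pow_Suc2[OF t(1), of n] by (simp add: m_assoc)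
    have Y': "Y t w (Suc n) = Y t w n \<oplus> ?p" unfolding Y_def by simp
    have "t \<otimes> Y t w (Suc n) \<otimes> \<theta> \<oplus> w = (t \<otimes> Y t w n \<otimes> \<theta> \<oplus> w) \<oplus> t \<otimes> ?p \<otimes> \<theta>"
      unfolding Y' using t tc p Yc[OF t, of n] by (simp add: l_distr r_distr a_ac)
    also have "\<dots> = (Y t w n \<oplus> ?p) \<oplus> t \<otimes> ?p \<otimes> \<theta>" unfolding Suc ..
    finally show ?case unfolding tp Y' .
  qed
  have eig: "t \<otimes> Y t w N \<otimes> \<theta> = Y t w N" if t: "t \<in> K" "t \<noteq> \<zero>" and w: "w \<in> carrier R" for t w
  proof -
    have "t [^] N = \<one>" "\<theta> [^] N = \<one>" using one t \<theta> unfolding N_def by auto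
    then have "t \<otimes> Y t w N \<otimes> \<theta> \<oplus> w = Y t w N \<oplus> w" using shift[of t w N] t w by simp
    then show ?thesis using Yc[of t w N] t w tc by simp
  qed
  have horner: "horner (map (\<lambda>i. w \<otimes> \<theta> [^] i) [0..<N]) t = Y t w N" if t: "t \<in> carrier R" "w \<in> carrier R" for t w
  proof -
    have "horner (map (\<lambda>i. w \<otimes> \<theta> [^] (i + m)) [0..<n]) t = lincomb (\<lambda>i. t [^] i) (\<lambda>i. w \<otimes> \<theta> [^] (i + m)) n" for n m :: nat
    proof (induction n arbitrary: m)
      case (Suc n)
      let ?g = "\<lambda>i::nat. w \<otimes> \<theta> [^] (i + m)"
      have gc: "?g i \<in> carrier R" for i using t tc by simp
      have "[0..<Suc n] = 0 # map Suc [0..<n]" by (simp add: upt_conv_Cons map_Suc_upt)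
      then have "horner (map ?g [0..<Suc n]) t = ?g 0 \<oplus> t \<otimes> horner (map (\<lambda>i. w \<otimes> \<theta> [^] (i + Suc m)) [0..<n]) t"
        by (simp add: o_def del: upt_Suc nat_pow_Suc)
      also have "\<dots> = ?g 0 \<oplus> t \<otimes> lincomb (\<lambda>i. t [^] i) (\<lambda>i. w \<otimes> \<theta> [^] (i + Suc m)) n" unfolding Suc ..
      also have "\<dots> = lincomb (\<lambda>i. t [^] i) ?g (Suc n)"
      proof -
        have "?g 0 \<oplus> t \<otimes> lincomb (\<lambda>i. t [^] i) (\<lambda>i. ?g (Suc i)) k = lincomb (\<lambda>i. t [^] i) ?g (Suc k)" for k
        proof (induction k)
          case 0
          show ?case using gc[of 0] t by simp
        next
          case (Suc k)
          have c: "lincomb (\<lambda>i. t [^] i) (\<lambda>i. ?g (Suc i)) k \<in> carrier R"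
            by (rule lincomb_closed) (use t in simp, rule gc)
          have "?g 0 \<oplus> t \<otimes> lincomb (\<lambda>i. t [^] i) (\<lambda>i. ?g (Suc i)) (Suc k) =
              (?g 0 \<oplus> t \<otimes> lincomb (\<lambda>i. t [^] i) (\<lambda>i. ?g (Suc i)) k) \<oplus> (t \<otimes> t [^] k) \<otimes> ?g (Suc k)"
            using c gc[of 0] gc[of "Suc k"] t by (simp add: r_distr m_assoc a_assoc)
          also have "t \<otimes> t [^] k = t [^] Suc k" using nat_pow_Suc2[OF t(1), of k] by simp
          finally show ?case unfolding Suc by (simp only: lincomb.simps(2))
        qed
        then show ?thesis by simp
      qed
      finally show ?case .
    qed simp
    from this[of 0 N] show ?thesis unfolding Y_def by simp
  qed
  have "\<exists>t\<in>K. t \<noteq> \<zero> \<and> inv t \<noteq> \<theta> \<and> Y t w N \<noteq> \<zero>"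
  proof (rule ccontr)
    assume n: "\<not> ?thesis"
    define w' where "w' = w \<otimes> \<theta> \<ominus> \<theta> \<otimes> w"
    have w'c: "w' \<in> carrier R" unfolding w'_def using w tc by simp
    have Y': "Y t w' N = \<zero>" if t: "t \<in> K" "t \<noteq> \<zero>" for t
    proof -
      have e: "Y t w' n = Y t w n \<otimes> \<theta> \<ominus> \<theta> \<otimes> Y t w n" for n
      proof (induction n)
        case 0
        show ?case unfolding Y_def using tc by (simp add: a_minus_def)
      next
        case (Suc n)
        have tn: "t [^] n \<in> K" using t by (induction n) auto
        have c: "t [^] n \<in> carrier R" "\<theta> [^] n \<in> carrier R" using t tc by auto
        have co: "\<theta> \<otimes> t [^] n = t [^] n \<otimes> \<theta>" by (rule K_comm[OF \<theta>(1) tn])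
        have co': "\<theta> \<otimes> \<theta> [^] n = \<theta> [^] n \<otimes> \<theta>" using nat_pow_Suc2[OF tc, of n] by simp
        have d: "p \<otimes> ((w \<otimes> \<theta> \<ominus> \<theta> \<otimes> w) \<otimes> q) = p \<otimes> (w \<otimes> (\<theta> \<otimes> q)) \<ominus> (p \<otimes> \<theta>) \<otimes> (w \<otimes> q)"
          if "p \<in> carrier R" "q \<in> carrier R" for p q
          using that w(1) tc by algebra
        have "t [^] n \<otimes> (w' \<otimes> \<theta> [^] n) = t [^] n \<otimes> (w \<otimes> \<theta> [^] n) \<otimes> \<theta> \<ominus> \<theta> \<otimes> (t [^] n \<otimes> (w \<otimes> \<theta> [^] n))"
          unfolding w'_def d[OF c] co' co[symmetric] using c w(1) tc by (simp add: m_assoc)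
        moreover have "(A \<otimes> \<theta> \<ominus> \<theta> \<otimes> A) \<oplus> (B \<otimes> \<theta> \<ominus> \<theta> \<otimes> B) = (A \<oplus> B) \<otimes> \<theta> \<ominus> \<theta> \<otimes> (A \<oplus> B)"
          if "A \<in> carrier R" "B \<in> carrier R" for A B
          using that tc by algebra
        ultimately show ?case using Suc Yc[of t w n] t w(1) c tc unfolding Y_def by simp
      qed
      have Yt: "Y t w N \<in> carrier R" using Yc t w by simp
      show ?thesis
      \<comment> \<open>For the one eigenvalue not excluded by assumption, \<open>Y t w N\<close>
        commutes with \<open>\<theta>\<close>, so its commutator vanishes all the same.\<close>
      proof (cases "inv t = \<theta>")
        case True
        have "\<theta> \<otimes> Y t w N = \<theta> \<otimes> (t \<otimes> Y t w N \<otimes> \<theta>)" using eig[OF t w(1)] by simp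
        also have "\<dots> = Y t w N \<otimes> \<theta>" unfolding True[symmetric] using t Yt by (simp add: m_assoc)
        finally show ?thesis unfolding e using Yt tc by (simp add: minus_eq_zero_iff)
      next
        case False
        then have "Y t w N = \<zero>" using n t by blast
        then show ?thesis unfolding e using tc by (simp add: a_minus_def)
      qed
    qed
    let ?ws = "map (\<lambda>i. w' \<otimes> \<theta> [^] i) [0..<N]"
    \<comment> \<open>All nonzero elements of \<open>K\<close> are roots, and the value at
      \<open>\<zero>\<close> is the constant coefficient \<open>w'\<close>.\<close>
    have "horner ?ws \<zero> = \<zero>"
    proof (rule horner_roots[of _ "K - {\<zero>}"])
      show "set ?ws \<subseteq> carrier R" using w'c tc by auto
      show "length ?ws \<le> card (K - {\<zero>})" by (simp add: N_def)
      show "horner ?ws s = \<zero>" if "s \<in> K - {\<zero>}" for s using horner[of s w'] w'c Y'[of s] that by simp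
    qed (use fin in auto)
    moreover have "N > 0" unfolding N_def by (subst card_gt_0_iff) (use fin \<theta> in blast)
    then have "[0..<N] = 0 # map Suc [0..<N - 1]" by (cases N) (simp_all add: upt_conv_Cons map_Suc_upt del: upt_Suc)
    then have "horner ?ws \<zero> = w' \<otimes> \<theta> [^] (0::nat) \<oplus> \<zero> \<otimes> horner (map (\<lambda>i. w' \<otimes> \<theta> [^] Suc i) [0..<N - 1]) \<zero>"
      by (simp add: o_def del: nat_pow_Suc)
    moreover have "horner (map (\<lambda>i. w' \<otimes> \<theta> [^] Suc i) [0..<N - 1]) \<zero> \<in> carrier R"
      using w'c tc by (intro horner_closed) auto
    ultimately have "w' = \<zero>" using w'c by simp
    then show False using w tc unfolding w'_def by (simp add: minus_eq_zero_iff)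
  qed
  then obtain t where t: "t \<in> K" "t \<noteq> \<zero>" "inv t \<noteq> \<theta>" "Y t w N \<noteq> \<zero>" by blast
  have Yt: "Y t w N \<in> carrier R" using Yc t w by simp
  have "inv t \<otimes> Y t w N = inv t \<otimes> (t \<otimes> Y t w N \<otimes> \<theta>)" using eig[OF t(1,2) w(1)] by simp
  also have "\<dots> = Y t w N \<otimes> \<theta>" using t Yt tc by (simp add: m_assoc)
  finally show thesis using that[of "Y t w N" "inv t"] Yt t by auto
qed

end

lemma (in ring) lincomb_cong_prod:
  "(\<And>i. i < n \<Longrightarrow> \<alpha> i \<otimes> f i = \<beta> i \<otimes> g i) \<Longrightarrow> lincomb \<alpha> f n = lincomb \<beta> g n"
  by (induction n) auto

context skew_field
begin

lemma left_cancel: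
  assumes "x \<in> carrier R" "x \<noteq> \<zero>" "y \<in> carrier R" "z \<in> carrier R" "x \<otimes> y = x \<otimes> z"
  shows "y = z"
  using assms by (metis inv_cancel1)

lemma right_cancel:
  assumes "x \<in> carrier R" "x \<noteq> \<zero>" "y \<in> carrier R" "z \<in> carrier R" "y \<otimes> x = z \<otimes> x"
  shows "y = z"
  using assms by (metis inv_closed' inv_right m_assoc r_one)

lemma twisted_pow:
  assumes "y \<in> carrier R" "k \<in> carrier R" "l \<in> carrier R" "y \<otimes> k = l \<otimes> y"
  shows "y \<otimes> k [^] (j::nat) = l [^] j \<otimes> y"
proof (induction j)
  case (Suc j)
  have "y \<otimes> k [^] Suc j = (y \<otimes> k [^] j) \<otimes> k" using assms by (simp add: m_assoc)
  also have "\<dots> = l [^] j \<otimes> (y \<otimes> k)" unfolding Suc using assms by (simp add: m_assoc)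
  also have "\<dots> = l [^] Suc j \<otimes> y" unfolding assms(4) using assms by (simp add: m_assoc)
  finally show ?case .
qed (use assms in simp)

end

context max_subfield
begin

text \<open>This is Wedderburn's theorem: a division ring with a noncentral element is infinite.\<close>

lemma infinite_carrier: "infinite (carrier R)"
proof
  assume fin: "finite (carrier R)"
  then have finK: "finite K" using K_sub finite_subset by blast
  obtain \<theta> where \<theta>: "\<theta> \<in> K" "\<theta> \<noteq> \<zero>" "\<forall>k\<in>K. k \<noteq> \<zero> \<longrightarrow> (\<exists>i::nat. k = \<theta> [^] i)"
    "\<forall>k\<in>K. k \<noteq> \<zero> \<longrightarrow> k [^] card (K - {\<zero>}) = \<one>"
    by (rule generator[OF finK])
  have tc: "\<theta> \<in> carrier R" using \<theta> by simp
  have in_K: "x \<in> K" if x: "x \<in> carrier R" "x \<otimes> \<theta> = \<theta> \<otimes> x" for x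
  proof -
    have "x \<otimes> k = k \<otimes> x" if k: "k \<in> K" for k
    proof (cases "k = \<zero>")
      case False
      then obtain i :: nat where "k = \<theta> [^] i" using \<theta>(3) k by blast
      then show ?thesis using twisted_pow[OF x(1) tc tc x(2)] by simp
    qed (use x in simp)
    then have "x \<in> centralizer K" unfolding centralizer_def using x by simp
    then show ?thesis unfolding centralizer_K .
  qed
  obtain w where w: "w \<in> carrier R" "w \<otimes> a \<noteq> a \<otimes> w" by (rule noncommuting)
  have "w \<otimes> \<theta> \<noteq> \<theta> \<otimes> w"
  proof
    assume "w \<otimes> \<theta> = \<theta> \<otimes> w"
    then have "w \<in> K" by (rule in_K[OF w(1)])
    then show False using w(2) K_comm a_in_K by blast
  qed
  \<comment> \<open>\<open>y\<close> normalizes \<open>K\<close> without centralizing it, so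
    conjugation by \<open>y\<close> is a nontrivial automorphism of \<open>K\<close>. The rest is
    the theory of a cyclic extension of finite fields, with \<open>y\<close> inducing the
    automorphism.\<close>
  then obtain y l where y: "y \<in> carrier R" "y \<noteq> \<zero>" and l: "l \<in> K" "l \<noteq> \<theta>" and yl: "y \<otimes> \<theta> = l \<otimes> y"
    by (rule eigenvector[OF finK \<theta>(1,2,4) w(1)])
  have yK: "y \<notin> K"
  proof
    assume "y \<in> K"
    then have "y \<otimes> \<theta> = \<theta> \<otimes> y" using K_comm \<theta>(1) by blast
    then have "\<theta> = l" using right_cancel[OF y tc] l yl by simp
    then show False using l by simp
  qed
  have ypc: "y [^] i \<in> carrier R" "y [^] i \<noteq> \<zero>" for i :: nat using y pow_nonzero by auto
  have tw1: "\<exists>k'\<in>K. y \<otimes> k = k' \<otimes> y" if k: "k \<in> K" for k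
  proof (cases "k = \<zero>")
    case True
    then show ?thesis using y by (intro bexI[of _ \<zero>]) auto
  next
    case False
    then obtain i :: nat where i: "k = \<theta> [^] i" using \<theta>(3) k by blast
    have "l [^] i \<in> K" using l by (induction i) auto
    then show ?thesis using twisted_pow[OF y(1) tc K_carrier[OF l(1)] yl, of i] i by blast
  qed
  have twi: "\<exists>k'\<in>K. y [^] i \<otimes> k = k' \<otimes> y [^] i" if k: "k \<in> K" for k and i :: nat
    using k
  proof (induction i arbitrary: k)
    case 0
    then show ?case by (intro bexI[of _ k]) auto
  next
    case (Suc i)
    obtain k' where k': "k' \<in> K" "y \<otimes> k = k' \<otimes> y" using tw1[OF Suc.prems] by blast
    obtain k'' where k'': "k'' \<in> K" "y [^] i \<otimes> k' = k'' \<otimes> y [^] i" using Suc.IH[OF k'(1)] by blast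
    have "y [^] Suc i \<otimes> k = y [^] i \<otimes> (y \<otimes> k)" using y Suc.prems by (simp add: m_assoc)
    also have "\<dots> = (y [^] i \<otimes> k') \<otimes> y" unfolding k'(2) using y k' by (simp add: m_assoc)
    also have "\<dots> = k'' \<otimes> y [^] Suc i" unfolding k''(2) using y k'' by (simp add: m_assoc)
    finally show ?case using k'' by blast
  qed
  define \<psi> where "\<psi> i k = y [^] i \<otimes> k \<otimes> inv (y [^] i)" for i :: nat and k
  have \<psi>: "\<psi> i k \<in> K" "y [^] i \<otimes> k = \<psi> i k \<otimes> y [^] i" if k: "k \<in> K" for i k
  proof -
    obtain k' where k': "k' \<in> K" "y [^] i \<otimes> k = k' \<otimes> y [^] i" using twi[OF k, of i] by blast
    have "\<psi> i k = k'" unfolding \<psi>_def k'(2) using k' ypc[of i] by (simp add: m_assoc)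
    then show "\<psi> i k \<in> K" "y [^] i \<otimes> k = \<psi> i k \<otimes> y [^] i" using k' by simp_all
  qed
  have \<psi>nz: "\<psi> i k \<noteq> \<zero>" if "k \<in> K" "k \<noteq> \<zero>" for i k
    using \<psi>[OF that(1), of i] that ypc[of i] by auto
  \<comment> \<open>As \<open>K\<close> is its own centralizer, \<open>y [^] i\<close> lies in
    \<open>K\<close> exactly when it induces the identity on \<open>K\<close>; so \<open>r\<close>
    is the order of the automorphism.\<close>
  define r where "r = (LEAST r::nat. 0 < r \<and> y [^] r \<in> K)"
  have "\<exists>r>0. y [^] (r::nat) \<in> K"
    using finite_pow_one[OF fin y] K_closed(2) by metis
  then have "\<exists>r. 0 < r \<and> y [^] (r::nat) \<in> K" by blast
  then have "0 < r \<and> y [^] r \<in> K" unfolding r_def by (rule LeastI_ex)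
  then have r: "0 < r" "y [^] r \<in> K" by simp_all
  have rmin: "y [^] i \<notin> K" if "0 < i" "i < r" for i :: nat
    using that not_less_Least[of i "\<lambda>r. 0 < r \<and> y [^] r \<in> K"] unfolding r_def by blast
  have \<psi>pow: "\<psi> i (\<theta> [^] j) = \<psi> i \<theta> [^] j" for i j :: nat
  proof -
    have "y [^] i \<otimes> \<theta> [^] j = \<psi> i \<theta> [^] j \<otimes> y [^] i"
      by (rule twisted_pow[OF ypc(1) tc _ \<psi>(2)[OF \<theta>(1)]]) (use \<psi>(1)[OF \<theta>(1)] in simp)
    then show ?thesis unfolding \<psi>_def[of i "\<theta> [^] j"] using ypc[of i] \<psi>(1)[OF \<theta>(1), of i] by (simp add: m_assoc)
  qed
  have tpK: "\<theta> [^] j \<in> K" for j :: nat using \<theta>(1) by (induction j) auto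
  \<comment> \<open>Equal values at the generator would make \<open>y [^] (j - i)\<close> commute
    with \<open>K\<close>, hence lie in \<open>K\<close>, against the choice of
    \<open>r\<close>.\<close>
  have dist_aux: False if ij: "i < j" "j < r" and e: "\<psi> i \<theta> = \<psi> j \<theta>" for i j
  proof -
    have yj: "y [^] j = y [^] i \<otimes> y [^] (j - i)" using ij nat_pow_mult[OF y(1), of i "j - i"] by simp
    have "y [^] i \<otimes> (y [^] (j - i) \<otimes> \<theta>) = y [^] j \<otimes> \<theta>" unfolding yj using y tc by (simp add: m_assoc)
    also have "\<dots> = \<psi> i \<theta> \<otimes> (y [^] i \<otimes> y [^] (j - i))" using \<psi>(2)[OF \<theta>(1), of j] e yj by simp
    also have "\<dots> = (y [^] i \<otimes> \<theta>) \<otimes> y [^] (j - i)"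
      unfolding \<psi>(2)[OF \<theta>(1)] using \<psi>(1)[OF \<theta>(1), of i] y by (simp add: m_assoc)
    also have "\<dots> = y [^] i \<otimes> (\<theta> \<otimes> y [^] (j - i))" using y tc by (simp add: m_assoc)
    finally have "y [^] (j - i) \<otimes> \<theta> = \<theta> \<otimes> y [^] (j - i)"
      by (rule left_cancel[OF ypc, rotated 2]) (use y tc in auto)
    then have "y [^] (j - i) \<in> K" by (rule in_K[OF ypc(1)])
    then show False using rmin[of "j - i"] ij by simp
  qed
  have dist: "i = j" if "i < r" "j < r" "\<psi> i \<theta> = \<psi> j \<theta>" for i j
    using dist_aux[of i j] dist_aux[of j i] that by (metis nat_neq_iff)
  \<comment> \<open>Multiplying the relation on the right by powers of \<open>\<theta>\<close>
    brings in the powers of the distinct \<open>\<psi> i \<theta>\<close>, and the Vandermonde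
    argument isolates each term.\<close>
  have ind1: "\<kappa> i = \<zero>" if \<kappa>: "\<And>i. i < r \<Longrightarrow> \<kappa> i \<in> K" and z: "lincomb \<kappa> (\<lambda>i. y [^] i) r = \<zero>" and i: "i < r" for \<kappa> i
  proof -
    have "\<kappa> i \<otimes> y [^] i = \<zero>"
    proof (rule vandermonde[where r = r and \<mu> = "\<lambda>i. \<psi> i \<theta>" and x = "\<lambda>i. \<kappa> i \<otimes> y [^] i"])
      fix j :: nat
      have "lincomb (\<lambda>i. \<psi> i \<theta> [^] j) (\<lambda>i. \<kappa> i \<otimes> y [^] i) r = lincomb \<kappa> (\<lambda>i. y [^] i \<otimes> \<theta> [^] j) r"
      proof (rule lincomb_cong_prod)
        fix i assume i: "i < r"
        have c: "\<kappa> i \<in> K" "\<psi> i (\<theta> [^] j) \<in> K" using \<kappa>[OF i] \<psi>(1)[OF tpK] .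
        have "\<psi> i (\<theta> [^] j) \<otimes> (\<kappa> i \<otimes> y [^] i) = (\<kappa> i \<otimes> \<psi> i (\<theta> [^] j)) \<otimes> y [^] i"
          unfolding K_comm[OF c] using c y by (simp add: m_assoc)
        also have "\<dots> = \<kappa> i \<otimes> (y [^] i \<otimes> \<theta> [^] j)" unfolding \<psi>(2)[OF tpK] using c y by (simp add: m_assoc)
        finally show "\<psi> i \<theta> [^] j \<otimes> (\<kappa> i \<otimes> y [^] i) = \<kappa> i \<otimes> (y [^] i \<otimes> \<theta> [^] j)" unfolding \<psi>pow .
      qed
      also have "\<dots> = lincomb \<kappa> (\<lambda>i. y [^] i) r \<otimes> \<theta> [^] j" by (rule lincomb_rmult) (use \<kappa> y tc in auto)
      finally show "lincomb (\<lambda>i. \<psi> i \<theta> [^] j) (\<lambda>i. \<kappa> i \<otimes> y [^] i) r = \<zero>" using z tc by simp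
    qed (use \<psi>(1)[OF \<theta>(1)] dist \<kappa> y i in auto)
    then show ?thesis using \<kappa>[OF i] ypc[of i] by simp
  qed
  \<comment> \<open>Independence of the automorphisms \<open>\<psi> i\<close>, tested on the powers
    of \<open>\<theta>\<close>.\<close>
  have ind2: "\<exists>c\<in>K. lincomb \<kappa> (\<lambda>i. \<psi> i c) r \<noteq> \<zero>" if \<kappa>: "\<And>i. i < r \<Longrightarrow> \<kappa> i \<in> K" and nz: "\<kappa> 0 \<noteq> \<zero>" for \<kappa>
  proof (rule ccontr)
    assume n: "\<not> ?thesis"
    have "\<kappa> 0 = \<zero>"
    proof (rule vandermonde[where r = r and \<mu> = "\<lambda>i. \<psi> i \<theta>"])
      fix j :: nat
      have "lincomb (\<lambda>i. \<psi> i \<theta> [^] j) \<kappa> r = lincomb \<kappa> (\<lambda>i. \<psi> i (\<theta> [^] j)) r"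
      proof (rule lincomb_cong_prod)
        fix i assume i: "i < r"
        show "\<psi> i \<theta> [^] j \<otimes> \<kappa> i = \<kappa> i \<otimes> \<psi> i (\<theta> [^] j)"
          unfolding \<psi>pow[symmetric] by (rule K_comm[OF \<psi>(1)[OF tpK] \<kappa>[OF i]])
      qed
      also have "\<dots> = \<zero>" using n tpK by blast
      finally show "lincomb (\<lambda>i. \<psi> i \<theta> [^] j) \<kappa> r = \<zero>" .
    qed (use \<psi>(1)[OF \<theta>(1)] dist \<kappa> r in auto)
    then show False using nz by simp
  qed
  define S where "S = K - {\<zero>}"
  have finS: "finite S" using finK S_def by simp
  have SK: "k \<in> K" "k \<noteq> \<zero>" "k \<in> carrier R" if "k \<in> S" for k using that S_def by auto
  \<comment> \<open>The nonzero elements of the fixed field of \<open>\<psi> 1\<close>.\<close>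
  define P where "P = {k \<in> S. y \<otimes> k = k \<otimes> y}"
  have zc: "k \<otimes> y \<in> carrier R" "k \<otimes> y \<noteq> \<zero>" if "k \<in> S" for k using SK[OF that] y by auto
  have zpow: "\<exists>\<kappa>\<in>S. (k \<otimes> y) [^] i = \<kappa> \<otimes> y [^] i" if k: "k \<in> S" for k and i :: nat
  proof (induction i)
    case 0
    show ?case unfolding S_def by (intro bexI[of _ \<one>]) auto
  next
    case (Suc i)
    then obtain \<kappa> where \<kappa>: "\<kappa> \<in> S" "(k \<otimes> y) [^] i = \<kappa> \<otimes> y [^] i" by blast
    have "(k \<otimes> y) [^] Suc i = \<kappa> \<otimes> (y [^] i \<otimes> k) \<otimes> y"
      using \<kappa>(2) SK[OF \<kappa>(1)] SK[OF k] y by (simp add: m_assoc)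
    also have "\<dots> = (\<kappa> \<otimes> \<psi> i k) \<otimes> y [^] Suc i"
      unfolding \<psi>(2)[OF SK(1)[OF k]] using \<psi>(1)[OF SK(1)[OF k], of i] SK[OF \<kappa>(1)] y by (simp add: m_assoc)
    finally have "(k \<otimes> y) [^] Suc i = (\<kappa> \<otimes> \<psi> i k) \<otimes> y [^] Suc i" .
    moreover have "\<kappa> \<otimes> \<psi> i k \<in> S"
      unfolding S_def using \<psi>(1)[OF SK(1)[OF k], of i] \<psi>nz[OF SK(1,2)[OF k], of i] SK[OF \<kappa>(1)] by simp
    ultimately show ?case by blast
  qed
  \<comment> \<open>Moving every \<open>y\<close> to the right shows that \<open>h k\<close> is the
    norm of \<open>k\<close> times \<open>y [^] r\<close>.\<close>
  define h where "h k = (k \<otimes> y) [^] r" for k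
  have hP: "h k \<in> P" if k: "k \<in> S" for k
  proof -
    obtain \<kappa> where \<kappa>: "\<kappa> \<in> S" "h k = \<kappa> \<otimes> y [^] r" using zpow[OF k, of r] unfolding h_def by blast
    have hK: "h k \<in> K" unfolding \<kappa>(2) using SK[OF \<kappa>(1)] r by simp
    have "h k \<noteq> \<zero>" unfolding h_def using pow_nonzero[OF zc[OF k]] .
    moreover have "k \<otimes> (y \<otimes> h k) = k \<otimes> (h k \<otimes> y)"
    proof -
      have "(k \<otimes> y) \<otimes> h k = h k \<otimes> (k \<otimes> y)"
        unfolding h_def using nat_pow_Suc2[OF zc(1)[OF k], of r] by simp
      then have "k \<otimes> (y \<otimes> h k) = (h k \<otimes> k) \<otimes> y" using SK[OF k] y hK by (simp add: m_assoc)
      also have "h k \<otimes> k = k \<otimes> h k" by (rule K_comm[OF hK SK(1)[OF k]])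
      finally show ?thesis using SK[OF k] y hK by (simp add: m_assoc)
    qed
    then have "y \<otimes> h k = h k \<otimes> y"
      using left_cancel[OF SK(3,2)[OF k]] y hK by simp
    ultimately show ?thesis unfolding P_def S_def using hK by simp
  qed
  \<comment> \<open>A form of Hilbert 90: elements of equal norm make \<open>k y\<close> and
    \<open>k0 y\<close> conjugate under \<open>K\<close>. The conjugating element is the sum of the
    \<open>t i\<close>, and \<open>ind2\<close> supplies a \<open>v\<close> for which it is
    nonzero.\<close>
  have conj: "\<exists>c\<in>S. (k \<otimes> y) \<otimes> c = c \<otimes> (k0 \<otimes> y)" if k: "k \<in> S" and k0: "k0 \<in> S" and e: "h k = h k0" for k k0
  proof -
    let ?z = "k \<otimes> y" and ?w = "k0 \<otimes> y"
    have z: "?z \<in> carrier R" "?w \<in> carrier R" "?w \<noteq> \<zero>" using zc k k0 by auto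
    have z0p: "?w [^] i \<in> carrier R" "?w [^] i \<noteq> \<zero>" for i :: nat using z pow_nonzero by auto
    obtain \<alpha> where \<alpha>: "\<And>i::nat. \<alpha> i \<in> S" "\<And>i. ?z [^] i = \<alpha> i \<otimes> y [^] i" using zpow[OF k] by metis
    obtain \<beta> where \<beta>: "\<And>i::nat. \<beta> i \<in> S" "\<And>i. ?w [^] i = \<beta> i \<otimes> y [^] i" using zpow[OF k0] by metis
    have "\<exists>c\<in>K. lincomb (\<lambda>i. \<alpha> i \<otimes> inv (\<beta> i)) (\<lambda>i. \<psi> i c) r \<noteq> \<zero>"
    proof (rule ind2)
      show "\<alpha> i \<otimes> inv (\<beta> i) \<in> K" for i using SK[OF \<alpha>(1)] SK[OF \<beta>(1)] by simp
      show "\<alpha> 0 \<otimes> inv (\<beta> 0) \<noteq> \<zero>" using SK[OF \<alpha>(1)] SK[OF \<beta>(1)] by simp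
    qed
    then obtain v where v: "v \<in> K" "lincomb (\<lambda>i. \<alpha> i \<otimes> inv (\<beta> i)) (\<lambda>i. \<psi> i v) r \<noteq> \<zero>" by blast
    define t where "t i = ?z [^] i \<otimes> v \<otimes> inv (?w [^] i)" for i :: nat
    have tcar: "t i \<in> carrier R" for i unfolding t_def using z z0p v by simp
    have t_eq: "t i = (\<alpha> i \<otimes> inv (\<beta> i)) \<otimes> \<psi> i v" for i
    proof (rule right_cancel[OF z0p(1,2)[of i]])
      note c = SK[OF \<alpha>(1)[of i]] SK[OF \<beta>(1)[of i]] \<psi>(1)[OF v(1), of i]
      have "t i \<otimes> ?w [^] i = \<alpha> i \<otimes> (y [^] i \<otimes> v)"
        unfolding t_def using z z0p[of i] v \<alpha>(2)[of i] c y by (simp add: m_assoc)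
      also have "\<dots> = \<alpha> i \<otimes> (\<psi> i v \<otimes> y [^] i)" unfolding \<psi>(2)[OF v(1)] ..
      also have "\<dots> = (\<alpha> i \<otimes> inv (\<beta> i)) \<otimes> (\<beta> i \<otimes> \<psi> i v) \<otimes> y [^] i"
        using c y by (simp add: m_assoc)
      also have "\<beta> i \<otimes> \<psi> i v = \<psi> i v \<otimes> \<beta> i" by (rule K_comm) (use c in auto)
      also have "(\<alpha> i \<otimes> inv (\<beta> i)) \<otimes> (\<psi> i v \<otimes> \<beta> i) \<otimes> y [^] i = (\<alpha> i \<otimes> inv (\<beta> i)) \<otimes> \<psi> i v \<otimes> ?w [^] i"
        unfolding \<beta>(2) using c y by (simp add: m_assoc)
      finally show "t i \<otimes> ?w [^] i = (\<alpha> i \<otimes> inv (\<beta> i)) \<otimes> \<psi> i v \<otimes> ?w [^] i" .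
    qed (use tcar SK[OF \<alpha>(1)[of i]] SK[OF \<beta>(1)[of i]] \<psi>(1)[OF v(1), of i] in auto)
    define c where "c = lincomb (\<lambda>_. \<one>) t r"
    have "c = lincomb (\<lambda>i. \<alpha> i \<otimes> inv (\<beta> i)) (\<lambda>i. \<psi> i v) r"
      unfolding c_def by (rule lincomb_cong_prod) (use t_eq tcar in simp)
    then have cnz: "c \<noteq> \<zero>" using v by simp
    have tK: "t i \<in> K" for i unfolding t_eq
      using SK[OF \<alpha>(1)[of i]] SK[OF \<beta>(1)[of i]] \<psi>(1)[OF v(1), of i] by simp
    have "lincomb (\<lambda>_. \<one>) t n \<in> K" for n using tK by (induction n) auto
    then have cK: "c \<in> K" unfolding c_def .
    have step: "?z \<otimes> t i = t (Suc i) \<otimes> ?w" for i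
    proof -
      have "inv (?w [^] Suc i) \<otimes> ?w = inv (?w [^] i)"
      proof (rule right_cancel[OF z0p(1,2)[of i]])
        have "inv (?w [^] Suc i) \<otimes> ?w \<otimes> ?w [^] i = inv (?w [^] Suc i) \<otimes> ?w [^] Suc i"
          using z z0p[of i] z0p(1,2)[of "Suc i"] nat_pow_Suc2[OF z(2), of i]
          by (metis inv_closed' m_assoc)
        also have "\<dots> = \<one>" by (rule inv_left[OF z0p])
        also have "\<dots> = inv (?w [^] i) \<otimes> ?w [^] i" using z0p[of i] by simp
        finally show "inv (?w [^] Suc i) \<otimes> ?w \<otimes> ?w [^] i = inv (?w [^] i) \<otimes> ?w [^] i" .
      qed (use z z0p[of i] inv_closed'[OF z0p(1,2)[of "Suc i"]] in simp_all)
      moreover have "t (Suc i) \<otimes> ?w = ?z [^] Suc i \<otimes> v \<otimes> (inv (?w [^] Suc i) \<otimes> ?w)"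
        unfolding t_def using z inv_closed'[OF z0p(1,2)[of "Suc i"]] v
        by (simp add: m_assoc del: nat_pow_Suc)
      ultimately have "t (Suc i) \<otimes> ?w = ?z [^] Suc i \<otimes> v \<otimes> inv (?w [^] i)" by simp
      also have "?z [^] Suc i = ?z \<otimes> ?z [^] i" by (rule nat_pow_Suc2[OF z(1)])
      finally show ?thesis unfolding t_def using z z0p[of i] v by (simp add: m_assoc)
    qed
    have tele: "?z \<otimes> lincomb (\<lambda>_. \<one>) t n \<oplus> t 0 \<otimes> ?w = (lincomb (\<lambda>_. \<one>) t n \<oplus> t n) \<otimes> ?w" for n
    proof (induction n)
      case 0
      show ?case using z tcar by simp
    next
      case (Suc n)
      have L: "lincomb (\<lambda>_. \<one>) t n \<in> carrier R" using tcar by auto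
      have "?z \<otimes> lincomb (\<lambda>_. \<one>) t (Suc n) \<oplus> t 0 \<otimes> ?w = (?z \<otimes> lincomb (\<lambda>_. \<one>) t n \<oplus> t 0 \<otimes> ?w) \<oplus> ?z \<otimes> t n"
        using L z tcar by (simp add: r_distr a_ac)
      also have "\<dots> = (lincomb (\<lambda>_. \<one>) t n \<oplus> t n) \<otimes> ?w \<oplus> t (Suc n) \<otimes> ?w" unfolding Suc step ..
      also have "\<dots> = (lincomb (\<lambda>_. \<one>) t (Suc n) \<oplus> t (Suc n)) \<otimes> ?w"
        using L z tcar by (simp add: l_distr)
      finally show ?case .
    qed
    \<comment> \<open>The common value \<open>h k = h k0\<close> lies in \<open>K\<close> and
      commutes with \<open>v\<close>; this closes the telescoping sum.\<close>
    have "t r = t 0"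
    proof -
      have hK: "h k0 \<in> K" "h k0 \<noteq> \<zero>" using hP[OF k0] unfolding P_def S_def by auto
      have "t r = h k0 \<otimes> v \<otimes> inv (h k0)" unfolding t_def using e unfolding h_def by simp
      also have "h k0 \<otimes> v = v \<otimes> h k0" by (rule K_comm[OF hK(1) v(1)])
      finally show ?thesis unfolding t_def using hK v by (simp add: m_assoc)
    qed
    then have "?z \<otimes> c \<oplus> t 0 \<otimes> ?w = c \<otimes> ?w \<oplus> t 0 \<otimes> ?w"
      using tele[of r] cK z tcar unfolding c_def by (simp add: l_distr)
    moreover have "?z \<otimes> c \<in> carrier R" "c \<otimes> ?w \<in> carrier R" "t 0 \<otimes> ?w \<in> carrier R"
      using cK z tcar by auto
    ultimately have "?z \<otimes> c = c \<otimes> ?w" by (metis add.right_cancel)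
    then show ?thesis using cK cnz unfolding S_def by blast
  qed
  \<comment> \<open>By \<open>conj\<close>, two elements with the same value of \<open>h\<close>
    differ by a factor of this form.\<close>
  define e where "e c = c \<otimes> inv (\<psi> 1 c)" for c
  have \<psi>1: "\<psi> 1 c \<in> K" "\<psi> 1 c \<noteq> \<zero>" "y \<otimes> c = \<psi> 1 c \<otimes> y" if "c \<in> S" for c
    using \<psi>[of c 1] \<psi>nz[of c 1] SK[OF that] y by simp_all
  define C where "C = e ` S"
  have finC: "finite C" unfolding C_def using finS by simp
  have fiber: "card {k \<in> S. h k = \<beta>} \<le> card C" for \<beta>
  proof (cases "\<exists>k0\<in>S. h k0 = \<beta>")
    case True
    then obtain k0 where k0: "k0 \<in> S" "h k0 = \<beta>" by blast
    have "{k \<in> S. h k = \<beta>} \<subseteq> (\<lambda>x. k0 \<otimes> x) ` C"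
    proof
      fix k assume "k \<in> {k \<in> S. h k = \<beta>}"
      then have k: "k \<in> S" "h k = h k0" using k0 by auto
      obtain c where c: "c \<in> S" "(k \<otimes> y) \<otimes> c = c \<otimes> (k0 \<otimes> y)" using conj[OF k(1) k0(1) k(2)] by blast
      note cc = SK[OF c(1)] SK[OF k(1)] SK[OF k0(1)] \<psi>1[OF c(1)]
      have "(k \<otimes> \<psi> 1 c) \<otimes> y = (c \<otimes> k0) \<otimes> y"
        using c(2) cc y by (simp add: m_assoc)
      then have "k \<otimes> \<psi> 1 c = c \<otimes> k0" by (rule right_cancel[OF y, rotated 2]) (use cc in simp_all)
      also have "\<dots> = k0 \<otimes> c" by (rule K_comm) (use cc in auto)
      finally have "k \<otimes> \<psi> 1 c \<otimes> inv (\<psi> 1 c) = k0 \<otimes> e c" unfolding e_def using cc by (simp add: m_assoc)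
      then have "k = k0 \<otimes> e c" using cc by (simp add: m_assoc)
      then show "k \<in> (\<lambda>x. k0 \<otimes> x) ` C" unfolding C_def using c(1) by blast
    qed
    then have "card {k \<in> S. h k = \<beta>} \<le> card ((\<lambda>x. k0 \<otimes> x) ` C)" using finC by (intro card_mono) auto
    also have "\<dots> \<le> card C" using finC by (rule card_image_le)
    finally show ?thesis .
  next
    case False
    then have "{k \<in> S. h k = \<beta>} = {}" by blast
    then show ?thesis by (metis card.empty le0)
  qed
  \<comment> \<open>\<open>e\<close> is constant on cosets of \<open>P\<close>, so each of its
    values is taken at least \<open>card P\<close> times.\<close>
  have CP: "card C * card P \<le> card S"
  proof -
    have "\<exists>c\<in>S. e c = x" if "x \<in> C" for x using that unfolding C_def by blast
    then obtain s where s: "\<And>x. x \<in> C \<Longrightarrow> s x \<in> S" "\<And>x. x \<in> C \<Longrightarrow> e (s x) = x" by metis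
    have ephi: "e (c \<otimes> p) = e c" if c: "c \<in> S" and p: "p \<in> P" for c p
    proof -
      have pS: "p \<in> S" "y \<otimes> p = p \<otimes> y" using p unfolding P_def by auto
      note cc = SK[OF c] SK[OF pS(1)] \<psi>1[OF c]
      have cp: "c \<otimes> p \<in> S" unfolding S_def using cc by simp
      have "\<psi> 1 (c \<otimes> p) \<otimes> y = \<psi> 1 c \<otimes> p \<otimes> y"
      proof -
        have "\<psi> 1 (c \<otimes> p) \<otimes> y = y \<otimes> (c \<otimes> p)" using \<psi>1(3)[OF cp] by simp
        also have "\<dots> = (y \<otimes> c) \<otimes> p" using cc(1-8) y by (simp add: m_assoc)
        also have "\<dots> = \<psi> 1 c \<otimes> (y \<otimes> p)" unfolding cc(9) using cc(1-8) y by (simp add: m_assoc)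
        finally show ?thesis unfolding pS(2) using cc(1-8) y by (simp add: m_assoc)
      qed
      then have e1: "\<psi> 1 (c \<otimes> p) = \<psi> 1 c \<otimes> p"
        by (rule right_cancel[OF y, rotated 2]) (use cc \<psi>1[OF cp] in simp_all)
      have "e (c \<otimes> p) \<otimes> (\<psi> 1 c \<otimes> p) = c \<otimes> p"
        unfolding e_def e1 using cc by (simp add: m_assoc)
      also have "\<dots> = e c \<otimes> (\<psi> 1 c \<otimes> p)" unfolding e_def using cc by (simp add: m_assoc)
      finally show ?thesis
        by (rule right_cancel[rotated 4]) (use cc \<psi>1[OF cp] in \<open>simp_all add: e_def\<close>)
    qed
    have "inj_on (\<lambda>(x, p). s x \<otimes> p) (C \<times> P)"
    proof (rule inj_onI, clarify)
      fix x p x' p' assume x: "x \<in> C" "x' \<in> C" "p \<in> P" "p' \<in> P" "s x \<otimes> p = s x' \<otimes> p'"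
      have "x = e (s x \<otimes> p)" using ephi[OF s(1) x(3)] s(2) x(1) by simp
      also have "\<dots> = x'" using ephi[OF s(1) x(4)] s(2) x(2,5) by simp
      finally have xx: "x = x'" .
      have "p \<in> S" "p' \<in> S" using x unfolding P_def by auto
      then have "p = p'" using left_cancel[OF SK(3,2)[OF s(1)[OF x(1)]]] x(5) SK xx by simp
      then show "x = x' \<and> p = p'" using xx by simp
    qed
    moreover have "(\<lambda>(x, p). s x \<otimes> p) ` (C \<times> P) \<subseteq> S"
    proof clarify
      fix x p assume "x \<in> C" "p \<in> P"
      then have "s x \<in> S" "p \<in> S" using s unfolding P_def by auto
      then show "s x \<otimes> p \<in> S" unfolding S_def by auto
    qed
    ultimately have "card (C \<times> P) \<le> card S" using finS by (rule card_inj_on_le)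
    then show ?thesis by (simp add: card_cartesian_product)
  qed
  \<comment> \<open>\<open>S\<close> is covered by the fibers of \<open>h\<close>, each of size at
    most \<open>card C\<close>. Together with \<open>CP\<close> this makes \<open>h\<close>
    surjective onto \<open>P\<close>, so \<open>\<one>\<close> is a value.\<close>
  have "card S \<le> card (h ` S) * card C"
  proof -
    have "S = (\<Union>\<beta>\<in>h ` S. {k \<in> S. h k = \<beta>})" by auto
    then have "card S \<le> (\<Sum>\<beta>\<in>h ` S. card {k \<in> S. h k = \<beta>})"
      using card_UN_le[of "h ` S" "\<lambda>\<beta>. {k \<in> S. h k = \<beta>}"] finS by simp
    also have "\<dots> \<le> (\<Sum>\<beta>\<in>h ` S. card C)" by (rule sum_mono) (rule fiber)
    finally show ?thesis by simp
  qed
  then have "card C * card P \<le> card (h ` S) * card C" using CP by linarith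
  moreover have "card C > 0"
  proof -
    have "\<one> \<in> S" unfolding S_def by simp
    then have "C \<noteq> {}" unfolding C_def by blast
    then show ?thesis using finC by (simp add: card_gt_0_iff)
  qed
  ultimately have "card P \<le> card (h ` S)" by (simp add: mult.commute)
  moreover have "h ` S \<subseteq> P" using hP by blast
  moreover have "finite P" unfolding P_def using finS by simp
  ultimately have "h ` S = P" by (simp add: card_seteq)
  moreover have "\<one> \<in> P" unfolding P_def S_def using y by simp
  ultimately obtain k where k: "k \<in> S" "h k = \<one>" by (metis imageE)
  let ?z = "k \<otimes> y"
  note z = zc[OF k(1)]
  obtain \<alpha> where \<alpha>: "\<And>i::nat. \<alpha> i \<in> S" "\<And>i. ?z [^] i = \<alpha> i \<otimes> y [^] i" using zpow[OF k(1)] by metis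
  \<comment> \<open>Here \<open>?z [^] r = \<one>\<close>. The geometric sum is a combination of the
    powers of \<open>y\<close> below \<open>r\<close> with nonzero coefficients, hence nonzero by
    \<open>ind1\<close>; so the other factor vanishes and \<open>y\<close> is the inverse of
    \<open>k\<close>.\<close>
  have "(?z \<ominus> \<one>) \<otimes> lincomb (\<lambda>_. \<one>) (\<lambda>i. ?z [^] i) r = \<zero>"
    using geometric_sum[OF z(1), of r] k(2) unfolding h_def by (simp add: a_minus_def r_neg)
  moreover have s: "lincomb (\<lambda>_. \<one>) (\<lambda>i. ?z [^] i) r \<in> carrier R" using z by auto
  moreover have "lincomb (\<lambda>_. \<one>) (\<lambda>i. ?z [^] i) r \<noteq> \<zero>"
  proof
    assume "lincomb (\<lambda>_. \<one>) (\<lambda>i. ?z [^] i) r = \<zero>"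
    moreover have "lincomb (\<lambda>_. \<one>) (\<lambda>i. ?z [^] i) r = lincomb \<alpha> (\<lambda>i. y [^] i) r"
      by (rule lincomb_cong_prod) (use \<alpha>(2) SK[OF \<alpha>(1)] y in simp)
    ultimately have "\<alpha> 0 = \<zero>" using ind1[of \<alpha> 0] SK[OF \<alpha>(1)] r by simp
    then show False using SK[OF \<alpha>(1)] by blast
  qed
  ultimately have "?z = \<one>" using z by (simp add: minus_eq_zero_iff)
  then have "y = inv k" using SK[OF k(1)] y by (metis inv_cancel1 r_one inv_closed')
  then show False using yK SK[OF k(1)] by simp
qed

end

subsection \<open>The dimension bound\<close>

lemma (in ring) finite_Span:
  assumes "subfield K R" "finite K" "set Us \<subseteq> carrier R"
  shows "finite (Span K Us)" "card (Span K Us) \<le> card K ^ length Us"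
proof -
  let ?L = "{Ks. set Ks \<subseteq> K \<and> length Ks = length Us}"
  have e: "Span K Us = (\<lambda>Ks. combine Ks Us) ` ?L"
    using Span_eq_combine_set_length_version[OF assms(1,3)] by auto
  have f: "finite ?L" using finite_lists_length_eq[OF assms(2)] .
  show "finite (Span K Us)" unfolding e using f by simp
  have "card (Span K Us) \<le> card ?L" unfolding e by (rule card_image_le[OF f])
  then show "card (Span K Us) \<le> card K ^ length Us" using card_lists_length_eq[OF assms(2)] by simp
qed

lemma pow_in_generate_field: "y \<in> S \<Longrightarrow> y [^]\<^bsub>R\<^esub> (i::nat) \<in> generate_field R S"
  by (induction i) (auto intro: generate_field.intros)

context skew_field
begin

text \<open>The \<open>d + 1\<close> powers of \<open>y\<close> lie in a space of dimension at most
  \<open>d\<close>.\<close>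

lemma algebraic_relation:
  assumes "algebraic_deg_le F d y" "subfield F R" "y \<in> carrier R"
  shows "\<exists>\<alpha>. (\<forall>i<Suc d. \<alpha> i \<in> F) \<and> lincomb \<alpha> (\<lambda>i. y [^] i) (Suc d) = \<zero> \<and> (\<exists>i<Suc d. \<alpha> i \<noteq> \<zero>)"
proof -
  obtain n where n: "n \<le> d" "dimension n F (generate_field R (insert y F))"
    using assms(1) unfolding algebraic_deg_le_def by blast
  have "\<not> independent F (family (\<lambda>i. y [^] i) (Suc d))"
  proof
    assume i: "independent F (family (\<lambda>i. y [^] i) (Suc d))"
    have "set (family (\<lambda>i. y [^] i) (Suc d)) \<subseteq> generate_field R (insert y F)"
      using pow_in_generate_field[of y "insert y F" R] by (auto simp del: family_simps(2))
    then have "length (family (\<lambda>i. y [^] i) (Suc d)) \<le> n"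
      by (rule independent_length_le_dimension[OF assms(2) n(2) i])
    then show False using n(1) by (simp del: family_simps(2))
  qed
  then show ?thesis using independent_family_iff[OF assms(2), of "Suc d" "\<lambda>i. y [^] i"] assms(3) by auto
qed

text \<open>\<open>F(y)\<close> has at most \<open>card F ^ d\<close> elements, so the order of a
  nonzero \<open>y\<close> is bounded by this number and divides its factorial, an exponent that
  does not depend on \<open>y\<close>.\<close>

lemma algebraic_power:
  assumes "algebraic_deg_le F d y" "subfield F R" "finite F" "y \<in> carrier R"
  shows "y [^] Suc (fact (card F ^ d)) = y"
proof (cases "y = \<zero>")
  case True
  then show ?thesis by simp
next
  case False
  let ?B = "card F ^ d" and ?E = "generate_field R (insert y F)"
  obtain n where n: "n \<le> d" "dimension n F ?E"
    using assms(1) unfolding algebraic_deg_le_def by blast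
  obtain Us where Us: "set Us \<subseteq> carrier R" "length Us = n" "Span F Us = ?E"
    using exists_base[OF assms(2) n(2)] by blast
  have "finite ?E" "card ?E \<le> card F ^ n"
    using finite_Span[OF assms(2,3) Us(1)] Us(2,3) by auto
  moreover have "0 < card F"
    using assms(3) subring_props(2)[OF assms(2)] by (auto simp: card_gt_0_iff)
  then have "card F ^ n \<le> ?B" using n(1) by (intro power_increasing) auto
  ultimately have E: "finite ?E" "card ?E \<le> ?B" by auto
  have "\<not> inj_on (\<lambda>i::nat. y [^] i) {..?B}"
  proof
    assume "inj_on (\<lambda>i::nat. y [^] i) {..?B}"
    moreover have "(\<lambda>i::nat. y [^] i) ` {..?B} \<subseteq> ?E"
      using pow_in_generate_field[of y "insert y F" R] by auto
    ultimately have "card {..?B} \<le> card ?E" using E(1) by (rule card_inj_on_le)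
    then show False using E(2) by simp
  qed
  then obtain i j where "i \<le> ?B" "j \<le> ?B" "i \<noteq> j" "y [^] i = y [^] j"
    unfolding inj_on_def by auto
  then obtain i j :: nat where ij: "i < j" "j \<le> ?B" "y [^] i = y [^] j" by (metis nat_neq_iff)
  have "y [^] i \<otimes> y [^] (j - i) = y [^] (i + (j - i))" by (rule nat_pow_mult[OF assms(4)])
  also have "\<dots> = y [^] i \<otimes> \<one>" using ij assms(4) by simp
  finally have "y [^] i \<otimes> y [^] (j - i) = y [^] i \<otimes> \<one>" .
  then have 1: "y [^] (j - i) = \<one>"
    by (rule left_cancel[rotated 4]) (use pow_nonzero[OF assms(4) False] assms(4) in auto)
  have "j - i dvd (fact ?B :: nat)" using ij by (intro dvd_fact) auto
  then obtain m where "fact ?B = (j - i) * m" by (elim dvdE)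
  then have "y [^] (fact ?B :: nat) = (y [^] (j - i)) [^] m" using nat_pow_pow[OF assms(4)] by simp
  then show ?thesis using 1 assms(4) by simp
qed

text \<open>Zorn's lemma gives a maximal commutative subset containing \<open>a\<close>. An element
  that centralizes it could be adjoined, so it belongs to it already.\<close>

lemma exists_max_subfield:
  assumes a: "a \<in> carrier R"
  shows "\<exists>K. centralizer K = K \<and> a \<in> K"
proof -
  let ?A = "{S. S \<subseteq> carrier R \<and> a \<in> S \<and> (\<forall>x\<in>S. \<forall>y\<in>S. x \<otimes> y = y \<otimes> x)}"
  have "\<exists>M\<in>?A. \<forall>S\<in>?A. M \<subseteq> S \<longrightarrow> S = M"
  proof (rule subset_Zorn_nonempty)
    have "{a} \<in> ?A" using a by simp
    then show "?A \<noteq> {}" by blast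
    fix C assume C: "C \<noteq> {}" "subset.chain ?A C"
    then have CA: "C \<subseteq> ?A" and tot: "\<And>S T. S \<in> C \<Longrightarrow> T \<in> C \<Longrightarrow> S \<subseteq> T \<or> T \<subseteq> S"
      unfolding subset.chain_def by auto
    have "x \<otimes> y = y \<otimes> x" if x: "x \<in> \<Union>C" and y: "y \<in> \<Union>C" for x y
    proof -
      obtain S T where ST: "S \<in> C" "x \<in> S" "T \<in> C" "y \<in> T" using x y by blast
      then have "\<exists>U\<in>C. x \<in> U \<and> y \<in> U" using tot[OF ST(1,3)] by blast
      then show ?thesis using CA by blast
    qed
    moreover have "\<Union>C \<subseteq> carrier R" "a \<in> \<Union>C" using C(1) CA by blast+
    ultimately show "\<Union>C \<in> ?A" by simp
  qed
  then obtain M where M: "M \<subseteq> carrier R" "a \<in> M" "\<forall>x\<in>M. \<forall>y\<in>M. x \<otimes> y = y \<otimes> x"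
      and max: "\<And>S. S \<in> ?A \<Longrightarrow> M \<subseteq> S \<Longrightarrow> S = M" by auto
  have "centralizer M \<subseteq> M"
  proof
    fix x assume x: "x \<in> centralizer M"
    have "insert x M \<in> ?A" using M centralizerD[OF x] by auto
    then have "insert x M = M" by (rule max) blast
    then show "x \<in> M" by blast
  qed
  moreover have "M \<subseteq> centralizer M" using M unfolding centralizer_def by auto
  ultimately show ?thesis using M(2) by blast
qed

end

theorem theorem4p3:
  fixes D :: "('a, 'b) ring_scheme" (structure)
    and N :: "'a set"
    and d :: nat
  assumes "skew_field D"
    and "d > 0"
    and "subnormal N (units_of D)"
    and "\<not> N \<subseteq> ring_center D"
    and "\<And>a c. a \<in> N \<Longrightarrow> c \<in> carrier D \<Longrightarrow>
      ring.algebraic_deg_le D (ring_center D) d (a \<otimes> c \<ominus> c \<otimes> a)"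
  shows "\<exists>n\<le>d\<^sup>2. ring.dimension D n (ring_center D) (carrier D)"
proof -
  interpret skew_field D by fact
  obtain a where a: "a \<in> N" "a \<notin> ring_center D" using assms(4) by blast
  have "subgroup N (units_of D)"
    by (rule group.subnormal_imp_subgroup[OF units_group assms(3)])
  then have "N \<subseteq> Units D" using subgroup.subset[of N "units_of D"] by (simp add: units_of_carrier)
  then have ac: "a \<in> carrier D" using a(1) Units_closed by blast
  obtain K where K: "centralizer K = K" "a \<in> K" using exists_max_subfield[OF ac] by blast
  interpret max_subfield D K a by unfold_locales (fact K a)+
  let ?F = "ring_center D"
  have F: "subfield ?F D" by (rule ring_center_subfield)
  have alg: "algebraic_deg_le ?F d y" if "y \<in> commutators" for y
    using commutatorsE[OF that] assms(5)[OF a(1)] by auto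
  show ?thesis
  proof (cases "finite ?F")
    case False
    have "\<not> dim_ge (Suc d)"
      by (rule not_dim_ge_infinite[OF False assms(2)])
        (rule algebraic_relation[OF alg F commutators_carrier])
    then show ?thesis by (rule dimension_of_not_dim_ge)
  next
    case True
    define M :: nat where "M = Suc (fact (card ?F ^ d))"
    have "y [^] M = y" if "y \<in> commutators" for y
      unfolding M_def by (rule algebraic_power[OF alg[OF that] F True commutators_carrier[OF that]])
    moreover have "2 \<le> M" unfolding M_def using fact_ge_1[of "card ?F ^ d", where 'a = nat] by simp
    ultimately have "\<not> dim_ge (2 * Suc M)" by (rule not_dim_ge_power)
    then have "\<not> dim_ge (Suc (2 * M + 1))" by simp
    \<comment> \<open>The size of \<open>n\<close> does not matter: any finite dimension over the
      finite center makes \<open>D\<close> finite, which \<open>infinite_carrier\<close>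
      excludes.\<close>
    then obtain n where n: "dimension n ?F (carrier D)" using dimension_of_not_dim_ge by blast
    obtain Us where Us: "set Us \<subseteq> carrier D" "Span ?F Us = carrier D"
      using exists_base[OF F n] by blast
    have "finite (carrier D)" using finite_Span(1)[OF F True Us(1)] Us(2) by simp
    then show ?thesis using infinite_carrier by simp
  qed
qed

end
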